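(* Let $(R,\mathfrak m,k)$ be a commutative Noetherian local ring of Krull dimension $d$ and let $M$, $N$ be nonzero finitely generated $R$-modules. View $N$ as an $R\ltimes M$-module via the projection $R\ltimes M\to R$. (i) If $R$ satisfies the Buchsbaum-Eisenbud-Horrocks Conjecture and $N$ has finite length and finite projective dimension over $R$, then for all $1\leq i\leq \operatorname{depth}(R)$, $$\beta_{i}^{R\ltimes M}(N)\geq \binom{d}{i}.$$ (ii) If $R$ satisfies the Total Rank Conjecture and $N$ has finite length and finite projective dimension over $R$, then $$\sum_{i\geq 0}\beta_{i}^{R\ltimes M}(N)\geq 2^{d}.$$
   Context: For a commutative ring $R$ and an $R$-module $M$, the idealization $R\ltimes M$ is the commutative ring whose additive group is $R\oplus M$, with identity $(1,0)$ and multiplication $(r_1,m_1)(r_2,m_2)=(r_1r_2,\,r_1m_2+r_2m_1)$. If $(R,\mathfrak m,k)$ is Noetherian local and $M$ is finitely generated, then $R\ltimes M$ is a Noetherian local ring with maximal ideal $\mathfrak m\ltimes M$ and residue field $k$. The projection $R\ltimes M\to R$, $(r,m)\mapsto r$, is a ring homomorphism. For a Noetherian local ring $A$ with residue field $k$ and a finitely generated $A$-module $L$, $\beta_i^A(L)=\dim_k\operatorname{Tor}_i^A(L,k)$ is the $i$-th Betti number. An infinite sum of Betti numbers is taken in $\mathbb{N}\cup\{\infty\}$. A $d$-dimensional Noetherian local ring $R$ satisfies the Buchsbaum-Eisenbud-Horrocks Conjecture if every nonzero finitely generated $R$-module $L$ of finite length and finite projective dimension satisfies $\beta_i^R(L)\ge\binom{d}{i}$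 for each $i\ge 0$. It satisfies the Total Rank Conjecture if every such $L$ satisfies $\sum_{i\ge 0}\beta_i^R(L)\ge 2^d$. *)

theory Defs
  imports
    "HOL-Algebra.Ring_Divisibility"
    "HOL-Library.Extended_Real"
    "Jordan_Normal_Form.Missing_VectorSpace"
begin

text \<open>
  Modules are the records of \<^theory>\<open>HOL-Algebra.Module\<close>; their \<open>mult\<close> and \<open>one\<close> fields are
  never used and are filled with dummies below. The constants \<^const>\<open>submodule\<close>, \<^const>\<open>module_hom\<close>,
  \<^const>\<open>module.span\<close> and \<^const>\<open>vectorspace.dim\<close> are those of the VectorSpace library.
\<close>

section \<open>Local rings, Krull dimension, depth\<close>

locale noetherian_local_ring = cring R + noetherian_ring R for R (structure) +
  assumes local: "\<exists>!I. maximalideal I R"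

definition max_ideal :: "('a, 'r) ring_scheme \<Rightarrow> 'a set" where
  "max_ideal R = (THE I. maximalideal I R)"

definition residue_field :: "('a, 'r) ring_scheme \<Rightarrow> 'a set ring" where
  "residue_field R = R Quot max_ideal R"

definition krull_dim :: "('a, 'r) ring_scheme \<Rightarrow> enat" where
  "krull_dim R = Sup {enat n | n. \<exists>P :: nat \<Rightarrow> 'a set.
     (\<forall>i\<le>n. primeideal (P i) R) \<and> (\<forall>i<n. P i \<subset> P (Suc i))}"

text \<open>The middle condition says that \<open>xs ! i\<close> is a nonzerodivisor on \<open>R/(xs ! 0, \<dots>, xs ! (i - 1))\<close>.\<close>

definition regular_sequence :: "('a, 'r) ring_scheme \<Rightarrow> 'a list \<Rightarrow> bool" where
  "regular_sequence R xs \<longleftrightarrow>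
     set xs \<subseteq> carrier R \<and>
     (\<forall>i<length xs. \<forall>y\<in>carrier R.
        xs ! i \<otimes>\<^bsub>R\<^esub> y \<in> genideal R (set (take i xs)) \<longrightarrow> y \<in> genideal R (set (take i xs))) \<and>
     genideal R (set xs) \<noteq> carrier R"

definition depth :: "('a, 'r) ring_scheme \<Rightarrow> enat" where
  "depth R = Sup {enat (length xs) | xs. regular_sequence R xs \<and> set xs \<subseteq> max_ideal R}"


section \<open>Module constructions\<close>

definition finitely_generated :: "('a, 'r) ring_scheme \<Rightarrow> ('a, 'm) module \<Rightarrow> bool" where
  "finitely_generated R M \<longleftrightarrow>
     (\<exists>B. finite B \<and> B \<subseteq> carrier M \<and> module.span R M B = carrier M)"

definition module_length :: "('a, 'r) ring_scheme \<Rightarrow> ('a, 'm) module \<Rightarrow> enat" where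
  "module_length R M = Sup {enat n | n. \<exists>U :: nat \<Rightarrow> 'm set.
     (\<forall>i\<le>n. submodule R (U i) M) \<and> (\<forall>i<n. U i \<subset> U (Suc i))}"

definition finite_length :: "('a, 'r) ring_scheme \<Rightarrow> ('a, 'm) module \<Rightarrow> bool" where
  "finite_length R M \<longleftrightarrow> module_length R M < \<infinity>"

definition regular_module :: "('a, 'r) ring_scheme \<Rightarrow> ('a, 'a) module" where
  "regular_module R = \<lparr>carrier = carrier R, mult = mult R, one = one R,
     zero = zero R, add = add R, smult = mult R\<rparr>"

definition restrict_scalars :: "('a \<Rightarrow> 'b) \<Rightarrow> ('b, 'm) module \<Rightarrow> ('a, 'm) module" where
  "restrict_scalars f M = \<lparr>carrier = carrier M, mult = mult M, one = one M,
     zero = zero M, add = add M, smult = (\<lambda>a x. f a \<odot>\<^bsub>M\<^esub> x)\<rparr>"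

definition quotient_module :: "('a, 'm) module \<Rightarrow> 'm set \<Rightarrow> ('a, 'm set) module" where
  "quotient_module M U = \<lparr>carrier = a_rcosets\<^bsub>M\<^esub> U, mult = (\<lambda>_ _. U), one = U,
     zero = U, add = set_add M, smult = (\<lambda>a X. \<Union>x\<in>X. U +>\<^bsub>M\<^esub> (a \<odot>\<^bsub>M\<^esub> x))\<rparr>"

text \<open>The free module on the index set \<open>X\<close>: finitely supported functions, zero off \<open>X\<close>.\<close>

definition free_module :: "('a, 'r) ring_scheme \<Rightarrow> 'x set \<Rightarrow> ('a, 'x \<Rightarrow> 'a) module" where
  "free_module R X = \<lparr>
     carrier = {v. (\<forall>x\<in>X. v x \<in> carrier R) \<and> (\<forall>x. x \<notin> X \<longrightarrow> v x = \<zero>\<^bsub>R\<^esub>) \<and>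
                   finite {x. v x \<noteq> \<zero>\<^bsub>R\<^esub>}},
     mult = (\<lambda>_ _ _. \<zero>\<^bsub>R\<^esub>), one = (\<lambda>_. \<zero>\<^bsub>R\<^esub>), zero = (\<lambda>_. \<zero>\<^bsub>R\<^esub>),
     add = (\<lambda>v w x. v x \<oplus>\<^bsub>R\<^esub> w x), smult = (\<lambda>a v x. a \<otimes>\<^bsub>R\<^esub> v x)\<rparr>"

definition free_gen :: "('a, 'r) ring_scheme \<Rightarrow> 'x \<Rightarrow> 'x \<Rightarrow> 'a" where
  "free_gen R x = (\<lambda>y. if y = x then \<one>\<^bsub>R\<^esub> else \<zero>\<^bsub>R\<^esub>)"

text \<open>
  Projective here means: a direct summand (retract) of a free module. Index sets in the type \<open>'p\<close>
  suffice, since a projective \<open>P\<close> is a retract of the free module on \<open>carrier P\<close>.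
\<close>

definition projective_module :: "('a, 'r) ring_scheme \<Rightarrow> ('a, 'p) module \<Rightarrow> bool" where
  "projective_module R P \<longleftrightarrow> module R P \<and>
     (\<exists>X :: 'p set. \<exists>s \<in> module_hom R P (free_module R X). \<exists>r \<in> module_hom R (free_module R X) P.
        \<forall>x\<in>carrier P. r (s x) = x)"


section \<open>Tensor products\<close>

definition tensor_relations ::
    "('a, 'r) ring_scheme \<Rightarrow> ('a, 'm) module \<Rightarrow> ('a, 'n) module \<Rightarrow> ('m \<times> 'n \<Rightarrow> 'a) set" where
  "tensor_relations R M N = (let F = free_module R (carrier M \<times> carrier N); e = free_gen R in
     {e (x \<oplus>\<^bsub>M\<^esub> x', y) \<ominus>\<^bsub>F\<^esub> (e (x, y) \<oplus>\<^bsub>F\<^esub> e (x', y)) | x x' y.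
        x \<in> carrier M \<and> x' \<in> carrier M \<and> y \<in> carrier N} \<union>
     {e (x, y \<oplus>\<^bsub>N\<^esub> y') \<ominus>\<^bsub>F\<^esub> (e (x, y) \<oplus>\<^bsub>F\<^esub> e (x, y')) | x y y'.
        x \<in> carrier M \<and> y \<in> carrier N \<and> y' \<in> carrier N} \<union>
     {e (a \<odot>\<^bsub>M\<^esub> x, y) \<ominus>\<^bsub>F\<^esub> (a \<odot>\<^bsub>F\<^esub> e (x, y)) | a x y.
        a \<in> carrier R \<and> x \<in> carrier M \<and> y \<in> carrier N} \<union>
     {e (x, a \<odot>\<^bsub>N\<^esub> y) \<ominus>\<^bsub>F\<^esub> (a \<odot>\<^bsub>F\<^esub> e (x, y)) | a x y.
        a \<in> carrier R \<and> x \<in> carrier M \<and> y \<in> carrier N})"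

definition tensor_kernel ::
    "('a, 'r) ring_scheme \<Rightarrow> ('a, 'm) module \<Rightarrow> ('a, 'n) module \<Rightarrow> ('m \<times> 'n \<Rightarrow> 'a) set" where
  "tensor_kernel R M N =
     module.span R (free_module R (carrier M \<times> carrier N)) (tensor_relations R M N)"

definition tensor_product ::
    "('a, 'r) ring_scheme \<Rightarrow> ('a, 'm) module \<Rightarrow> ('a, 'n) module
      \<Rightarrow> ('a, ('m \<times> 'n \<Rightarrow> 'a) set) module" where
  "tensor_product R M N =
     quotient_module (free_module R (carrier M \<times> carrier N)) (tensor_kernel R M N)"

definition pure_tensor ::
    "('a, 'r) ring_scheme \<Rightarrow> ('a, 'm) module \<Rightarrow> ('a, 'n) module \<Rightarrow> 'm \<Rightarrow> 'n
      \<Rightarrow> ('m \<times> 'n \<Rightarrow> 'a) set" where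
  "pure_tensor R M N x y =
     tensor_kernel R M N +>\<^bsub>free_module R (carrier M \<times> carrier N)\<^esub> free_gen R (x, y)"

text \<open>
  The map induced by \<open>f : M \<rightarrow> M'\<close> on the tensor products with \<open>N\<close>. On the carrier it is unique,
  because the pure tensors generate.
\<close>

definition tensor_map ::
    "('a, 'r) ring_scheme \<Rightarrow> ('a, 'm) module \<Rightarrow> ('a, 'm2) module \<Rightarrow> ('a, 'n) module \<Rightarrow> ('m \<Rightarrow> 'm2)
      \<Rightarrow> ('m \<times> 'n \<Rightarrow> 'a) set \<Rightarrow> ('m2 \<times> 'n \<Rightarrow> 'a) set" where
  "tensor_map R M M' N f = (SOME h.
     h \<in> module_hom R (tensor_product R M N) (tensor_product R M' N) \<and>
     (\<forall>x\<in>carrier M. \<forall>y\<in>carrier N. h (pure_tensor R M N x y) = pure_tensor R M' N (f x) y))"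


section \<open>Resolutions, projective dimension, Tor, Betti numbers\<close>

text \<open>
  The differential \<open>d i\<close> goes from \<open>C i\<close> to \<open>C (i - 1)\<close> for \<open>i \<ge> 1\<close>; \<open>d 0\<close> is ignored.
\<close>

definition cycles :: "(nat \<Rightarrow> ('a, 'c) module) \<Rightarrow> (nat \<Rightarrow> 'c \<Rightarrow> 'c) \<Rightarrow> nat \<Rightarrow> 'c set" where
  "cycles C d i = {x \<in> carrier (C i). i \<noteq> 0 \<longrightarrow> d i x = \<zero>\<^bsub>C (i - 1)\<^esub>}"

definition boundaries :: "(nat \<Rightarrow> ('a, 'c) module) \<Rightarrow> (nat \<Rightarrow> 'c \<Rightarrow> 'c) \<Rightarrow> nat \<Rightarrow> 'c set" where
  "boundaries C d i = d (Suc i) ` carrier (C (Suc i))"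

definition homology ::
    "(nat \<Rightarrow> ('a, 'c) module) \<Rightarrow> (nat \<Rightarrow> 'c \<Rightarrow> 'c) \<Rightarrow> nat \<Rightarrow> ('a, 'c set) module" where
  "homology C d i = quotient_module ((C i)\<lparr>carrier := cycles C d i\<rparr>) (boundaries C d i)"

definition projective_resolution ::
    "('a, 'r) ring_scheme \<Rightarrow> ('a, 'l) module \<Rightarrow> (nat \<Rightarrow> ('a, 'p) module) \<Rightarrow> (nat \<Rightarrow> 'p \<Rightarrow> 'p)
      \<Rightarrow> ('p \<Rightarrow> 'l) \<Rightarrow> bool" where
  "projective_resolution R L P d \<epsilon> \<longleftrightarrow>
     (\<forall>i. projective_module R (P i)) \<and>
     (\<forall>i. d (Suc i) \<in> module_hom R (P (Suc i)) (P i)) \<and>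
     \<epsilon> \<in> module_hom R (P 0) L \<and>
     \<epsilon> ` carrier (P 0) = carrier L \<and>
     boundaries P d 0 = {x \<in> carrier (P 0). \<epsilon> x = \<zero>\<^bsub>L\<^esub>} \<and>
     (\<forall>i. boundaries P d (Suc i) = cycles P d (Suc i))"

text \<open>
  Over a Noetherian ring a finitely generated module has a resolution by modules \<open>R\<^sup>n\<close>. If its
  projective dimension is \<open>n\<close>, this can be cut off at the \<open>n\<close>-th syzygy, which is finitely generated
  projective and so isomorphic to a submodule of some \<open>R\<^sup>m\<close>. All of these live on subsets of the type
  \<open>nat \<Rightarrow> 'a\<close>, so for such modules it is no restriction to take the resolutions in that type.
\<close>

definition proj_dim :: "('a, 'r) ring_scheme \<Rightarrow> ('a, 'l) module \<Rightarrow> enat" where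
  "proj_dim R L = Inf {enat n | n.
     \<exists>(P :: nat \<Rightarrow> ('a, nat \<Rightarrow> 'a) module) d \<epsilon>.
       projective_resolution R L P d \<epsilon> \<and> (\<forall>i>n. carrier (P i) = {\<zero>\<^bsub>P i\<^esub>})}"

definition some_resolution ::
    "('a, 'r) ring_scheme \<Rightarrow> ('a, 'l) module
      \<Rightarrow> (nat \<Rightarrow> ('a, nat \<Rightarrow> 'a) module) \<times> (nat \<Rightarrow> (nat \<Rightarrow> 'a) \<Rightarrow> (nat \<Rightarrow> 'a))" where
  "some_resolution R L = (SOME C. \<exists>\<epsilon>. projective_resolution R L (fst C) (snd C) \<epsilon>)"

definition Tor ::
    "('a, 'r) ring_scheme \<Rightarrow> nat \<Rightarrow> ('a, 'l) module \<Rightarrow> ('a, 'k) module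
      \<Rightarrow> ('a, ((nat \<Rightarrow> 'a) \<times> 'k \<Rightarrow> 'a) set set) module" where
  "Tor R i L K = (let P = fst (some_resolution R L); d = snd (some_resolution R L) in
     homology (\<lambda>j. tensor_product R (P j) K) (\<lambda>j. tensor_map R (P j) (P (j - 1)) K (d j)) i)"

definition residue_module :: "('a, 'r) ring_scheme \<Rightarrow> ('a, 'a set) module" where
  "residue_module R =
     restrict_scalars (\<lambda>a. max_ideal R +>\<^bsub>R\<^esub> a) (regular_module (residue_field R))"

text \<open>
  An \<open>R\<close>-module annihilated by the maximal ideal, such as \<open>Tor\<close> with values in the residue field,
  viewed as a vector space over the residue field: a coset acts through any of its representatives.
\<close>

definition residue_space ::
    "('a, 'r) ring_scheme \<Rightarrow> ('a, 't) module \<Rightarrow> ('a set, 't) module" where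
  "residue_space R T = restrict_scalars (\<lambda>X. SOME a. a \<in> X) T"

definition betti :: "('a, 'r) ring_scheme \<Rightarrow> nat \<Rightarrow> ('a, 'l) module \<Rightarrow> nat" where
  "betti R i L =
     vectorspace.dim (residue_field R) (residue_space R (Tor R i L (residue_module R)))"


section \<open>The two conjectures and the idealization\<close>

text \<open>
  Every finitely generated \<open>R\<close>-module is isomorphic to a quotient of some \<open>R\<^sup>n\<close> and hence to a module
  whose elements are of type \<open>(nat \<Rightarrow> 'a) set\<close>. Quantifying over the modules in this one type
  therefore amounts to quantifying over all finitely generated \<open>R\<close>-modules.
\<close>

definition BEH_conjecture :: "('a, 'r) ring_scheme \<Rightarrow> bool" where
  "BEH_conjecture R \<longleftrightarrow> (\<forall>d. krull_dim R = enat d \<longrightarrow>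
     (\<forall>L :: ('a, (nat \<Rightarrow> 'a) set) module.
        module R L \<and> carrier L \<noteq> {\<zero>\<^bsub>L\<^esub>} \<and> finitely_generated R L \<and>
        finite_length R L \<and> proj_dim R L < \<infinity> \<longrightarrow>
        (\<forall>i. betti R i L \<ge> d choose i)))"

definition total_rank_conjecture :: "('a, 'r) ring_scheme \<Rightarrow> bool" where
  "total_rank_conjecture R \<longleftrightarrow> (\<forall>d. krull_dim R = enat d \<longrightarrow>
     (\<forall>L :: ('a, (nat \<Rightarrow> 'a) set) module.
        module R L \<and> carrier L \<noteq> {\<zero>\<^bsub>L\<^esub>} \<and> finitely_generated R L \<and>
        finite_length R L \<and> proj_dim R L < \<infinity> \<longrightarrow>
        (\<Sum>i. enat (betti R i L)) \<ge> 2 ^ d))"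

definition idealization ::
    "('a, 'r) ring_scheme \<Rightarrow> ('a, 'm) module \<Rightarrow> ('a \<times> 'm) ring" (infixl \<open>\<ltimes>\<close> 65) where
  "R \<ltimes> M = \<lparr>carrier = carrier R \<times> carrier M,
     mult = (\<lambda>(r, m) (s, n). (r \<otimes>\<^bsub>R\<^esub> s, r \<odot>\<^bsub>M\<^esub> n \<oplus>\<^bsub>M\<^esub> s \<odot>\<^bsub>M\<^esub> m)),
     one = (\<one>\<^bsub>R\<^esub>, \<zero>\<^bsub>M\<^esub>),
     zero = (\<zero>\<^bsub>R\<^esub>, \<zero>\<^bsub>M\<^esub>),
     add = (\<lambda>(r, m) (s, n). (r \<oplus>\<^bsub>R\<^esub> s, m \<oplus>\<^bsub>M\<^esub> n))\<rparr>"

end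

theory Submission
  imports Defs
begin

text \<open>
  The inclusion \<open>R \<rightarrow> R \<ltimes> M\<close> and the projection \<open>R \<ltimes> M \<rightarrow> R\<close> compose to the identity of \<open>R\<close>. Since
  \<open>Tor\<close> is functorial in the ring, \<open>Tor\<^sub>i(N, k)\<close> over \<open>R\<close> is a retract of \<open>Tor\<^sub>i(N, k)\<close> over
  \<open>R \<ltimes> M\<close>, so the Betti numbers of \<open>N\<close> can only grow on passing from \<open>R\<close> to \<open>R \<ltimes> M\<close>, and the
  two conjectures for \<open>R\<close> give the bounds. On resolutions \<open>P\<close> over \<open>R\<close> and \<open>Q\<close> over \<open>R \<ltimes> M\<close> the
  retraction is a composite of chain maps \<open>P \<rightarrow> Q \<rightarrow> P\<close> lifting the identity of \<open>N\<close>, which is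
  homotopic to the identity. As \<open>dim\<close> is a least cardinality of a generating set, without meaning in the
  infinite-dimensional case, finiteness of the Betti numbers over \<open>R \<ltimes> M\<close> is needed as well; it comes
  from a resolution by finitely generated free modules.
\<close>

section \<open>Homomorphisms, quotients and restriction of scalars\<close>

text \<open>\<open>Tor\<close> over R and \<open>Tor\<close> over \<open>R \<ltimes> M\<close> are
  vector spaces over residue fields of different types, so no single linear map between them
  compares their dimensions. A generating set of \<open>Tor\<close> is therefore replaced by a
  finite set of elements of the resolution which, together with the boundaries and the multiples by
  the maximal ideal, generates all elements that become cycles modulo that ideal
  (\<open>homology_generators\<close>). Such sets can be pushed along chain maps, and a Betti number
  is the least cardinality of one, when one exists. A second obstacle is that \<open>Tor\<close>
  uses an arbitrarily chosen projective resolution, whose terms need not be finitely generated.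
  Finiteness reaches it from the free resolution by the same retraction argument, with the identity
  of \<open>R \<ltimes> M\<close> in place of both ring maps. Finally, the conjectures quantify over
  modules with elements in one fixed type, so N is exchanged for an isomorphic copy there.\<close>

lemma module_homI:
  assumes "\<And>x. x \<in> carrier M \<Longrightarrow> f x \<in> carrier N"
    and "\<And>x y. x \<in> carrier M \<Longrightarrow> y \<in> carrier M \<Longrightarrow> f (x \<oplus>\<^bsub>M\<^esub> y) = f x \<oplus>\<^bsub>N\<^esub> f y"
    and "\<And>a x. a \<in> carrier R \<Longrightarrow> x \<in> carrier M \<Longrightarrow> f (a \<odot>\<^bsub>M\<^esub> x) = a \<odot>\<^bsub>N\<^esub> f x"
  shows "f \<in> module_hom R M N"
  using assms unfolding module_hom_def by auto

lemma module_homD: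
  assumes "f \<in> module_hom R M N"
  shows "x \<in> carrier M \<Longrightarrow> f x \<in> carrier N"
    and "x \<in> carrier M \<Longrightarrow> y \<in> carrier M \<Longrightarrow> f (x \<oplus>\<^bsub>M\<^esub> y) = f x \<oplus>\<^bsub>N\<^esub> f y"
    and "a \<in> carrier R \<Longrightarrow> x \<in> carrier M \<Longrightarrow> f (a \<odot>\<^bsub>M\<^esub> x) = a \<odot>\<^bsub>N\<^esub> f x"
  using assms unfolding module_hom_def by auto

lemma mod_homI: "module R M \<Longrightarrow> module R N \<Longrightarrow> f \<in> module_hom R M N \<Longrightarrow> mod_hom R M N f"
  by (simp add: mod_hom_def mod_hom_axioms_def)

lemma module_hom_comp:
  assumes f: "f \<in> module_hom R M N" and g: "g \<in> module_hom R N P"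
  shows "(\<lambda>x. g (f x)) \<in> module_hom R M P"
  by (rule module_homI) (simp_all add: module_homD[OF f] module_homD[OF g])

lemma module_hom_minus:
  assumes "module R M" "module R N" "f \<in> module_hom R M N" "g \<in> module_hom R M N"
  shows "(\<lambda>x. f x \<ominus>\<^bsub>N\<^esub> g x) \<in> module_hom R M N"
proof -
  interpret f: mod_hom R M N f using assms by (intro mod_homI)
  interpret g: mod_hom R M N g using assms by (intro mod_homI)
  show ?thesis
  proof (rule module_homI)
    fix x y assume "x \<in> carrier M" "y \<in> carrier M"
    then show "f (x \<oplus>\<^bsub>M\<^esub> y) \<ominus>\<^bsub>N\<^esub> g (x \<oplus>\<^bsub>M\<^esub> y) = f x \<ominus>\<^bsub>N\<^esub> g x \<oplus>\<^bsub>N\<^esub> (f y \<ominus>\<^bsub>N\<^esub> g y)"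
      by (simp add: a_minus_def f.N.M.minus_add f.N.M.a_ac)
  next
    fix a x assume "a \<in> carrier R" "x \<in> carrier M"
    then show "f (a \<odot>\<^bsub>M\<^esub> x) \<ominus>\<^bsub>N\<^esub> g (a \<odot>\<^bsub>M\<^esub> x) = a \<odot>\<^bsub>N\<^esub> (f x \<ominus>\<^bsub>N\<^esub> g x)"
      by (simp add: a_minus_def f.N.smult_r_distr f.N.smult_r_minus)
  qed simp
qed

section \<open>Submodules, their images and preimages\<close>

lemma submodule_intro:
  assumes "module R M" "U \<subseteq> carrier M" "\<zero>\<^bsub>M\<^esub> \<in> U"
    and "\<And>x y. x \<in> U \<Longrightarrow> y \<in> U \<Longrightarrow> x \<oplus>\<^bsub>M\<^esub> y \<in> U"
    and "\<And>a x. a \<in> carrier R \<Longrightarrow> x \<in> U \<Longrightarrow> a \<odot>\<^bsub>M\<^esub> x \<in> U"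
  shows "submodule R U M"
  using assms by (auto simp: submodule_def)

lemma submodule_uminus:
  assumes "submodule R U M" "x \<in> U"
  shows "\<ominus>\<^bsub>M\<^esub> x \<in> U"
proof -
  interpret M: module R M using assms(1) by (rule submodule.module)
  interpret U: submodule R U M by fact
  have "(\<ominus>\<^bsub>R\<^esub> \<one>\<^bsub>R\<^esub>) \<odot>\<^bsub>M\<^esub> x \<in> U" using assms(2) by simp
  moreover have "x \<in> carrier M" using assms(2) U.subset by auto
  ultimately show ?thesis using M.smult_minus_1 by simp
qed

lemma submodule_minus:
  assumes "submodule R U M" "x \<in> U" "y \<in> U"
  shows "x \<ominus>\<^bsub>M\<^esub> y \<in> U"
  unfolding a_minus_def using assms by (simp add: submodule.m_closed submodule_uminus)

lemma submodule_carrier: "module R M \<Longrightarrow> submodule R (carrier M) M"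
proof -
  assume "module R M"
  then interpret module R M .
  show ?thesis by (rule submodule_intro) (auto simp: module_axioms)
qed

lemma submodule_of_subset:
  assumes U: "submodule R U M" and V: "submodule R V M" and "U \<subseteq> V"
  shows "submodule R U (M\<lparr>carrier := V\<rparr>)"
proof -
  interpret M: module R M using U by (rule submodule.module)
  interpret U: submodule R U M by fact
  show ?thesis using \<open>U \<subseteq> V\<close>
    by (intro submodule_intro M.submodule_is_module V) auto
qed

context mod_hom
begin

lemma submodule_vimage:
  assumes "submodule R U N"
  shows "submodule R {x \<in> carrier M. f x \<in> U} M"
proof -
  interpret U: submodule R U N by fact
  show ?thesis by (rule submodule_intro) (auto simp: M.module_axioms)
qed

lemma submodule_image:
  assumes "submodule R U M"
  shows "submodule R (f ` U) N"
proof -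
  interpret U: submodule R U M by fact
  have s: "x \<in> carrier M" if "x \<in> U" for x using U.subset that by auto
  show ?thesis
  proof (rule submodule_intro)
    show "f ` U \<subseteq> carrier N" using s by auto
    show "\<zero>\<^bsub>N\<^esub> \<in> f ` U" by (rule image_eqI[where f = f and x = "\<zero>\<^bsub>M\<^esub>"]) simp_all
  next
    fix x y assume "x \<in> f ` U" "y \<in> f ` U"
    then obtain x' y' where x': "x' \<in> U" "x = f x'" and y': "y' \<in> U" "y = f y'" by blast
    then have "x \<oplus>\<^bsub>N\<^esub> y = f (x' \<oplus>\<^bsub>M\<^esub> y')" by (simp add: s)
    then show "x \<oplus>\<^bsub>N\<^esub> y \<in> f ` U" using U.m_closed[OF x'(1) y'(1)] by (rule image_eqI)
  next
    fix a x assume a: "a \<in> carrier R" and "x \<in> f ` U"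
    then obtain x' where x': "x' \<in> U" "x = f x'" by blast
    then have "a \<odot>\<^bsub>N\<^esub> x = f (a \<odot>\<^bsub>M\<^esub> x')" using a by (simp add: s)
    then show "a \<odot>\<^bsub>N\<^esub> x \<in> f ` U" using U.smult_closed[OF a x'(1)] by (rule image_eqI)
  qed (rule N.module_axioms)
qed

text \<open>Any preimage under \<open>p\<close> serves to define \<open>h\<close>: two of them
  differ by an element killed by \<open>p\<close>, hence by \<open>f\<close>. Used both to extend
  bilinear maps to tensor products and to identify R^n modulo a kernel with its image.\<close>

lemma factor_through:
  assumes Q: "module R Q" and p: "p \<in> module_hom R M Q" "p ` carrier M = carrier Q"
    and ker: "\<And>x. x \<in> carrier M \<Longrightarrow> p x = \<zero>\<^bsub>Q\<^esub> \<Longrightarrow> f x = \<zero>\<^bsub>N\<^esub>"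
  obtains h where "h \<in> module_hom R Q N" "\<forall>x\<in>carrier M. h (p x) = f x"
proof -
  interpret p: mod_hom R M Q p using M.module_axioms Q p(1) by (rule mod_homI)
  have eq: "f x = f y" if "x \<in> carrier M" "y \<in> carrier M" "p x = p y" for x y
  proof -
    have "p (x \<ominus>\<^bsub>M\<^esub> y) = \<zero>\<^bsub>Q\<^esub>" using that by simp
    then have "f (x \<ominus>\<^bsub>M\<^esub> y) = \<zero>\<^bsub>N\<^esub>" using ker that by simp
    then show ?thesis using that by simp
  qed
  define h where "h y = f (SOME x. x \<in> carrier M \<and> p x = y)" for y
  have h: "h (p x) = f x" if x: "x \<in> carrier M" for x
  proof -
    let ?x = "SOME z. z \<in> carrier M \<and> p z = p x"
    have "\<exists>z. z \<in> carrier M \<and> p z = p x" using x by blast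
    from someI_ex[OF this]
    show ?thesis unfolding h_def using eq[of ?x x] x by blast
  qed
  have "h \<in> module_hom R Q N"
  proof (rule module_homI)
    fix x assume "x \<in> carrier Q"
    then obtain x' where "x' \<in> carrier M" "x = p x'" using p(2) by (metis imageE)
    then show "h x \<in> carrier N" by (simp add: h)
  next
    fix x y assume "x \<in> carrier Q" "y \<in> carrier Q"
    then obtain x' y' where x': "x' \<in> carrier M" "x = p x'" and y': "y' \<in> carrier M" "y = p y'"
      using p(2) by (metis imageE)
    then have "h (x \<oplus>\<^bsub>Q\<^esub> y) = h (p (x' \<oplus>\<^bsub>M\<^esub> y'))" by simp
    also have "\<dots> = f (x' \<oplus>\<^bsub>M\<^esub> y')" using x' y' by (intro h) simp
    finally show "h (x \<oplus>\<^bsub>Q\<^esub> y) = h x \<oplus>\<^bsub>N\<^esub> h y" using x' y' by (simp add: h)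
  next
    fix a x assume a: "a \<in> carrier R" and "x \<in> carrier Q"
    then obtain x' where x': "x' \<in> carrier M" "x = p x'" using p(2) by (metis imageE)
    then have "h (a \<odot>\<^bsub>Q\<^esub> x) = h (p (a \<odot>\<^bsub>M\<^esub> x'))" using a by simp
    also have "\<dots> = f (a \<odot>\<^bsub>M\<^esub> x')" using x' a by (intro h) simp
    finally show "h (a \<odot>\<^bsub>Q\<^esub> x) = a \<odot>\<^bsub>N\<^esub> h x" using x' a by (simp add: h)
  qed
  moreover have "\<forall>x\<in>carrier M. h (p x) = f x" using h by blast
  ultimately show ?thesis by (rule that)
qed

end

text \<open>The module axioms are equations, closure conditions and the existence of negatives, and
  they pass to \<open>Q\<close> because all its elements are values of \<open>p\<close>. Nothing is
  known of \<open>Q\<close> beforehand, so the zero field of the record has to be tied to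
  \<open>p\<close> by a separate assumption. Supplies the axioms for quotients, for the residue
  field and, in \<open>chain_map_lift\<close>, for the resolved module.\<close>

lemma module_surj_image:
  assumes "module R M" and p: "p \<in> module_hom R M Q" and surj: "p ` carrier M = carrier Q"
    and zero: "p \<zero>\<^bsub>M\<^esub> = \<zero>\<^bsub>Q\<^esub>"
  shows "module R Q"
proof -
  interpret M: module R M by fact
  note p' = module_homD[OF p]
  \<comment> \<open>Reduces statements about elements of \<open>Q\<close> to values of
    \<open>p\<close>; nested uses treat several variables.\<close>
  have all: "\<forall>x \<in> carrier Q. P x" if "\<And>x. x \<in> carrier M \<Longrightarrow> P (p x)" for P
    using that surj by (metis imageE)
  have clos: "\<forall>x \<in> carrier Q. \<forall>y \<in> carrier Q. x \<oplus>\<^bsub>Q\<^esub> y \<in> carrier Q"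
    by (intro all) (simp add: p'(1) flip: p'(2))
  have inv: "\<forall>x \<in> carrier Q. \<exists>y \<in> carrier Q. y \<oplus>\<^bsub>Q\<^esub> x = \<zero>\<^bsub>Q\<^esub>"
  proof (intro all)
    fix x assume "x \<in> carrier M"
    then show "\<exists>y\<in>carrier Q. y \<oplus>\<^bsub>Q\<^esub> p x = \<zero>\<^bsub>Q\<^esub>"
      by (intro bexI[of _ "p (\<ominus>\<^bsub>M\<^esub> x)"]) (simp_all add: p'(1) M.M.l_neg zero flip: p'(2))
  qed
  have comm: "\<forall>x \<in> carrier Q. \<forall>y \<in> carrier Q. x \<oplus>\<^bsub>Q\<^esub> y = y \<oplus>\<^bsub>Q\<^esub> x"
    by (intro all) (simp add: M.M.a_comm flip: p'(2))
  have assoc: "\<forall>x \<in> carrier Q. \<forall>y \<in> carrier Q. \<forall>z \<in> carrier Q.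
      x \<oplus>\<^bsub>Q\<^esub> y \<oplus>\<^bsub>Q\<^esub> z = x \<oplus>\<^bsub>Q\<^esub> (y \<oplus>\<^bsub>Q\<^esub> z)"
    by (intro all) (simp add: M.M.a_assoc flip: p'(2))
  have zero': "\<forall>x \<in> carrier Q. \<zero>\<^bsub>Q\<^esub> \<oplus>\<^bsub>Q\<^esub> x = x"
    by (intro all) (simp flip: p'(2) zero)
  have scl: "\<forall>x \<in> carrier Q. \<forall>a \<in> carrier R. a \<odot>\<^bsub>Q\<^esub> x \<in> carrier Q"
    by (intro all ballI) (simp add: p'(1) flip: p'(3))
  have ld: "\<forall>x \<in> carrier Q. \<forall>a \<in> carrier R. \<forall>b \<in> carrier R.
      (a \<oplus>\<^bsub>R\<^esub> b) \<odot>\<^bsub>Q\<^esub> x = a \<odot>\<^bsub>Q\<^esub> x \<oplus>\<^bsub>Q\<^esub> b \<odot>\<^bsub>Q\<^esub> x"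
    by (intro all ballI) (simp add: M.smult_l_distr flip: p'(2,3))
  have rd: "\<forall>x \<in> carrier Q. \<forall>y \<in> carrier Q. \<forall>a \<in> carrier R.
      a \<odot>\<^bsub>Q\<^esub> (x \<oplus>\<^bsub>Q\<^esub> y) = a \<odot>\<^bsub>Q\<^esub> x \<oplus>\<^bsub>Q\<^esub> a \<odot>\<^bsub>Q\<^esub> y"
    by (intro all ballI) (simp add: M.smult_r_distr flip: p'(2,3))
  have sa: "\<forall>x \<in> carrier Q. \<forall>a \<in> carrier R. \<forall>b \<in> carrier R.
      (a \<otimes>\<^bsub>R\<^esub> b) \<odot>\<^bsub>Q\<^esub> x = a \<odot>\<^bsub>Q\<^esub> (b \<odot>\<^bsub>Q\<^esub> x)"
    by (intro all ballI) (simp add: M.smult_assoc1 flip: p'(3))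
  have one: "\<forall>x \<in> carrier Q. \<one>\<^bsub>R\<^esub> \<odot>\<^bsub>Q\<^esub> x = x"
    by (intro all) (simp flip: p'(3))
  have "\<zero>\<^bsub>Q\<^esub> \<in> carrier Q" using p'(1)[OF M.M.zero_closed] zero by simp
  then have "abelian_group Q"
    using clos inv comm assoc zero' by (intro abelian_groupI) auto
  then show ?thesis
    using M.R.is_cring scl ld rd sa one by (intro moduleI) auto
qed

section \<open>Quotient modules\<close>

lemma quotient_module_sel [simp]:
  "carrier (quotient_module M U) = a_rcosets\<^bsub>M\<^esub> U" "\<zero>\<^bsub>quotient_module M U\<^esub> = U"
  "X \<oplus>\<^bsub>quotient_module M U\<^esub> Y = X <+>\<^bsub>M\<^esub> Y"
  "a \<odot>\<^bsub>quotient_module M U\<^esub> X = (\<Union>x\<in>X. U +>\<^bsub>M\<^esub> (a \<odot>\<^bsub>M\<^esub> x))"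
  by (auto simp: quotient_module_def)

lemma abelian_subgroup_of_submodule:
  assumes "submodule R U M" shows "abelian_subgroup U M"
proof -
  interpret M: module R M using assms by (rule submodule.module)
  interpret U: submodule R U M by fact
  show ?thesis
  proof (rule abelian_subgroupI3)
    have "subgroup U (add_monoid M)"
    proof (rule subgroup.intro)
      show "inv\<^bsub>add_monoid M\<^esub> x \<in> U" if "x \<in> U" for x
        using submodule_uminus[OF assms that] by (simp add: a_inv_def)
    qed (use U.subset in simp_all)
    then show "additive_subgroup U M" by (rule additive_subgroup.intro)
  qed (rule M.M.abelian_group_axioms)
qed

lemma mem_a_r_coset: "y \<in> U +>\<^bsub>M\<^esub> x \<longleftrightarrow> (\<exists>u \<in> U. y = u \<oplus>\<^bsub>M\<^esub> x)"
  by (auto simp: a_r_coset_def')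

lemma
  assumes "submodule R U M"
  shows quotient_proj_hom: "(\<lambda>x. U +>\<^bsub>M\<^esub> x) \<in> module_hom R M (quotient_module M U)"
    and quotient_proj_surj: "(\<lambda>x. U +>\<^bsub>M\<^esub> x) ` carrier M = carrier (quotient_module M U)"
    and quotient_module_module: "module R (quotient_module M U)"
    and quotient_proj_zero_iff: "x \<in> carrier M \<Longrightarrow> U +>\<^bsub>M\<^esub> x = \<zero>\<^bsub>quotient_module M U\<^esub> \<longleftrightarrow> x \<in> U"
proof -
  interpret M: module R M using assms by (rule submodule.module)
  interpret U: submodule R U M by fact
  interpret A: abelian_subgroup U M using assms by (rule abelian_subgroup_of_submodule)
  show surj: "(\<lambda>x. U +>\<^bsub>M\<^esub> x) ` carrier M = carrier (quotient_module M U)"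
    by (auto simp: A_RCOSETS_def' a_r_coset_def')
  show zero: "U +>\<^bsub>M\<^esub> x = \<zero>\<^bsub>quotient_module M U\<^esub> \<longleftrightarrow> x \<in> U" if "x \<in> carrier M" for x
    using that A.a_rcos_const A.a_rcos_self by auto
  show hom: "(\<lambda>x. U +>\<^bsub>M\<^esub> x) \<in> module_hom R M (quotient_module M U)"
  proof (rule module_homI)
    fix x assume "x \<in> carrier M"
    then show "U +>\<^bsub>M\<^esub> x \<in> carrier (quotient_module M U)" using surj by blast
  next
    fix x y assume "x \<in> carrier M" "y \<in> carrier M"
    then show "U +>\<^bsub>M\<^esub> (x \<oplus>\<^bsub>M\<^esub> y) = (U +>\<^bsub>M\<^esub> x) \<oplus>\<^bsub>quotient_module M U\<^esub> (U +>\<^bsub>M\<^esub> y)"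
      by (simp add: A.a_rcos_sum)
  next
    fix a x assume a: "a \<in> carrier R" and x: "x \<in> carrier M"
    \<comment> \<open>A scalar multiple of a coset is defined as a union over all members of the
      coset. Each member contributes the same coset, so the union collapses.\<close>
    have "U +>\<^bsub>M\<^esub> (a \<odot>\<^bsub>M\<^esub> y) = U +>\<^bsub>M\<^esub> (a \<odot>\<^bsub>M\<^esub> x)" if y: "y \<in> U +>\<^bsub>M\<^esub> x" for y
    proof -
      obtain u where u: "u \<in> U" "y = u \<oplus>\<^bsub>M\<^esub> x" using y by (auto simp: mem_a_r_coset)
      then have "a \<odot>\<^bsub>M\<^esub> y = a \<odot>\<^bsub>M\<^esub> u \<oplus>\<^bsub>M\<^esub> a \<odot>\<^bsub>M\<^esub> x"
        using U.subset a x by (simp add: M.smult_r_distr subset_eq)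
      then have "a \<odot>\<^bsub>M\<^esub> y \<in> U +>\<^bsub>M\<^esub> (a \<odot>\<^bsub>M\<^esub> x)"
        using U.smult_closed[OF a u(1)] unfolding mem_a_r_coset by blast
      then show ?thesis using M.M.a_repr_independence[OF _ _ A.a_subgroup] a x by simp
    qed
    moreover have "x \<in> U +>\<^bsub>M\<^esub> x" using x A.a_rcos_self by auto
    ultimately have "(\<Union>y\<in>U +>\<^bsub>M\<^esub> x. U +>\<^bsub>M\<^esub> (a \<odot>\<^bsub>M\<^esub> y)) = U +>\<^bsub>M\<^esub> (a \<odot>\<^bsub>M\<^esub> x)" by blast
    then show "U +>\<^bsub>M\<^esub> (a \<odot>\<^bsub>M\<^esub> x) = a \<odot>\<^bsub>quotient_module M U\<^esub> (U +>\<^bsub>M\<^esub> x)" by simp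
  qed
  show "module R (quotient_module M U)"
    by (rule module_surj_image[OF M.module_axioms hom surj]) (simp add: zero del: quotient_module_sel)
qed

section \<open>Restriction of scalars along a ring homomorphism\<close>

lemma restrict_scalars_sel [simp]:
  "carrier (restrict_scalars h M) = carrier M" "\<zero>\<^bsub>restrict_scalars h M\<^esub> = \<zero>\<^bsub>M\<^esub>"
  "x \<oplus>\<^bsub>restrict_scalars h M\<^esub> y = x \<oplus>\<^bsub>M\<^esub> y" "a \<odot>\<^bsub>restrict_scalars h M\<^esub> x = h a \<odot>\<^bsub>M\<^esub> x"
  by (auto simp: restrict_scalars_def)

lemma restrict_scalars_module:
  assumes "h \<in> ring_hom A B" "cring A" "module B M"
  shows "module A (restrict_scalars h M)"
proof -
  interpret M: module B M by fact
  note h = ring_hom_memE[OF assms(1)]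
  have "abelian_group (restrict_scalars h M)"
    by (rule abelian_groupI) (auto simp: M.M.a_ac intro: M.M.l_neg bexI[of _ "\<ominus>\<^bsub>M\<^esub> _"])
  with assms(2) show ?thesis
    by (rule moduleI) (simp_all add: h M.smult_l_distr M.smult_r_distr M.smult_assoc1)
qed

lemma restrict_scalars_hom:
  "h \<in> ring_hom A B \<Longrightarrow> f \<in> module_hom B M N \<Longrightarrow>
    f \<in> module_hom A (restrict_scalars h M) (restrict_scalars h N)"
  using ring_hom_memE(1)[of h A B] by (auto simp: module_hom_def)

section \<open>Free and projective modules\<close>

lemma free_module_sel [simp]:
  "v \<in> carrier (free_module R X) \<longleftrightarrow> (\<forall>x\<in>X. v x \<in> carrier R) \<and> (\<forall>x. x \<notin> X \<longrightarrow> v x = \<zero>\<^bsub>R\<^esub>) \<and>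
     finite {x. v x \<noteq> \<zero>\<^bsub>R\<^esub>}"
  "\<zero>\<^bsub>free_module R X\<^esub> = (\<lambda>_. \<zero>\<^bsub>R\<^esub>)"
  "v \<oplus>\<^bsub>free_module R X\<^esub> w = (\<lambda>x. v x \<oplus>\<^bsub>R\<^esub> w x)"
  "a \<odot>\<^bsub>free_module R X\<^esub> v = (\<lambda>x. a \<otimes>\<^bsub>R\<^esub> v x)"
  by (auto simp: free_module_def)

context cring
begin

text \<open>Covers indices outside \<open>X\<close> too, where the value is zero, and so spares
  later computations a case distinction.\<close>

lemma free_module_closed:
  assumes "v \<in> carrier (free_module R X)" shows "v x \<in> carrier R"
  using assms by (cases "x \<in> X") auto

lemma free_module_module: "module R (free_module R X)"
proof -
  have "abelian_group (free_module R X)"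
  proof (rule abelian_groupI)
    fix v w assume v: "v \<in> carrier (free_module R X)" and w: "w \<in> carrier (free_module R X)"
    have "{x. v x \<oplus> w x \<noteq> \<zero>} \<subseteq> {x. v x \<noteq> \<zero>} \<union> {x. w x \<noteq> \<zero>}" by auto
    then have "finite {x. v x \<oplus> w x \<noteq> \<zero>}" by (rule finite_subset) (use v w in simp)
    then show "v \<oplus>\<^bsub>free_module R X\<^esub> w \<in> carrier (free_module R X)" using v w by simp
    show "v \<oplus>\<^bsub>free_module R X\<^esub> w = w \<oplus>\<^bsub>free_module R X\<^esub> v"
      using free_module_closed[OF v] free_module_closed[OF w] by (auto simp: a_comm)
    fix u assume u: "u \<in> carrier (free_module R X)"
    show "v \<oplus>\<^bsub>free_module R X\<^esub> w \<oplus>\<^bsub>free_module R X\<^esub> u = v \<oplus>\<^bsub>free_module R X\<^esub> (w \<oplus>\<^bsub>free_module R X\<^esub> u)"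
      using free_module_closed[OF v] free_module_closed[OF w] free_module_closed[OF u]
      by (simp add: a_assoc)
  next
    fix v assume v: "v \<in> carrier (free_module R X)"
    show "\<zero>\<^bsub>free_module R X\<^esub> \<oplus>\<^bsub>free_module R X\<^esub> v = v"
      using free_module_closed[OF v] by simp
    have "{x. \<ominus> v x \<noteq> \<zero>} \<subseteq> {x. v x \<noteq> \<zero>}" by auto
    then have "finite {x. \<ominus> v x \<noteq> \<zero>}" by (rule finite_subset) (use v in simp)
    then show "\<exists>w\<in>carrier (free_module R X). w \<oplus>\<^bsub>free_module R X\<^esub> v = \<zero>\<^bsub>free_module R X\<^esub>"
      using v free_module_closed[OF v] by (intro bexI[where x = "\<lambda>x. \<ominus> v x"]) (simp_all add: l_neg)
  qed simp
  with is_cring show ?thesis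
  proof (rule moduleI)
    fix a v assume a: "a \<in> carrier R" and v: "v \<in> carrier (free_module R X)"
    have "{x. a \<otimes> v x \<noteq> \<zero>} \<subseteq> {x. v x \<noteq> \<zero>}" using a by auto
    then have "finite {x. a \<otimes> v x \<noteq> \<zero>}" by (rule finite_subset) (use v in simp)
    then show "a \<odot>\<^bsub>free_module R X\<^esub> v \<in> carrier (free_module R X)" using a v by simp
  next
    fix a b v assume "a \<in> carrier R" "b \<in> carrier R" and v: "v \<in> carrier (free_module R X)"
    then show "(a \<oplus> b) \<odot>\<^bsub>free_module R X\<^esub> v = a \<odot>\<^bsub>free_module R X\<^esub> v \<oplus>\<^bsub>free_module R X\<^esub> b \<odot>\<^bsub>free_module R X\<^esub> v"
      using free_module_closed[OF v] by (simp add: l_distr)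
  next
    fix a b v assume "a \<in> carrier R" "b \<in> carrier R" and v: "v \<in> carrier (free_module R X)"
    then show "(a \<otimes> b) \<odot>\<^bsub>free_module R X\<^esub> v = a \<odot>\<^bsub>free_module R X\<^esub> (b \<odot>\<^bsub>free_module R X\<^esub> v)"
      using free_module_closed[OF v] by (simp add: m_assoc)
  next
    fix a v w assume "a \<in> carrier R" and v: "v \<in> carrier (free_module R X)" and w: "w \<in> carrier (free_module R X)"
    then show "a \<odot>\<^bsub>free_module R X\<^esub> (v \<oplus>\<^bsub>free_module R X\<^esub> w) = a \<odot>\<^bsub>free_module R X\<^esub> v \<oplus>\<^bsub>free_module R X\<^esub> a \<odot>\<^bsub>free_module R X\<^esub> w"
      using free_module_closed[OF v] free_module_closed[OF w] by (simp add: r_distr)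
  next
    fix v assume v: "v \<in> carrier (free_module R X)"
    then show "\<one> \<odot>\<^bsub>free_module R X\<^esub> v = v" using free_module_closed[OF v] by simp
  qed
qed

lemma free_gen_closed: "x \<in> X \<Longrightarrow> free_gen R x \<in> carrier (free_module R X)"
proof -
  assume "x \<in> X"
  moreover have "{y. free_gen R x y \<noteq> \<zero>} \<subseteq> {x}" by (auto simp: free_gen_def)
  then have "finite {y. free_gen R x y \<noteq> \<zero>}" by (rule finite_subset) simp
  ultimately show ?thesis by (auto simp: free_gen_def)
qed

text \<open>Removing one coordinate at a time exhausts a finite support. Facts about free modules
  are derived from this by checking that the good vectors form a submodule containing the
  generators.\<close>

lemma free_module_induct:
  assumes U: "submodule R U (free_module R X)" and gen: "\<And>x. x \<in> X \<Longrightarrow> free_gen R x \<in> U"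
  shows "U = carrier (free_module R X)"
proof -
  interpret F: module R "free_module R X" by (rule free_module_module)
  interpret U: submodule R U "free_module R X" by fact
  have "v \<in> U" if "finite F" "v \<in> carrier (free_module R X)" "{x. v x \<noteq> \<zero>} \<subseteq> F" for v F
    using that
  proof (induction F arbitrary: v rule: finite_induct)
    case empty
    then have "v = \<zero>\<^bsub>free_module R X\<^esub>" by auto
    then show ?case using U.zero_closed by metis
  next
    case (insert y F)
    define w where "w = v(y := \<zero>)"
    note vc = free_module_closed[OF insert.prems(1)]
    have "{x. w x \<noteq> \<zero>} \<subseteq> {x. v x \<noteq> \<zero>}" by (auto simp: w_def)
    then have "finite {x. w x \<noteq> \<zero>}" by (rule finite_subset) (use insert.prems in simp)
    then have "w \<in> carrier (free_module R X)" using insert.prems(1) by (auto simp: w_def)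
    moreover have "{x. w x \<noteq> \<zero>} \<subseteq> F" using insert.prems(2) by (auto simp: w_def)
    ultimately have w: "w \<in> U" by (rule insert.IH)
    show ?case
    proof (cases "y \<in> X")
      case True
      have "v = w \<oplus>\<^bsub>free_module R X\<^esub> v y \<odot>\<^bsub>free_module R X\<^esub> free_gen R y"
        using vc by (auto simp: w_def free_gen_def)
      moreover have "w \<oplus>\<^bsub>free_module R X\<^esub> v y \<odot>\<^bsub>free_module R X\<^esub> free_gen R y \<in> U"
        using w vc gen[OF True] by (intro U.m_closed U.smult_closed)
      ultimately show ?thesis by metis
    next
      \<comment> \<open>The finite set of the induction is arbitrary, so its new element may lie
        outside \<open>X\<close>; then \<open>v\<close> vanishes there already.\<close>
      case False
      then have "w = v" using insert.prems(1) by (auto simp: w_def)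
      then show ?thesis using w by simp
    qed
  qed
  then show ?thesis using U.subset by (auto simp del: free_module_sel(2,3,4))
qed

end

lemma module_hom_eqI_free:
  assumes M: "module R M" and f: "f \<in> module_hom R (free_module R X) M" "g \<in> module_hom R (free_module R X) M"
    and eq: "\<And>x. x \<in> X \<Longrightarrow> f (free_gen R x) = g (free_gen R x)" and v: "v \<in> carrier (free_module R X)"
  shows "f v = g v"
proof -
  interpret M: module R M by fact
  have F: "module R (free_module R X)" by (rule M.R.free_module_module)
  interpret f: mod_hom R "free_module R X" M f using F M f(1) by (rule mod_homI)
  interpret g: mod_hom R "free_module R X" M g using F M f(2) by (rule mod_homI)
  have "submodule R {v \<in> carrier (free_module R X). f v = g v} (free_module R X)"
  proof (rule submodule_intro[OF F])
    show "\<zero>\<^bsub>free_module R X\<^esub> \<in> {v \<in> carrier (free_module R X). f v = g v}"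
      using f.f0_is_0 g.f0_is_0 f.M.M.zero_closed by simp
  qed (auto simp del: free_module_sel)
  then have "{v \<in> carrier (free_module R X). f v = g v} = carrier (free_module R X)"
    by (rule M.R.free_module_induct) (auto simp: eq M.R.free_gen_closed simp del: free_module_sel)
  then show ?thesis using v by blast
qed

lemma free_module_lift:
  assumes M: "module R M" and f: "\<And>x. x \<in> X \<Longrightarrow> f x \<in> carrier M"
  obtains h where "h \<in> module_hom R (free_module R X) M" "\<forall>x\<in>X. h (free_gen R x) = f x"
proof -
  interpret M: module R M by fact
  let ?F = "free_module R X"
  interpret F: module R ?F by (rule M.R.free_module_module)
  define h where "h v = finsum M (\<lambda>x. v x \<odot>\<^bsub>M\<^esub> f x) {x. v x \<noteq> \<zero>\<^bsub>R\<^esub>}" for v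
  \<comment> \<open>The sum may be taken over any finite subset of \<open>X\<close> containing the
    support. Additivity relies on this, since the supports of \<open>v\<close>, \<open>w\<close> and
    their sum differ.\<close>
  have h: "h v = finsum M (\<lambda>x. v x \<odot>\<^bsub>M\<^esub> f x) S"
    if v: "v \<in> carrier ?F" and S: "finite S" "S \<subseteq> X" "{x. v x \<noteq> \<zero>\<^bsub>R\<^esub>} \<subseteq> S" for v S
    unfolding h_def using that f M.R.free_module_closed[OF v]
    by (intro M.M.add.finprod_mono_neutral_cong_left) (auto simp: Pi_iff)
  have supp: "{x. v x \<noteq> \<zero>\<^bsub>R\<^esub>} \<subseteq> X" "finite {x. v x \<noteq> \<zero>\<^bsub>R\<^esub>}" if "v \<in> carrier ?F" for v
    using that by auto
  have "h \<in> module_hom R ?F M"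
  proof (rule module_homI)
    fix v assume v: "v \<in> carrier ?F"
    show "h v \<in> carrier M" unfolding h_def using supp[OF v] f M.R.free_module_closed[OF v]
      by (intro M.M.finsum_closed) auto
  next
    fix v w assume v: "v \<in> carrier ?F" and w: "w \<in> carrier ?F"
    let ?S = "{x. v x \<noteq> \<zero>\<^bsub>R\<^esub>} \<union> {x. w x \<noteq> \<zero>\<^bsub>R\<^esub>}"
    have S: "finite ?S" "?S \<subseteq> X" using supp[OF v] supp[OF w] by auto
    note c = M.R.free_module_closed[OF v] M.R.free_module_closed[OF w]
    have "h (v \<oplus>\<^bsub>?F\<^esub> w) = finsum M (\<lambda>x. (v \<oplus>\<^bsub>?F\<^esub> w) x \<odot>\<^bsub>M\<^esub> f x) ?S"
      using F.M.a_closed[OF v w] S by (rule h) (auto simp: c)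
    also have "\<dots> = finsum M (\<lambda>x. v x \<odot>\<^bsub>M\<^esub> f x \<oplus>\<^bsub>M\<^esub> w x \<odot>\<^bsub>M\<^esub> f x) ?S"
      using S(2) f c by (intro M.M.finsum_cong') (auto simp: M.smult_l_distr subset_eq)
    also have "\<dots> = finsum M (\<lambda>x. v x \<odot>\<^bsub>M\<^esub> f x) ?S \<oplus>\<^bsub>M\<^esub> finsum M (\<lambda>x. w x \<odot>\<^bsub>M\<^esub> f x) ?S"
      using S(2) f c by (intro M.M.finsum_addf) auto
    also have "\<dots> = h v \<oplus>\<^bsub>M\<^esub> h w" using h[OF v S] h[OF w S] by simp
    finally show "h (v \<oplus>\<^bsub>?F\<^esub> w) = h v \<oplus>\<^bsub>M\<^esub> h w" .
  next
    fix a v assume a: "a \<in> carrier R" and v: "v \<in> carrier ?F"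
    let ?S = "{x. v x \<noteq> \<zero>\<^bsub>R\<^esub>}"
    note c = M.R.free_module_closed[OF v]
    have "h (a \<odot>\<^bsub>?F\<^esub> v) = finsum M (\<lambda>x. (a \<odot>\<^bsub>?F\<^esub> v) x \<odot>\<^bsub>M\<^esub> f x) ?S"
      using F.smult_closed[OF a v] supp(2,1)[OF v] by (rule h) (auto simp: a)
    also have "\<dots> = finsum M (\<lambda>x. a \<odot>\<^bsub>M\<^esub> (v x \<odot>\<^bsub>M\<^esub> f x)) ?S"
      using supp[OF v] f c a by (intro M.M.finsum_cong') (auto simp: M.smult_assoc1 subset_eq)
    also have "\<dots> = a \<odot>\<^bsub>M\<^esub> h v" unfolding h_def
      using supp[OF v] f c a by (intro M.finsum_smult_ldistr[symmetric]) auto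
    finally show "h (a \<odot>\<^bsub>?F\<^esub> v) = a \<odot>\<^bsub>M\<^esub> h v" .
  qed
  moreover have "\<forall>x\<in>X. h (free_gen R x) = f x"
  proof
    fix x assume x: "x \<in> X"
    have "h (free_gen R x) = finsum M (\<lambda>y. free_gen R x y \<odot>\<^bsub>M\<^esub> f y) {x}"
      using M.R.free_gen_closed[OF x] x by (intro h) (auto simp: free_gen_def)
    also have "\<dots> = f x" using f[OF x] by (simp add: free_gen_def)
    finally show "h (free_gen R x) = f x" .
  qed
  ultimately show ?thesis by (rule that)
qed

section \<open>Projective modules and lifting\<close>

lemma projective_moduleE:
  fixes P :: "('a, 'p) module"
  assumes "projective_module R P"
  obtains s r and X :: "'p set" where "module R P" "s \<in> module_hom R P (free_module R X)"
    "r \<in> module_hom R (free_module R X) P" "\<forall>x\<in>carrier P. r (s x) = x"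
proof -
  note * = assms[unfolded projective_module_def]
  from conjunct2[OF *] show ?thesis
    by (elim exE bexE) (rule that[OF conjunct1[OF *]])
qed

text \<open>Lift the images of the basis of the free module of which \<open>P\<close> is a retract,
  extend linearly, and precompose with the section \<open>s\<close>. The condition compares images
  instead of asking \<open>p\<close> to be onto, because \<open>p\<close> will be a differential and
  the values of \<open>f\<close> will be boundaries.\<close>

lemma projective_module_lift:
  fixes P :: "('a, 'p) module"
  assumes P: "projective_module R P" and X: "module R X" and Y: "module R Y"
    and p: "p \<in> module_hom R X Y" and f: "f \<in> module_hom R P Y"
    and im: "f ` carrier P \<subseteq> p ` carrier X"
  obtains g where "g \<in> module_hom R P X" "\<forall>x\<in>carrier P. p (g x) = f x"
proof -
  from P obtain s r and I :: "'p set" where Pm: "module R P" and s: "s \<in> module_hom R P (free_module R I)"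
    and r: "r \<in> module_hom R (free_module R I) P" and rs: "\<forall>x\<in>carrier P. r (s x) = x"
    by (rule projective_moduleE)
  interpret Pm: module R P by fact
  have "\<exists>x \<in> carrier X. p x = f (r (free_gen R i))" if "i \<in> I" for i
    using im module_homD(1)[OF r Pm.R.free_gen_closed[OF that]] by force
  then obtain u where u: "\<And>i. i \<in> I \<Longrightarrow> u i \<in> carrier X" "\<And>i. i \<in> I \<Longrightarrow> p (u i) = f (r (free_gen R i))"
    by metis
  obtain g where g: "g \<in> module_hom R (free_module R I) X" "\<forall>i\<in>I. g (free_gen R i) = u i"
    using X u(1) by (rule free_module_lift)
  have "p (g v) = f (r v)" if "v \<in> carrier (free_module R I)" for v
    using Y module_hom_comp[OF g(1) p] module_hom_comp[OF r f] _ that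
    by (rule module_hom_eqI_free) (simp add: g u)
  then have "\<forall>x\<in>carrier P. p (g (s x)) = f x"
    using rs module_homD(1)[OF s] by simp
  then show ?thesis by (rule that[OF module_hom_comp[OF s g(1)]])
qed

text \<open>\<open>projective_module\<close> takes its index set inside the element type of the
  module, so a free module cannot be presented as a retract of itself. It is a retract of the free
  module on its own carrier; the section sends the generator at \<open>x\<close> to the generator
  indexed by that generator.\<close>

lemma projective_free_module:
  fixes R :: "('a, 'r) ring_scheme" and X :: "'x set"
  assumes "cring R" shows "projective_module R (free_module R X)"
proof -
  interpret cring R by fact
  let ?F = "free_module R X" and ?G = "free_module R (carrier (free_module R X))"
  note F = free_module_module[of X] and G = free_module_module[of "carrier ?F"]
  obtain s where s: "s \<in> module_hom R ?F ?G" "\<forall>x\<in>X. s (free_gen R x) = free_gen R (free_gen R x)"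
    using G free_gen_closed[OF free_gen_closed]
    by (rule free_module_lift[where f = "\<lambda>x. free_gen R (free_gen R x)"])
  obtain r where r: "r \<in> module_hom R ?G ?F" "\<forall>v\<in>carrier ?F. r (free_gen R v) = v"
    using F by (rule free_module_lift[where f = "\<lambda>v. v"])
  have id: "(\<lambda>v. v) \<in> module_hom R ?F ?F" by (rule module_homI) simp_all
  have "r (s v) = v" if "v \<in> carrier ?F" for v
    using F module_hom_comp[OF s(1) r(1)] id _ that
    by (rule module_hom_eqI_free) (simp add: s r free_gen_closed del: free_module_sel)
  then have "\<forall>v\<in>carrier ?F. r (s v) = v" by blast
  then show ?thesis unfolding projective_module_def
    by (intro conjI F exI[of _ "carrier ?F"] bexI[OF _ s(1)] bexI[OF _ r(1)])
qed

section \<open>Comparison of resolutions\<close>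

text \<open>Projectivity is split off because restriction of scalars may destroy it: along the
  inclusion, a free module over \<open>R \<ltimes> M\<close> becomes a direct sum of copies of R and
  M. Exactness survives, and it is what the comparison of resolutions asks of the target.\<close>

definition resolves ::
    "('a, 'r) ring_scheme \<Rightarrow> ('a, 'l) module \<Rightarrow> (nat \<Rightarrow> ('a, 'p) module) \<Rightarrow> (nat \<Rightarrow> 'p \<Rightarrow> 'p)
      \<Rightarrow> ('p \<Rightarrow> 'l) \<Rightarrow> bool" where
  "resolves R L P d \<epsilon> \<longleftrightarrow>
     (\<forall>i. module R (P i)) \<and>
     (\<forall>i. d (Suc i) \<in> module_hom R (P (Suc i)) (P i)) \<and>
     \<epsilon> \<in> module_hom R (P 0) L \<and>
     \<epsilon> ` carrier (P 0) = carrier L \<and>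
     boundaries P d 0 = {x \<in> carrier (P 0). \<epsilon> x = \<zero>\<^bsub>L\<^esub>} \<and>
     (\<forall>i. boundaries P d (Suc i) = cycles P d (Suc i))"

lemma projective_resolution_iff:
  "projective_resolution R L P d \<epsilon> \<longleftrightarrow> (\<forall>i. projective_module R (P i)) \<and> resolves R L P d \<epsilon>"
  unfolding projective_resolution_def resolves_def projective_module_def by auto

lemma resolvesD:
  assumes "resolves R L P d \<epsilon>"
  shows "module R (P i)" "d (Suc i) \<in> module_hom R (P (Suc i)) (P i)" "\<epsilon> \<in> module_hom R (P 0) L"
    "\<epsilon> ` carrier (P 0) = carrier L" "boundaries P d 0 = {x \<in> carrier (P 0). \<epsilon> x = \<zero>\<^bsub>L\<^esub>}"
    "boundaries P d (Suc i) = cycles P d (Suc i)"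
  using assms by (auto simp: resolves_def)

lemma resolves_differential:
  assumes "resolves R L P d \<epsilon>"
  shows "x \<in> carrier (P (Suc 0)) \<Longrightarrow> \<epsilon> (d (Suc 0) x) = \<zero>\<^bsub>L\<^esub>"
    and "y \<in> carrier (P (Suc (Suc i))) \<Longrightarrow> d (Suc i) (d (Suc (Suc i)) y) = \<zero>\<^bsub>P i\<^esub>"
proof -
  show "\<epsilon> (d (Suc 0) x) = \<zero>\<^bsub>L\<^esub>" if "x \<in> carrier (P (Suc 0))"
    using resolvesD(5)[OF assms] that by (auto simp: boundaries_def)
  show "d (Suc i) (d (Suc (Suc i)) y) = \<zero>\<^bsub>P i\<^esub>" if "y \<in> carrier (P (Suc (Suc i)))"
  proof -
    have "d (Suc (Suc i)) y \<in> boundaries P d (Suc i)" using that by (auto simp: boundaries_def)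
    then show ?thesis by (simp add: resolvesD(6)[OF assms] cycles_def)
  qed
qed

lemma resolves_restrict_scalars:
  assumes "h \<in> ring_hom A B" "cring A" "resolves B L P d \<epsilon>"
  shows "resolves A (restrict_scalars h L) (\<lambda>i. restrict_scalars h (P i)) d \<epsilon>"
  using resolvesD[OF assms(3)] unfolding resolves_def
  by (simp add: restrict_scalars_module[OF assms(1,2)] restrict_scalars_hom[OF assms(1)]
      boundaries_def cycles_def)

text \<open>The invariant \<open>Z\<close> records that \<open>f\<close> after the differential
  lands in boundaries, which is what \<open>projective_module_lift\<close> needs for the next map.
  Exactness of the target renews it: the composite is a cycle because consecutive differentials of
  the source compose to zero.\<close>

lemma chain_map_lift:
  assumes P: "projective_resolution R L P d \<epsilon>" and Q: "resolves R L' Q e \<eta>"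
    and L': "module R L'" and \<phi>: "\<phi> \<in> module_hom R L L'"
  obtains f where "\<And>i. f i \<in> module_hom R (P i) (Q i)"
    "\<And>x. x \<in> carrier (P 0) \<Longrightarrow> \<eta> (f 0 x) = \<phi> (\<epsilon> x)"
    "\<And>i x. x \<in> carrier (P (Suc i)) \<Longrightarrow> e (Suc i) (f (Suc i) x) = f i (d (Suc i) x)"
proof -
  have proj: "projective_module R (P i)" for i using P by (simp add: projective_resolution_iff)
  have P': "resolves R L P d \<epsilon>" using P by (simp add: projective_resolution_iff)
  note p = resolvesD[OF P'] and q = resolvesD[OF Q]
  define Z where "Z n f \<longleftrightarrow> f \<in> module_hom R (P n) (Q n) \<and>
      (\<forall>x \<in> carrier (P (Suc n)). f (d (Suc n) x) \<in> boundaries Q e n) \<and>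
      (n = 0 \<longrightarrow> (\<forall>x \<in> carrier (P 0). \<eta> (f x) = \<phi> (\<epsilon> x)))" for n f
  have "\<exists>f. \<forall>n. Z n (f n) \<and> (\<forall>x \<in> carrier (P (Suc n)). e (Suc n) (f (Suc n) x) = f n (d (Suc n) x))"
  proof (rule dependent_nat_choice)
    have "(\<lambda>x. \<phi> (\<epsilon> x)) ` carrier (P 0) \<subseteq> \<eta> ` carrier (Q 0)"
      using module_homD(1)[OF \<phi>] module_homD(1)[OF p(3)] by (auto simp: q(4))
    then obtain f where f: "f \<in> module_hom R (P 0) (Q 0)"
      and eq: "\<forall>x \<in> carrier (P 0). \<eta> (f x) = \<phi> (\<epsilon> x)"
      by (rule projective_module_lift[OF proj q(1) L' q(3) module_hom_comp[OF p(3) \<phi>]])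
    \<comment> \<open>\<open>L\<close> is known here only as the image of the augmentation, so its
      module axioms are transported from \<open>P 0\<close>. The augmentation preserves zero by
      exactness, because zero is a boundary.\<close>
    interpret \<phi>: mod_hom R L L' \<phi>
    proof (intro mod_homI \<phi> L')
      interpret \<epsilon>: module R "P 0" by (rule p)
      have "\<epsilon> \<zero>\<^bsub>P 0\<^esub> = \<zero>\<^bsub>L\<^esub>"
      proof -
        have "d (Suc 0) \<zero>\<^bsub>P (Suc 0)\<^esub> = \<zero>\<^bsub>P 0\<^esub>"
          using mod_hom.f0_is_0[OF mod_homI[OF p(1) p(1) p(2)]] .
        moreover have "\<zero>\<^bsub>P (Suc 0)\<^esub> \<in> carrier (P (Suc 0))"
          using p(1)[of "Suc 0"] by (simp add: module_def abelian_group.axioms abelian_monoid.zero_closed)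
        ultimately show ?thesis using resolves_differential(1)[OF P'] by metis
      qed
      then show "module R L" by (rule module_surj_image[OF p(1) p(3,4)])
    qed
    have "f (d (Suc 0) x) \<in> boundaries Q e 0" if x: "x \<in> carrier (P (Suc 0))" for x
    proof -
      have dx: "d (Suc 0) x \<in> carrier (P 0)" using module_homD(1)[OF p(2)] x by simp
      then have "\<eta> (f (d (Suc 0) x)) = \<phi> \<zero>\<^bsub>L\<^esub>"
        using eq resolves_differential(1)[OF P' x] by simp
      then show ?thesis using module_homD(1)[OF f dx] q(5) by simp
    qed
    then have "Z 0 f" using f eq by (simp add: Z_def)
    then show "\<exists>f. Z 0 f" by (intro exI[where x = f])
  next
    fix f n assume "Z n f"
    then have f: "f \<in> module_hom R (P n) (Q n)"
      and fd: "\<forall>x \<in> carrier (P (Suc n)). f (d (Suc n) x) \<in> boundaries Q e n" by (auto simp: Z_def)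
    have "(\<lambda>x. f (d (Suc n) x)) ` carrier (P (Suc n)) \<subseteq> e (Suc n) ` carrier (Q (Suc n))"
      using fd by (auto simp: boundaries_def)
    then obtain g where g: "g \<in> module_hom R (P (Suc n)) (Q (Suc n))"
      and eq: "\<forall>x \<in> carrier (P (Suc n)). e (Suc n) (g x) = f (d (Suc n) x)"
      by (rule projective_module_lift[OF proj q(1) q(1) q(2) module_hom_comp[OF p(2) f]])
    have "g (d (Suc (Suc n)) x) \<in> boundaries Q e (Suc n)" if x: "x \<in> carrier (P (Suc (Suc n)))" for x
    proof -
      have dx: "d (Suc (Suc n)) x \<in> carrier (P (Suc n))" using module_homD(1)[OF p(2)] x by simp
      then have "e (Suc n) (g (d (Suc (Suc n)) x)) = f \<zero>\<^bsub>P n\<^esub>"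
        using eq resolves_differential(2)[OF P' x] by simp
      also have "\<dots> = \<zero>\<^bsub>Q n\<^esub>" by (rule mod_hom.f0_is_0[OF mod_homI[OF p(1) q(1) f]])
      finally show ?thesis using module_homD(1)[OF g dx] by (simp add: q(6) cycles_def)
    qed
    then have "Z (Suc n) g" using g by (simp add: Z_def)
    then show "\<exists>g. Z (Suc n) g \<and> (\<forall>x \<in> carrier (P (Suc n)). e (Suc n) (g x) = f (d (Suc n) x))"
      using eq by blast
  qed
  then obtain f where f: "\<And>n. Z n (f n)"
    "\<And>n. \<forall>x \<in> carrier (P (Suc n)). e (Suc n) (f (Suc n) x) = f n (d (Suc n) x)" by blast
  show ?thesis
  proof (rule that[of f])
    show "f i \<in> module_hom R (P i) (Q i)" for i using f(1)[of i] by (simp add: Z_def)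
    show "\<eta> (f 0 x) = \<phi> (\<epsilon> x)" if "x \<in> carrier (P 0)" for x using f(1)[of 0] that by (simp add: Z_def)
    show "e (Suc i) (f (Suc i) x) = f i (d (Suc i) x)" if "x \<in> carrier (P (Suc i))" for i x
      using f(2) that by blast
  qed
qed

text \<open>The uniqueness half of the comparison theorem, for a self-map over the identity; it is
  applied to the composite of the two chain maps of the retraction.\<close>

lemma chain_homotopy_id:
  assumes P: "projective_resolution R L P d \<epsilon>"
    and F: "\<And>i. F i \<in> module_hom R (P i) (P i)"
    and F0: "\<And>x. x \<in> carrier (P 0) \<Longrightarrow> \<epsilon> (F 0 x) = \<epsilon> x"
    and FS: "\<And>i x. x \<in> carrier (P (Suc i)) \<Longrightarrow> d (Suc i) (F (Suc i) x) = F i (d (Suc i) x)"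
    and L: "module R L"
  obtains h where "\<And>i. h i \<in> module_hom R (P i) (P (Suc i))"
    "\<And>x. x \<in> carrier (P 0) \<Longrightarrow> d (Suc 0) (h 0 x) = F 0 x \<ominus>\<^bsub>P 0\<^esub> x"
    "\<And>i x. x \<in> carrier (P (Suc i)) \<Longrightarrow>
       d (Suc (Suc i)) (h (Suc i) x) = F (Suc i) x \<ominus>\<^bsub>P (Suc i)\<^esub> x \<ominus>\<^bsub>P (Suc i)\<^esub> h i (d (Suc i) x)"
proof -
  have proj: "projective_module R (P i)" for i using P by (simp add: projective_resolution_iff)
  have P': "resolves R L P d \<epsilon>" using P by (simp add: projective_resolution_iff)
  note p = resolvesD[OF P']
  have id: "(\<lambda>x. x) \<in> module_hom R (P i) (P i)" for i by (rule module_homI) simp_all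
  note Fid = module_hom_minus[OF p(1) p(1) F id]
  have dhom: "mod_hom R (P (Suc i)) (P i) (d (Suc i))" for i by (rule mod_homI[OF p(1) p(1) p(2)])
  have \<epsilon>hom: "mod_hom R (P 0) L \<epsilon>" by (rule mod_homI[OF p(1) L p(3)])
  note dcl = module_homD(1)[OF p(2)] and Fcl = module_homD(1)[OF F]
  \<comment> \<open>The element that must be the boundary of the next homotopy at
    \<open>x\<close>.\<close>
  define D where "D n h x = F (Suc n) x \<ominus>\<^bsub>P (Suc n)\<^esub> x \<ominus>\<^bsub>P (Suc n)\<^esub> h (d (Suc n) x)" for n h x
  have Dhom: "D n h \<in> module_hom R (P (Suc n)) (P (Suc n))" if "h \<in> module_hom R (P n) (P (Suc n))" for n h
    unfolding D_def by (rule module_hom_minus[OF p(1) p(1) Fid module_hom_comp[OF p(2) that]])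
  define Z where "Z n h \<longleftrightarrow> h \<in> module_hom R (P n) (P (Suc n)) \<and>
      (\<forall>x \<in> carrier (P (Suc n)). D n h x \<in> boundaries P d (Suc n)) \<and>
      (n = 0 \<longrightarrow> (\<forall>x \<in> carrier (P 0). d (Suc 0) (h x) = F 0 x \<ominus>\<^bsub>P 0\<^esub> x))" for n h
  \<comment> \<open>\<open>D n h x\<close> is a cycle, hence a boundary. The premise
    \<open>eq\<close> is the homotopy relation at points \<open>d x\<close>, where the term with the
    previous homotopy vanishes; in this form degree 0 and higher degrees are treated alike.\<close>
  have bd: "D n h x \<in> boundaries P d (Suc n)"
    if h: "h \<in> module_hom R (P n) (P (Suc n))" and x: "x \<in> carrier (P (Suc n))"
      and eq: "d (Suc n) (h (d (Suc n) x)) = F n (d (Suc n) x) \<ominus>\<^bsub>P n\<^esub> d (Suc n) x" for n h x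
  proof -
    interpret d: mod_hom R "P (Suc n)" "P n" "d (Suc n)" by (rule dhom)
    have cl: "F (Suc n) x \<in> carrier (P (Suc n))" "h (d (Suc n) x) \<in> carrier (P (Suc n))"
      "F n (d (Suc n) x) \<in> carrier (P n)" "d (Suc n) x \<in> carrier (P n)"
      using x Fcl dcl module_homD(1)[OF h] by auto
    have "d (Suc n) (D n h x) =
        d (Suc n) (F (Suc n) x) \<ominus>\<^bsub>P n\<^esub> d (Suc n) x \<ominus>\<^bsub>P n\<^esub> d (Suc n) (h (d (Suc n) x))"
      unfolding D_def using cl x by (simp del: d.N.M.minus_other_side)
    also have "\<dots> = \<zero>\<^bsub>P n\<^esub>" using cl x by (simp add: eq FS)
    finally show ?thesis using module_homD(1)[OF Dhom[OF h] x] by (simp add: p(6) cycles_def)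
  qed
  have "\<exists>h. \<forall>n. Z n (h n) \<and> (\<forall>x \<in> carrier (P (Suc n)). d (Suc (Suc n)) (h (Suc n) x) = D n (h n) x)"
  proof (rule dependent_nat_choice)
    have "F 0 x \<ominus>\<^bsub>P 0\<^esub> x \<in> boundaries P d 0" if x: "x \<in> carrier (P 0)" for x
    proof -
      interpret \<epsilon>: mod_hom R "P 0" L \<epsilon> by (rule \<epsilon>hom)
      show ?thesis using x Fcl F0[OF x] by (simp add: p(5))
    qed
    then have "(\<lambda>x. F 0 x \<ominus>\<^bsub>P 0\<^esub> x) ` carrier (P 0) \<subseteq> d (Suc 0) ` carrier (P (Suc 0))"
      by (auto simp: boundaries_def)
    then obtain h where h: "h \<in> module_hom R (P 0) (P (Suc 0))"
      and eq: "\<forall>x \<in> carrier (P 0). d (Suc 0) (h x) = F 0 x \<ominus>\<^bsub>P 0\<^esub> x"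
      by (rule projective_module_lift[OF proj p(1) p(1) p(2) Fid])
    have "\<forall>x \<in> carrier (P (Suc 0)). D 0 h x \<in> boundaries P d (Suc 0)"
      using bd[OF h] eq dcl by blast
    then have "Z 0 h" using h eq by (simp add: Z_def)
    then show "\<exists>h. Z 0 h" by (intro exI[where x = h])
  next
    fix h n assume "Z n h"
    then have h: "h \<in> module_hom R (P n) (P (Suc n))"
      and hd: "\<forall>x \<in> carrier (P (Suc n)). D n h x \<in> boundaries P d (Suc n)" by (auto simp: Z_def)
    have "D n h ` carrier (P (Suc n)) \<subseteq> d (Suc (Suc n)) ` carrier (P (Suc (Suc n)))"
      using hd by (auto simp: boundaries_def)
    then obtain g where g: "g \<in> module_hom R (P (Suc n)) (P (Suc (Suc n)))"
      and eq: "\<forall>x \<in> carrier (P (Suc n)). d (Suc (Suc n)) (g x) = D n h x"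
      by (rule projective_module_lift[OF proj p(1) p(1) p(2) Dhom[OF h]])
    have "D (Suc n) g x \<in> boundaries P d (Suc (Suc n))" if x: "x \<in> carrier (P (Suc (Suc n)))" for x
    proof (rule bd[OF g x])
      interpret h: mod_hom R "P n" "P (Suc n)" h by (rule mod_homI[OF p(1) p(1) h])
      have dx: "d (Suc (Suc n)) x \<in> carrier (P (Suc n))" using dcl x by simp
      \<comment> \<open>At a boundary the last term of \<open>D n h\<close> is \<open>h\<close> of
        zero, as two differentials compose to zero.\<close>
      then show "d (Suc (Suc n)) (g (d (Suc (Suc n)) x)) =
          F (Suc n) (d (Suc (Suc n)) x) \<ominus>\<^bsub>P (Suc n)\<^esub> d (Suc (Suc n)) x"
        using eq Fcl[OF dx] by (simp add: D_def resolves_differential(2)[OF P' x] a_minus_def)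
    qed
    then have "Z (Suc n) g" using g by (simp add: Z_def)
    then show "\<exists>g. Z (Suc n) g \<and> (\<forall>x \<in> carrier (P (Suc n)). d (Suc (Suc n)) (g x) = D n h x)"
      using eq by blast
  qed
  then obtain h where h: "\<And>n. Z n (h n)"
    "\<And>n. \<forall>x \<in> carrier (P (Suc n)). d (Suc (Suc n)) (h (Suc n) x) = D n (h n) x" by blast
  show ?thesis
  proof (rule that[of h])
    show "h i \<in> module_hom R (P i) (P (Suc i))" for i using h(1)[of i] by (simp add: Z_def)
    show "d (Suc 0) (h 0 x) = F 0 x \<ominus>\<^bsub>P 0\<^esub> x" if "x \<in> carrier (P 0)" for x
      using h(1)[of 0] that by (simp add: Z_def)
    show "d (Suc (Suc i)) (h (Suc i) x) = F (Suc i) x \<ominus>\<^bsub>P (Suc i)\<^esub> x \<ominus>\<^bsub>P (Suc i)\<^esub> h i (d (Suc i) x)"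
      if "x \<in> carrier (P (Suc i))" for i x
      using h(2)[of i] that by (simp add: D_def)
  qed
qed

section \<open>Generators of the homology modulo the maximal ideal\<close>

text \<open>The products alone need not be closed under addition; the submodule \<mm>M is their
  span. As a generating set they allow claims about \<mm>M to be checked on single products.\<close>

definition max_smults :: "('a, 'r) ring_scheme \<Rightarrow> ('a, 'm) module \<Rightarrow> 'm set" where
  "max_smults R M = {a \<odot>\<^bsub>M\<^esub> x | a x. a \<in> max_ideal R \<and> x \<in> carrier M}"

text \<open>
  The cycles of \<open>P \<otimes> k\<close>, lifted to \<open>P\<close> along the isomorphism \<open>P\<^sub>i \<otimes> k \<cong> P\<^sub>i/\<mm>P\<^sub>i\<close>, and a set
  generating the preimage of the boundaries.
\<close>

definition residue_cycles ::
    "('a, 'r) ring_scheme \<Rightarrow> (nat \<Rightarrow> ('a, 'p) module) \<Rightarrow> (nat \<Rightarrow> 'p \<Rightarrow> 'p) \<Rightarrow> nat \<Rightarrow> 'p set" where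
  "residue_cycles R P d i = {x \<in> carrier (P i).
     i \<noteq> 0 \<longrightarrow> d i x \<in> module.span R (P (i - 1)) (max_smults R (P (i - 1)))}"

definition residue_boundaries ::
    "('a, 'r) ring_scheme \<Rightarrow> (nat \<Rightarrow> ('a, 'p) module) \<Rightarrow> (nat \<Rightarrow> 'p \<Rightarrow> 'p) \<Rightarrow> nat \<Rightarrow> 'p set" where
  "residue_boundaries R P d i = boundaries P d i \<union> max_smults R (P i)"

text \<open>A finite generating set of \<open>Tor\<close>, seen inside the resolution:
  \<open>P\<close> stands in for P \<otimes> k and for its homology. Sets of this kind over
  different rings can be compared by cardinality.\<close>

definition homology_generators ::
    "('a, 'r) ring_scheme \<Rightarrow> (nat \<Rightarrow> ('a, 'p) module) \<Rightarrow> (nat \<Rightarrow> 'p \<Rightarrow> 'p) \<Rightarrow> nat \<Rightarrow> 'p set \<Rightarrow> bool" where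
  "homology_generators R P d i S \<longleftrightarrow> finite S \<and> S \<subseteq> residue_cycles R P d i \<and>
     residue_cycles R P d i \<subseteq> module.span R (P i) (S \<union> residue_boundaries R P d i)"

lemma (in abelian_group) minus_swap:
  "x \<in> carrier G \<Longrightarrow> y \<in> carrier G \<Longrightarrow> x \<ominus> (x \<ominus> y) = y"
  by (simp add: a_minus_def minus_add r_neg flip: a_assoc)

text \<open>Solves the homotopy relation b = F x - x - z for \<open>x\<close>.\<close>

lemma (in abelian_group) minus_minus_swap:
  assumes "x \<in> carrier G" "y \<in> carrier G" "z \<in> carrier G"
  shows "x \<ominus> (x \<ominus> y \<ominus> z) \<ominus> z = y"
proof -
  have "x \<ominus> (x \<ominus> y \<ominus> z) \<ominus> z = x \<ominus> (x \<ominus> y \<ominus> z \<oplus> z)"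
    using assms by (simp add: a_minus_def minus_add a_assoc)
  also have "x \<ominus> y \<ominus> z \<oplus> z = x \<ominus> y"
    using assms by (simp add: a_minus_def a_assoc l_neg)
  finally show ?thesis using assms by (simp add: minus_swap)
qed

section \<open>Spans and multiples by the maximal ideal\<close>

lemma max_smults_subset:
  assumes "module R M" "max_ideal R \<subseteq> carrier R"
  shows "max_smults R M \<subseteq> carrier M"
proof -
  interpret module R M by fact
  show ?thesis using assms(2) by (auto simp: max_smults_def)
qed

lemma residue_boundaries_subset:
  assumes "module R (P i)" "max_ideal R \<subseteq> carrier R" "d (Suc i) \<in> module_hom R (P (Suc i)) (P i)"
  shows "residue_boundaries R P d i \<subseteq> carrier (P i)"
  using max_smults_subset[OF assms(1,2)] module_homD(1)[OF assms(3)]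
  by (auto simp: residue_boundaries_def boundaries_def)

lemma submodule_span: "module R M \<Longrightarrow> S \<subseteq> carrier M \<Longrightarrow> submodule R (module.span R M S) M"
  by (rule module.span_is_submodule)

lemma span_subset_submodule: "submodule R U M \<Longrightarrow> S \<subseteq> U \<Longrightarrow> module.span R M S \<subseteq> U"
  using module.span_is_subset submodule.module by blast

lemma span_base: "module R M \<Longrightarrow> S \<subseteq> carrier M \<Longrightarrow> x \<in> S \<Longrightarrow> x \<in> module.span R M S"
  using module.in_own_span by blast

lemma span_mono: "module R M \<Longrightarrow> S \<subseteq> T \<Longrightarrow> module.span R M S \<subseteq> module.span R M T"
  by (rule module.span_is_monotone)

lemma module_hom_span:
  assumes "module R M" "f \<in> module_hom R M N" "submodule R U N" "S \<subseteq> carrier M"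
    and "\<And>x. x \<in> S \<Longrightarrow> f x \<in> U" and "x \<in> module.span R M S"
  shows "f x \<in> U"
proof -
  interpret f: mod_hom R M N f
    using assms(1,3,2) by (intro mod_homI) (auto dest: submodule.module)
  have "module.span R M S \<subseteq> {x \<in> carrier M. f x \<in> U}"
    using assms by (intro span_subset_submodule f.submodule_vimage) auto
  then show ?thesis using assms(6) by blast
qed

lemma submodule_restrict_scalars:
  assumes "h \<in> ring_hom A B" "cring A" "submodule B U M"
  shows "submodule A U (restrict_scalars h M)"
proof -
  interpret U: submodule B U M by fact
  show ?thesis
    using restrict_scalars_module[OF assms(1,2) U.module] U.subset ring_hom_memE(1)[OF assms(1)]
    by (intro submodule_intro) auto
qed

text \<open>The map is semilinear, f (a z) = h a f z, and \<open>h a\<close> lies in the maximal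
  ideal of \<open>B\<close> again. Applied with the inclusion as \<open>h\<close> in one direction
  of the retraction and with the projection in the other.\<close>

lemma span_restrict_scalars_max_smults:
  assumes h: "h \<in> ring_hom A B" "cring A" "h ` max_ideal A \<subseteq> max_ideal B"
    and B: "max_ideal B \<subseteq> carrier B" and A: "max_ideal A \<subseteq> carrier A"
    and M: "module A M" and N: "module B N"
    and f: "f \<in> module_hom A M (restrict_scalars h N)" and x: "x \<in> module.span A M (max_smults A M)"
  shows "f x \<in> module.span B N (max_smults B N)"
proof (rule module_hom_span[OF M f _ _ _ x])
  note sub = max_smults_subset[OF N B]
  show "submodule A (module.span B N (max_smults B N)) (restrict_scalars h N)"
    by (intro submodule_restrict_scalars[OF h(1,2)] submodule_span N sub)
  show "max_smults A M \<subseteq> carrier M" by (rule max_smults_subset[OF M A])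
  fix y assume "y \<in> max_smults A M"
  then obtain a z where y: "a \<in> max_ideal A" "z \<in> carrier M" "y = a \<odot>\<^bsub>M\<^esub> z"
    by (auto simp: max_smults_def)
  then have "f y = h a \<odot>\<^bsub>N\<^esub> f z" "f z \<in> carrier N" "h a \<in> max_ideal B"
    using module_homD(1,3)[OF f] A h(3) by auto
  then have "f y \<in> max_smults B N" by (auto simp: max_smults_def)
  then show "f y \<in> module.span B N (max_smults B N)" by (rule span_base[OF N sub])
qed

text \<open>
  Functoriality of \<open>Tor\<close> in the ring: \<open>Tor\<^sup>R(N, k) \<rightarrow> Tor\<^sup>A(N, k) \<rightarrow> Tor\<^sup>R(N, k)\<close> composes to the
  identity, so the second map is onto.
\<close>

lemma homology_generators_retract:
  fixes P :: "nat \<Rightarrow> ('a, 'p) module" and Q :: "nat \<Rightarrow> ('b, 'q) module"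
  assumes \<iota>: "\<iota> \<in> ring_hom R A" "\<iota> ` max_ideal R \<subseteq> max_ideal A"
    and \<pi>: "\<pi> \<in> ring_hom A R" "\<pi> ` max_ideal A \<subseteq> max_ideal R"
    and retract: "\<And>r. r \<in> carrier R \<Longrightarrow> \<pi> (\<iota> r) = r"
    and rings: "cring R" "cring A"
    and max: "max_ideal R \<subseteq> carrier R" "max_ideal A \<subseteq> carrier A"
    and N: "module R N"
    and P: "projective_resolution R N P d \<epsilon>"
    and Q: "projective_resolution A (restrict_scalars \<pi> N) Q e \<eta>"
    and S: "homology_generators A Q e i S"
  shows "\<exists>T. homology_generators R P d i T \<and> card T \<le> card S"
proof -
  have P': "resolves R N P d \<epsilon>" using P by (simp add: projective_resolution_iff)
  have Q': "resolves A (restrict_scalars \<pi> N) Q e \<eta>" using Q by (simp add: projective_resolution_iff)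
  note p = resolvesD[OF P'] and q = resolvesD[OF Q']
  note RQ = resolves_restrict_scalars[OF \<iota>(1) rings(1) Q']
  note AP = resolves_restrict_scalars[OF \<pi>(1) rings(2) P']
  have \<pi>N: "module A (restrict_scalars \<pi> N)" by (rule restrict_scalars_module[OF \<pi>(1) rings(2) N])
  have N': "module R (restrict_scalars \<iota> (restrict_scalars \<pi> N))"
    by (rule restrict_scalars_module[OF \<iota>(1) rings(1) \<pi>N])
  \<comment> \<open>A scalar \<open>r\<close> acts on the twice restricted module as \<pi> (\<iota>
    r) = r.\<close>
  have "(\<lambda>x. x) \<in> module_hom R N (restrict_scalars \<iota> (restrict_scalars \<pi> N))"
    by (rule module_homI) (auto simp: retract)
  \<comment> \<open>Here \<open>P\<close> is the projective side and \<open>Q\<close>, restricted to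
    R, the exact side; in the next lifting, over \<open>A\<close>, they exchange roles.\<close>
  from chain_map_lift[OF P RQ N' this] obtain f where
    f: "\<And>i. f i \<in> module_hom R (P i) (restrict_scalars \<iota> (Q i))"
    and f0: "\<And>x. x \<in> carrier (P 0) \<Longrightarrow> \<eta> (f 0 x) = \<epsilon> x"
    and fS: "\<And>i x. x \<in> carrier (P (Suc i)) \<Longrightarrow> e (Suc i) (f (Suc i) x) = f i (d (Suc i) x)"
    by metis
  have "(\<lambda>x. x) \<in> module_hom A (restrict_scalars \<pi> N) (restrict_scalars \<pi> N)"
    by (rule module_homI) auto
  from chain_map_lift[OF Q AP \<pi>N this] obtain g where
    g: "\<And>i. g i \<in> module_hom A (Q i) (restrict_scalars \<pi> (P i))"
    and g0: "\<And>x. x \<in> carrier (Q 0) \<Longrightarrow> \<epsilon> (g 0 x) = \<eta> x"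
    and gS: "\<And>i x. x \<in> carrier (Q (Suc i)) \<Longrightarrow> d (Suc i) (g (Suc i) x) = g i (e (Suc i) x)"
    by metis
  have fcl: "f i x \<in> carrier (Q i)" if "x \<in> carrier (P i)" for i x
    using module_homD(1)[OF f that] by simp
  have gcl: "g i x \<in> carrier (P i)" if "x \<in> carrier (Q i)" for i x
    using module_homD(1)[OF g that] by simp
  note dcl = module_homD(1)[OF p(2)] and ecl = module_homD(1)[OF q(2)]
  define F where "F i x = g i (f i x)" for i x
  \<comment> \<open>The composite is R-linear although \<open>g\<close> is linear over
    \<open>A\<close>: a scalar \<open>a\<close> passes \<open>f\<close> as \<iota> a and then
    \<open>g\<close> as \<pi> (\<iota> a) = a.\<close>
  have F: "F i \<in> module_hom R (P i) (P i)" for i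
  proof (rule module_homI)
    fix a x assume "a \<in> carrier R" "x \<in> carrier (P i)"
    then show "F i (a \<odot>\<^bsub>P i\<^esub> x) = a \<odot>\<^bsub>P i\<^esub> F i x"
      using module_homD(3)[OF f] module_homD(3)[OF g] fcl ring_hom_memE(1)[OF \<iota>(1)]
      by (simp add: F_def retract)
  next
    fix x y assume "x \<in> carrier (P i)" "y \<in> carrier (P i)"
    then show "F i (x \<oplus>\<^bsub>P i\<^esub> y) = F i x \<oplus>\<^bsub>P i\<^esub> F i y"
      using module_homD(2)[OF f] module_homD(2)[OF g] fcl by (simp add: F_def)
  qed (simp add: F_def fcl gcl)
  have F0: "\<epsilon> (F 0 x) = \<epsilon> x" if "x \<in> carrier (P 0)" for x
    using that by (simp add: F_def g0 fcl f0)
  have FS: "d (Suc i) (F (Suc i) x) = F i (d (Suc i) x)" if "x \<in> carrier (P (Suc i))" for i x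
    using that by (simp add: F_def gS fcl fS)
  obtain h where h: "\<And>i. h i \<in> module_hom R (P i) (P (Suc i))"
    and h0: "\<And>x. x \<in> carrier (P 0) \<Longrightarrow> d (Suc 0) (h 0 x) = F 0 x \<ominus>\<^bsub>P 0\<^esub> x"
    and hS: "\<And>i x. x \<in> carrier (P (Suc i)) \<Longrightarrow>
       d (Suc (Suc i)) (h (Suc i) x) = F (Suc i) x \<ominus>\<^bsub>P (Suc i)\<^esub> x \<ominus>\<^bsub>P (Suc i)\<^esub> h i (d (Suc i) x)"
    using chain_homotopy_id[OF P F F0 FS N] by metis
  have f_cyc: "f i x \<in> residue_cycles A Q e i" if x: "x \<in> residue_cycles R P d i" for x
  proof (cases i)
    case 0
    then show ?thesis using x fcl by (simp add: residue_cycles_def)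
  next
    case (Suc j)
    have "f j (d i x) \<in> module.span A (Q j) (max_smults A (Q j))"
      using x Suc by (intro span_restrict_scalars_max_smults[OF \<iota>(1) rings(1) \<iota>(2) max(2,1) p(1) q(1) f])
        (simp add: residue_cycles_def)
    then show ?thesis using x Suc fcl by (simp add: residue_cycles_def fS)
  qed
  have g_cyc: "g i x \<in> residue_cycles R P d i" if x: "x \<in> residue_cycles A Q e i" for x
  proof (cases i)
    case 0
    then show ?thesis using x gcl by (simp add: residue_cycles_def)
  next
    case (Suc j)
    have "g j (e i x) \<in> module.span R (P j) (max_smults R (P j))"
      using x Suc by (intro span_restrict_scalars_max_smults[OF \<pi>(1) rings(2) \<pi>(2) max q(1) p(1) g])
        (simp add: residue_cycles_def)
    then show ?thesis using x Suc gcl by (simp add: residue_cycles_def gS)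
  qed
  from S have S': "finite S" "S \<subseteq> residue_cycles A Q e i"
    "residue_cycles A Q e i \<subseteq> module.span A (Q i) (S \<union> residue_boundaries A Q e i)"
    by (auto simp: homology_generators_def)
  define T where "T = g i ` S"
  define U where "U = module.span R (P i) (T \<union> residue_boundaries R P d i)"
  have T: "T \<subseteq> residue_cycles R P d i" using S'(2) g_cyc by (auto simp: T_def)
  have rbP: "residue_boundaries R P d i \<subseteq> carrier (P i)"
    by (rule residue_boundaries_subset[where P = P and d = d and i = i, OF p(1) max(1) p(2)])
  have rbQ: "residue_boundaries A Q e i \<subseteq> carrier (Q i)"
    by (rule residue_boundaries_subset[where P = Q and d = e and i = i, OF q(1) max(2) q(2)])
  have TP: "T \<union> residue_boundaries R P d i \<subseteq> carrier (P i)"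
    using T rbP by (auto simp: residue_cycles_def)
  have U: "submodule R U (P i)" unfolding U_def by (rule submodule_span[OF p(1) TP])
  have baseU: "x \<in> U" if "x \<in> T \<union> residue_boundaries R P d i" for x
    unfolding U_def by (rule span_base[OF p(1) TP that])
  have mU: "module.span R (P i) (max_smults R (P i)) \<subseteq> U"
    unfolding U_def by (rule span_mono[OF p(1)]) (auto simp: residue_boundaries_def)
  \<comment> \<open>Checked on generators: \<open>S\<close> goes to \<open>T\<close>, boundaries go
    to boundaries, and multiples by the maximal ideal go to sums of such multiples.\<close>
  have gU: "g i y \<in> U" if y: "y \<in> residue_cycles A Q e i" for y
  proof (rule module_hom_span[OF q(1) g submodule_restrict_scalars[OF \<pi>(1) rings(2) U]])
    show "S \<union> residue_boundaries A Q e i \<subseteq> carrier (Q i)"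
      using S'(2) rbQ by (auto simp: residue_cycles_def)
    show "y \<in> module.span A (Q i) (S \<union> residue_boundaries A Q e i)" using y S'(3) by blast
    fix x assume "x \<in> S \<union> residue_boundaries A Q e i"
    then consider "x \<in> S" | "x \<in> boundaries Q e i" | "x \<in> max_smults A (Q i)"
      by (auto simp: residue_boundaries_def)
    then show "g i x \<in> U"
    proof cases
      case 1
      then show ?thesis by (intro baseU) (simp add: T_def)
    next
      case 2
      then obtain z where "z \<in> carrier (Q (Suc i))" "x = e (Suc i) z" by (auto simp: boundaries_def)
      then have "g i x = d (Suc i) (g (Suc i) z)" "g (Suc i) z \<in> carrier (P (Suc i))"
        by (simp_all add: gS gcl)
      then show ?thesis by (intro baseU) (simp add: residue_boundaries_def boundaries_def)
    next
      case 3
      then have "x \<in> module.span A (Q i) (max_smults A (Q i))"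
        by (intro span_base[OF q(1) max_smults_subset[OF q(1) max(2)]])
      then have "g i x \<in> module.span R (P i) (max_smults R (P i))"
        by (rule span_restrict_scalars_max_smults[OF \<pi>(1) rings(2) \<pi>(2) max q(1) p(1) g])
      then show ?thesis using mU by blast
    qed
  qed
  \<comment> \<open>The homotopy writes \<open>x\<close> as F x - d (h x) - h (d x), without the
    last term in degree 0. The first term is the \<open>g\<close>-image of a cycle of
    \<open>Q\<close> modulo the maximal ideal, the second is a boundary, and the third lies in
    \<mm>P because \<open>d x\<close> does.\<close>
  have "x \<in> U" if x: "x \<in> residue_cycles R P d i" for x
  proof -
    interpret Pi: module R "P i" by (rule p(1))
    have xP: "x \<in> carrier (P i)" using x by (simp add: residue_cycles_def)
    have FU: "F i x \<in> U" unfolding F_def by (intro gU f_cyc x)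
    have FP: "F i x \<in> carrier (P i)" by (rule module_homD(1)[OF F xP])
    have hb: "d (Suc i) (h i x) \<in> U"
      using module_homD(1)[OF h xP] by (intro baseU) (simp add: residue_boundaries_def boundaries_def)
    have hP: "d (Suc i) (h i x) \<in> carrier (P i)" using submodule.subset[OF U] hb by blast
    show ?thesis
    proof (cases i)
      case 0
      have "d (Suc i) (h i x) = F i x \<ominus>\<^bsub>P i\<^esub> x" using h0 xP 0 by simp
      then have "x = F i x \<ominus>\<^bsub>P i\<^esub> d (Suc i) (h i x)"
        using xP FP by (simp add: Pi.M.minus_swap)
      then show ?thesis using submodule_minus[OF U FU hb] by simp
    next
      case (Suc j)
      have "d i x \<in> module.span R (P j) (max_smults R (P j))"
        using x Suc by (simp add: residue_cycles_def)
      then have "h j (d i x) \<in> module.span R (P i) (max_smults R (P i))"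
        unfolding Suc
      proof (rule module_hom_span[OF p(1) h _ max_smults_subset[OF p(1) max(1)], rotated -1])
        show "submodule R (module.span R (P (Suc j)) (max_smults R (P (Suc j)))) (P (Suc j))"
          by (rule submodule_span[OF p(1) max_smults_subset[OF p(1) max(1)]])
        fix y assume "y \<in> max_smults R (P j)"
        then obtain a z where y: "a \<in> max_ideal R" "z \<in> carrier (P j)" "y = a \<odot>\<^bsub>P j\<^esub> z"
          by (auto simp: max_smults_def)
        then have "h j y = a \<odot>\<^bsub>P (Suc j)\<^esub> h j z" "h j z \<in> carrier (P (Suc j))"
          using module_homD(1,3)[OF h] max(1) by auto
        then have "h j y \<in> max_smults R (P (Suc j))" using y(1) by (auto simp: max_smults_def)
        then show "h j y \<in> module.span R (P (Suc j)) (max_smults R (P (Suc j)))"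
          by (rule span_base[OF p(1) max_smults_subset[OF p(1) max(1)]])
      qed
      then have hU: "h j (d i x) \<in> U" using mU by blast
      then have hjP: "h j (d i x) \<in> carrier (P i)" using submodule.subset[OF U] by blast
      have "d (Suc i) (h i x) = F i x \<ominus>\<^bsub>P i\<^esub> x \<ominus>\<^bsub>P i\<^esub> h j (d i x)" using hS xP Suc by simp
      then have "x = F i x \<ominus>\<^bsub>P i\<^esub> d (Suc i) (h i x) \<ominus>\<^bsub>P i\<^esub> h j (d i x)"
        using xP FP hjP by (simp add: Pi.M.minus_minus_swap)
      then show ?thesis using submodule_minus[OF U submodule_minus[OF U FU hb] hU] by simp
    qed
  qed
  moreover have "finite T" "card T \<le> card S" using S'(1) by (auto simp: T_def card_image_le)
  ultimately show ?thesis using T by (intro exI[where x = T]) (auto simp: homology_generators_def U_def)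
qed

section \<open>Tensor products\<close>

lemma tensor_relations_cases:
  assumes "v \<in> tensor_relations R M N"
  obtains
    (add_left) x x' y where "x \<in> carrier M" "x' \<in> carrier M" "y \<in> carrier N"
      "v = free_gen R (x \<oplus>\<^bsub>M\<^esub> x', y) \<ominus>\<^bsub>free_module R (carrier M \<times> carrier N)\<^esub>
        (free_gen R (x, y) \<oplus>\<^bsub>free_module R (carrier M \<times> carrier N)\<^esub> free_gen R (x', y))"
  | (add_right) x y y' where "x \<in> carrier M" "y \<in> carrier N" "y' \<in> carrier N"
      "v = free_gen R (x, y \<oplus>\<^bsub>N\<^esub> y') \<ominus>\<^bsub>free_module R (carrier M \<times> carrier N)\<^esub>
        (free_gen R (x, y) \<oplus>\<^bsub>free_module R (carrier M \<times> carrier N)\<^esub> free_gen R (x, y'))"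
  | (smult_left) a x y where "a \<in> carrier R" "x \<in> carrier M" "y \<in> carrier N"
      "v = free_gen R (a \<odot>\<^bsub>M\<^esub> x, y) \<ominus>\<^bsub>free_module R (carrier M \<times> carrier N)\<^esub>
        (a \<odot>\<^bsub>free_module R (carrier M \<times> carrier N)\<^esub> free_gen R (x, y))"
  | (smult_right) a x y where "a \<in> carrier R" "x \<in> carrier M" "y \<in> carrier N"
      "v = free_gen R (x, a \<odot>\<^bsub>N\<^esub> y) \<ominus>\<^bsub>free_module R (carrier M \<times> carrier N)\<^esub>
        (a \<odot>\<^bsub>free_module R (carrier M \<times> carrier N)\<^esub> free_gen R (x, y))"
  using assms unfolding tensor_relations_def Let_def by fast

lemma tensor_relationsI:
  fixes R :: "('a, 'r) ring_scheme" and M :: "('a, 'm) module" and N :: "('a, 'n) module"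
  defines "F \<equiv> free_module R (carrier M \<times> carrier N)" and "e \<equiv> free_gen R"
  shows "x \<in> carrier M \<Longrightarrow> x' \<in> carrier M \<Longrightarrow> y \<in> carrier N \<Longrightarrow>
      e (x \<oplus>\<^bsub>M\<^esub> x', y) \<ominus>\<^bsub>F\<^esub> (e (x, y) \<oplus>\<^bsub>F\<^esub> e (x', y)) \<in> tensor_relations R M N"
    and "x \<in> carrier M \<Longrightarrow> y \<in> carrier N \<Longrightarrow> y' \<in> carrier N \<Longrightarrow>
      e (x, y \<oplus>\<^bsub>N\<^esub> y') \<ominus>\<^bsub>F\<^esub> (e (x, y) \<oplus>\<^bsub>F\<^esub> e (x, y')) \<in> tensor_relations R M N"
    and "a \<in> carrier R \<Longrightarrow> x \<in> carrier M \<Longrightarrow> y \<in> carrier N \<Longrightarrow>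
      e (a \<odot>\<^bsub>M\<^esub> x, y) \<ominus>\<^bsub>F\<^esub> (a \<odot>\<^bsub>F\<^esub> e (x, y)) \<in> tensor_relations R M N"
    and "a \<in> carrier R \<Longrightarrow> x \<in> carrier M \<Longrightarrow> y \<in> carrier N \<Longrightarrow>
      e (x, a \<odot>\<^bsub>N\<^esub> y) \<ominus>\<^bsub>F\<^esub> (a \<odot>\<^bsub>F\<^esub> e (x, y)) \<in> tensor_relations R M N"
  unfolding tensor_relations_def Let_def F_def e_def by fast+

locale tensor = M: module R M + N: module R N
  for R :: "('a, 'r) ring_scheme" and M :: "('a, 'm) module" and N :: "('a, 'n) module"
begin

abbreviation F where "F \<equiv> free_module R (carrier M \<times> carrier N)"
abbreviation T where "T \<equiv> tensor_product R M N"
abbreviation pt where "pt \<equiv> pure_tensor R M N"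

sublocale F: module R F by (rule M.R.free_module_module)

lemma gen_closed [simp]: "x \<in> carrier M \<Longrightarrow> y \<in> carrier N \<Longrightarrow> free_gen R (x, y) \<in> carrier F"
  by (rule M.R.free_gen_closed) simp

lemma relations_closed: "tensor_relations R M N \<subseteq> carrier F"
proof
  fix v assume "v \<in> tensor_relations R M N"
  then show "v \<in> carrier F"
    by (cases rule: tensor_relations_cases) (simp_all del: free_module_sel)
qed

lemma kernel: "submodule R (tensor_kernel R M N) F"
  unfolding tensor_kernel_def by (rule submodule_span[OF F.module_axioms relations_closed])

lemma tensor_module: "module R T"
  unfolding tensor_product_def by (rule quotient_module_module[OF kernel])

sublocale T: module R T by (rule tensor_module)

definition proj where "proj v = tensor_kernel R M N +>\<^bsub>F\<^esub> v"

lemma proj_hom: "proj \<in> module_hom R F T"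
  unfolding tensor_product_def proj_def[abs_def] by (rule quotient_proj_hom[OF kernel])

lemma proj_surj: "proj ` carrier F = carrier T"
  unfolding tensor_product_def proj_def[abs_def] by (rule quotient_proj_surj[OF kernel])

lemma proj_zero_iff: "v \<in> carrier F \<Longrightarrow> proj v = \<zero>\<^bsub>T\<^esub> \<longleftrightarrow> v \<in> tensor_kernel R M N"
  unfolding tensor_product_def proj_def by (rule quotient_proj_zero_iff[OF kernel])

sublocale proj: mod_hom R F T proj
  by (rule mod_homI[OF F.module_axioms T.module_axioms proj_hom])

lemma pt_eq: "pt x y = proj (free_gen R (x, y))"
  by (simp add: pure_tensor_def proj_def)

lemma pt_closed [simp]: "x \<in> carrier M \<Longrightarrow> y \<in> carrier N \<Longrightarrow> pt x y \<in> carrier T"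
  unfolding pt_eq by (intro proj.f_im gen_closed)

lemma proj_eqI:
  assumes "v \<ominus>\<^bsub>F\<^esub> w \<in> tensor_relations R M N" "v \<in> carrier F" "w \<in> carrier F"
  shows "proj v = proj w"
proof -
  have "v \<ominus>\<^bsub>F\<^esub> w \<in> tensor_kernel R M N"
    unfolding tensor_kernel_def by (rule span_base[OF F.module_axioms relations_closed assms(1)])
  then have "proj (v \<ominus>\<^bsub>F\<^esub> w) = \<zero>\<^bsub>T\<^esub>" using assms(2,3) by (simp add: proj_zero_iff del: free_module_sel proj.f_minus)
  then show ?thesis using assms(2,3) by (simp del: free_module_sel)
qed

lemma pt_add_left:
  assumes "x \<in> carrier M" "x' \<in> carrier M" "y \<in> carrier N"
  shows "pt (x \<oplus>\<^bsub>M\<^esub> x') y = pt x y \<oplus>\<^bsub>T\<^esub> pt x' y"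
  using proj_eqI[OF tensor_relationsI(1)[OF assms]] assms by (simp add: pt_eq del: free_module_sel)

lemma pt_add_right:
  assumes "x \<in> carrier M" "y \<in> carrier N" "y' \<in> carrier N"
  shows "pt x (y \<oplus>\<^bsub>N\<^esub> y') = pt x y \<oplus>\<^bsub>T\<^esub> pt x y'"
  using proj_eqI[OF tensor_relationsI(2)[OF assms]] assms by (simp add: pt_eq del: free_module_sel)

lemma pt_smult_left:
  assumes "a \<in> carrier R" "x \<in> carrier M" "y \<in> carrier N"
  shows "pt (a \<odot>\<^bsub>M\<^esub> x) y = a \<odot>\<^bsub>T\<^esub> pt x y"
  using proj_eqI[OF tensor_relationsI(3)[OF assms]] assms by (simp add: pt_eq del: free_module_sel)

lemma pt_smult_right:
  assumes "a \<in> carrier R" "x \<in> carrier M" "y \<in> carrier N"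
  shows "pt x (a \<odot>\<^bsub>N\<^esub> y) = a \<odot>\<^bsub>T\<^esub> pt x y"
  using proj_eqI[OF tensor_relationsI(4)[OF assms]] assms by (simp add: pt_eq del: free_module_sel)

text \<open>Pulled back along \<open>proj\<close>, this is
  \<open>free_module_induct\<close>.\<close>

lemma tensor_induct:
  assumes U: "submodule R U T" and pt: "\<And>x y. x \<in> carrier M \<Longrightarrow> y \<in> carrier N \<Longrightarrow> pt x y \<in> U"
  shows "U = carrier T"
proof -
  have "{v \<in> carrier F. proj v \<in> U} = carrier F"
    using proj.submodule_vimage[OF U]
    by (rule M.R.free_module_induct) (auto simp: pt_eq[symmetric] pt simp del: free_module_sel)
  then have "carrier T \<subseteq> U" unfolding proj_surj[symmetric] by blast
  then show ?thesis using submodule.subset[OF U] by blast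
qed

text \<open>Bilinearity of \<open>b\<close> says that its linear extension to the free module
  vanishes on the four families of relations, so the extension factors through the quotient.\<close>

lemma tensor_lift:
  fixes W :: "('a, 'w) module"
  assumes W: "module R W"
    and cl: "\<And>x y. x \<in> carrier M \<Longrightarrow> y \<in> carrier N \<Longrightarrow> b x y \<in> carrier W"
    and add_left: "\<And>x x' y. x \<in> carrier M \<Longrightarrow> x' \<in> carrier M \<Longrightarrow> y \<in> carrier N \<Longrightarrow>
      b (x \<oplus>\<^bsub>M\<^esub> x') y = b x y \<oplus>\<^bsub>W\<^esub> b x' y"
    and add_right: "\<And>x y y'. x \<in> carrier M \<Longrightarrow> y \<in> carrier N \<Longrightarrow> y' \<in> carrier N \<Longrightarrow>
      b x (y \<oplus>\<^bsub>N\<^esub> y') = b x y \<oplus>\<^bsub>W\<^esub> b x y'"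
    and smult_left: "\<And>a x y. a \<in> carrier R \<Longrightarrow> x \<in> carrier M \<Longrightarrow> y \<in> carrier N \<Longrightarrow>
      b (a \<odot>\<^bsub>M\<^esub> x) y = a \<odot>\<^bsub>W\<^esub> b x y"
    and smult_right: "\<And>a x y. a \<in> carrier R \<Longrightarrow> x \<in> carrier M \<Longrightarrow> y \<in> carrier N \<Longrightarrow>
      b x (a \<odot>\<^bsub>N\<^esub> y) = a \<odot>\<^bsub>W\<^esub> b x y"
  obtains h where "h \<in> module_hom R T W"
    "\<forall>x\<in>carrier M. \<forall>y\<in>carrier N. h (pt x y) = b x y"
proof -
  obtain h0 where h0: "h0 \<in> module_hom R F W"
    and eq: "\<forall>z\<in>carrier M \<times> carrier N. h0 (free_gen R z) = case_prod b z"
    using W by (rule free_module_lift[where f = "case_prod b" and X = "carrier M \<times> carrier N"])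
      (auto intro: cl)
  have eq': "h0 (free_gen R (x, y)) = b x y" if "x \<in> carrier M" "y \<in> carrier N" for x y
    using eq that by auto
  interpret W: module R W by (rule W)
  interpret h0: mod_hom R F W h0 by (rule mod_homI[OF F.module_axioms W h0])
  have "h0 v = \<zero>\<^bsub>W\<^esub>" if "v \<in> tensor_relations R M N" for v
    using that
    by (cases rule: tensor_relations_cases)
      (simp_all add: eq' add_left add_right smult_left smult_right cl del: free_module_sel)
  then have "tensor_relations R M N \<subseteq> h0.ker" using relations_closed unfolding h0.ker_def by blast
  then have "tensor_kernel R M N \<subseteq> h0.ker"
    unfolding tensor_kernel_def by (rule span_subset_submodule[OF h0.ker_is_submodule])
  then have ker: "h0 v = \<zero>\<^bsub>W\<^esub>" if "v \<in> carrier F" "proj v = \<zero>\<^bsub>T\<^esub>" for v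
    using proj_zero_iff that h0.f_ker by blast
  obtain h where h: "h \<in> module_hom R T W" "\<forall>v\<in>carrier F. h (proj v) = h0 v"
    by (rule h0.factor_through[OF T.module_axioms proj_hom proj_surj ker])
  have "\<forall>x\<in>carrier M. \<forall>y\<in>carrier N. h (pt x y) = b x y"
    using h(2) by (simp add: pt_eq eq' del: free_module_sel)
  with h(1) show ?thesis by (rule that)
qed

end

text \<open>\<open>tensor_map\<close> is defined by choice; \<open>tensor_lift\<close> shows that a
  map with the chosen property exists.\<close>

lemma tensor_map_pure:
  assumes M: "module R M" and M': "module R M'" and N: "module R N" and f: "f \<in> module_hom R M M'"
    and xy: "x \<in> carrier M" "y \<in> carrier N"
  shows "tensor_map R M M' N f (pure_tensor R M N x y) = pure_tensor R M' N (f x) y"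
proof -
  interpret t: tensor R M N using M N by (rule tensor.intro)
  interpret t': tensor R M' N using M' N by (rule tensor.intro)
  note f' = module_homD[OF f]
  obtain h where "h \<in> module_hom R (tensor_product R M N) (tensor_product R M' N)"
    "\<forall>x\<in>carrier M. \<forall>y\<in>carrier N. h (pure_tensor R M N x y) = pure_tensor R M' N (f x) y"
    by (rule t.tensor_lift[where W = "tensor_product R M' N" and b = "\<lambda>x y. pure_tensor R M' N (f x) y"])
      (simp_all add: f' t'.T.module_axioms t'.pt_add_left t'.pt_add_right t'.pt_smult_left t'.pt_smult_right)
  then have "\<exists>h. h \<in> module_hom R (tensor_product R M N) (tensor_product R M' N) \<and>
     (\<forall>x\<in>carrier M. \<forall>y\<in>carrier N. h (pure_tensor R M N x y) = pure_tensor R M' N (f x) y)"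
    by (intro exI[where x = h] conjI)
  from someI_ex[OF this, folded tensor_map_def]
  show ?thesis using xy by auto
qed

section \<open>The residue field\<close>

text \<open>Isolates the fact about the description \<open>max_ideal\<close> on which the residue
  field rests, so that it is available for the idealization before the latter is shown to be
  Noetherian.\<close>

locale cring_max = cring R for R :: "('a, 'r) ring_scheme" (structure) +
  assumes max_ideal: "maximalideal (max_ideal R) R"
begin

abbreviation "\<mm> \<equiv> max_ideal R"
abbreviation "K \<equiv> residue_module R"

sublocale \<mm>: maximalideal "max_ideal R" R by (rule max_ideal)

lemma max_ideal_subset: "max_ideal R \<subseteq> carrier R"
  by (rule \<mm>.a_subset)

lemma residue_module_sel [simp]:
  "carrier (residue_module R) = a_rcosets \<mm>" "\<zero>\<^bsub>residue_module R\<^esub> = \<mm>"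
  "X \<oplus>\<^bsub>residue_module R\<^esub> Y = X <+> Y" "a \<odot>\<^bsub>residue_module R\<^esub> X = [mod \<mm>:] (\<mm> +> a) \<Otimes> X"
  by (simp_all add: residue_module_def restrict_scalars_def regular_module_def residue_field_def FactRing_def)

lemma regular_module_sel [simp]:
  "carrier (regular_module R) = carrier R" "\<zero>\<^bsub>regular_module R\<^esub> = \<zero>"
  "x \<oplus>\<^bsub>regular_module R\<^esub> y = x \<oplus> y" "a \<odot>\<^bsub>regular_module R\<^esub> x = a \<otimes> x"
  by (simp_all add: regular_module_def)

lemma regular_module_module: "module R (regular_module R)"
proof (rule moduleI)
  show "abelian_group (regular_module R)"
    by (rule abelian_groupI) (auto simp: a_ac intro: l_neg bexI[of _ "\<ominus> _"])
qed (auto simp: l_distr r_distr m_assoc is_cring)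

lemma residue_proj_surj: "(\<lambda>r. \<mm> +> r) ` carrier (regular_module R) = carrier K"
  by (auto simp: A_RCOSETS_def' a_r_coset_def')

lemma residue_proj_hom: "(\<lambda>r. \<mm> +> r) \<in> module_hom R (regular_module R) K"
proof (rule module_homI)
  show "\<mm> +> r \<in> carrier K" if "r \<in> carrier (regular_module R)" for r
    using residue_proj_surj that by blast
qed (simp_all add: \<mm>.a_rcos_sum \<mm>.rcoset_mult_add)

lemma coset_zero_iff: "r \<in> carrier R \<Longrightarrow> \<mm> +> r = \<mm> \<longleftrightarrow> r \<in> \<mm>"
  using \<mm>.a_rcos_const \<mm>.a_rcos_self by auto

lemma residue_module_module: "module R K"
  by (rule module_surj_image[OF regular_module_module residue_proj_hom residue_proj_surj])
     (simp add: coset_zero_iff)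

lemma coset_eqI:
  assumes "a \<in> \<mm> +> r" "r \<in> carrier R"
  shows "a \<in> carrier R" "a \<ominus> r \<in> \<mm>"
proof -
  obtain u where u: "u \<in> \<mm>" "a = u \<oplus> r" using assms(1) by (auto simp: mem_a_r_coset)
  then have "u \<in> carrier R" using max_ideal_subset by auto
  then show "a \<in> carrier R" "a \<ominus> r \<in> \<mm>" using u assms(2) by (auto simp: a_minus_def a_assoc r_neg)
qed

end

subsection \<open>Modules annihilated by the maximal ideal\<close>

locale residue_annihilated = cring_max R + T: module R T
  for R :: "('a, 'r) ring_scheme" (structure) and T :: "('a, 't) module" +
  assumes annihilated: "\<And>a t. a \<in> max_ideal R \<Longrightarrow> t \<in> carrier T \<Longrightarrow> a \<odot>\<^bsub>T\<^esub> t = \<zero>\<^bsub>T\<^esub>"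
begin

abbreviation "V \<equiv> residue_space R T"

lemma residue_space_sel [simp]:
  "carrier V = carrier T" "\<zero>\<^bsub>V\<^esub> = \<zero>\<^bsub>T\<^esub>" "x \<oplus>\<^bsub>V\<^esub> y = x \<oplus>\<^bsub>T\<^esub> y"
  by (simp_all add: residue_space_def)

lemma residue_field_sel [simp]:
  "carrier (residue_field R) = a_rcosets \<mm>" "\<one>\<^bsub>residue_field R\<^esub> = \<mm> +> \<one>"
  "X \<oplus>\<^bsub>residue_field R\<^esub> Y = X <+> Y" "X \<otimes>\<^bsub>residue_field R\<^esub> Y = [mod \<mm>:] X \<Otimes> Y"
  by (simp_all add: residue_field_def FactRing_def)

text \<open>A coset acts through the representative picked by \<open>SOME\<close>. Another
  representative differs from it by an element of \<mm>, which kills \<open>t\<close>.\<close>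

lemma residue_smult:
  assumes r: "r \<in> carrier R" and t: "t \<in> carrier T"
  shows "(\<mm> +> r) \<odot>\<^bsub>V\<^esub> t = r \<odot>\<^bsub>T\<^esub> t"
proof -
  define a where "a = (SOME a. a \<in> \<mm> +> r)"
  have "a \<in> \<mm> +> r" unfolding a_def using \<mm>.a_rcos_self[OF r] by (rule someI)
  note a = coset_eqI[OF this r]
  have "a \<odot>\<^bsub>T\<^esub> t = (a \<ominus> r \<oplus> r) \<odot>\<^bsub>T\<^esub> t" using a r by (simp add: a_minus_def a_assoc l_neg)
  also have "\<dots> = (a \<ominus> r) \<odot>\<^bsub>T\<^esub> t \<oplus>\<^bsub>T\<^esub> r \<odot>\<^bsub>T\<^esub> t" using a r t by (intro T.smult_l_distr) simp_all
  also have "\<dots> = r \<odot>\<^bsub>T\<^esub> t" using annihilated[OF a(2) t] r t by simp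
  finally show ?thesis by (simp add: residue_space_def a_def)
qed

lemma cosetE:
  assumes "X \<in> a_rcosets \<mm>" obtains r where "r \<in> carrier R" "X = \<mm> +> r"
  using assms by (auto simp: A_RCOSETS_def' a_r_coset_def')

lemma residue_vectorspace: "vectorspace (residue_field R) V"
proof -
  have fld: "field (residue_field R)"
    unfolding residue_field_def by (rule \<mm>.quotient_is_field[OF is_cring])
  have ab: "abelian_group V"
    by (rule abelian_groupI) (auto simp: T.M.a_ac intro: T.M.l_neg bexI[of _ "\<ominus>\<^bsub>T\<^esub> _"])
  have "module (residue_field R) V"
  proof (rule moduleI)
    show "cring (residue_field R)" using fld by (simp add: field_def domain_def)
  next
    fix X t assume "X \<in> carrier (residue_field R)" "t \<in> carrier V"
    then show "X \<odot>\<^bsub>V\<^esub> t \<in> carrier V" by (auto elim!: cosetE simp: residue_smult)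
  next
    fix X Y t assume "X \<in> carrier (residue_field R)" "Y \<in> carrier (residue_field R)" "t \<in> carrier V"
    then show "(X \<oplus>\<^bsub>residue_field R\<^esub> Y) \<odot>\<^bsub>V\<^esub> t = X \<odot>\<^bsub>V\<^esub> t \<oplus>\<^bsub>V\<^esub> Y \<odot>\<^bsub>V\<^esub> t"
      by (auto elim!: cosetE simp: residue_smult \<mm>.a_rcos_sum T.smult_l_distr)
  next
    fix X Y t assume "X \<in> carrier (residue_field R)" "Y \<in> carrier (residue_field R)" "t \<in> carrier V"
    then show "(X \<otimes>\<^bsub>residue_field R\<^esub> Y) \<odot>\<^bsub>V\<^esub> t = X \<odot>\<^bsub>V\<^esub> (Y \<odot>\<^bsub>V\<^esub> t)"
      by (auto elim!: cosetE simp: residue_smult \<mm>.rcoset_mult_add T.smult_assoc1)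
  next
    fix X s t assume "X \<in> carrier (residue_field R)" "s \<in> carrier V" "t \<in> carrier V"
    then show "X \<odot>\<^bsub>V\<^esub> (s \<oplus>\<^bsub>V\<^esub> t) = X \<odot>\<^bsub>V\<^esub> s \<oplus>\<^bsub>V\<^esub> X \<odot>\<^bsub>V\<^esub> t"
      by (auto elim!: cosetE simp: residue_smult T.smult_r_distr)
  qed (simp_all add: ab residue_smult)
  then show ?thesis using fld by (rule vectorspace.intro)
qed

text \<open>Each scalar of one action acts as some scalar of the other. Hence spans agree, and
  \<open>residue_dim\<close> turns the dimension over the residue field into a count of generators
  over R.\<close>

lemma residue_submodule_iff: "submodule (residue_field R) U V \<longleftrightarrow> submodule R U T"
proof
  assume "submodule (residue_field R) U V"
  then interpret U: submodule "residue_field R" U V .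
  have "a \<odot>\<^bsub>T\<^esub> x \<in> U" if "a \<in> carrier R" "x \<in> U" for a x
  proof -
    have "(\<mm> +> a) \<odot>\<^bsub>V\<^esub> x \<in> U"
      using that residue_proj_surj by (intro U.smult_closed) auto
    then show ?thesis using residue_smult that U.subset by auto
  qed
  then show "submodule R U T"
    using U.subset U.m_closed U.zero_closed by (intro submodule_intro) (auto simp: T.module_axioms)
next
  assume "submodule R U T"
  then interpret U: submodule R U T .
  have "X \<odot>\<^bsub>V\<^esub> x \<in> U" if X: "X \<in> a_rcosets \<mm>" and x: "x \<in> U" for X x
  proof -
    obtain r where "r \<in> carrier R" "X = \<mm> +> r" using X by (rule cosetE)
    then show ?thesis using x residue_smult U.subset by auto
  qed
  then show "submodule (residue_field R) U V"
    using U.subset U.m_closed U.zero_closed vectorspace.axioms(1)[OF residue_vectorspace]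
    by (intro submodule_intro) auto
qed

lemma residue_span:
  assumes "S \<subseteq> carrier T"
  shows "module.span (residue_field R) V S = module.span R T S"
proof
  have V: "module (residue_field R) V" by (rule vectorspace.axioms(1)[OF residue_vectorspace])
  show "module.span (residue_field R) V S \<subseteq> module.span R T S"
    using assms submodule_span[OF T.module_axioms assms]
    by (intro span_subset_submodule) (auto simp: residue_submodule_iff intro: span_base[OF T.module_axioms])
  show "module.span R T S \<subseteq> module.span (residue_field R) V S"
    using submodule_span[OF V, of S] span_base[OF V, of S] assms
    by (intro span_subset_submodule) (simp_all add: residue_submodule_iff subset_iff)
qed

lemma residue_dim:
  "vectorspace.dim (residue_field R) V =
     (LEAST n. \<exists>E. finite E \<and> card E = n \<and> E \<subseteq> carrier T \<and> module.span R T E = carrier T)"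
  unfolding vectorspace.dim_def[OF residue_vectorspace]
  by (rule arg_cong[where f = Least]) (auto simp: fun_eq_iff residue_span)

end

section \<open>Betti numbers via generators of the homology\<close>

context cring_max
begin

text \<open>The map taking x to x \<otimes> 1. It is shown to be onto with kernel \<mm>P, which is
  the isomorphism of P/\<mm>P with P \<otimes> k.\<close>

definition residue_tensor :: "('a, 'p) module \<Rightarrow> 'p \<Rightarrow> ('p \<times> 'a set \<Rightarrow> 'a) set" where
  "residue_tensor P x = pure_tensor R P K x (\<mm> +> \<one>)"

lemma coset_one_closed: "\<mm> +> \<one> \<in> carrier K"
  using residue_proj_surj by auto

context
  fixes P :: "('a, 'p) module"
  assumes P: "module R P"
begin

interpretation t: tensor R P K
  using P residue_module_module by (rule tensor.intro)

lemma residue_tensor_hom: "residue_tensor P \<in> module_hom R P (tensor_product R P K)"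
  unfolding residue_tensor_def[abs_def] using coset_one_closed
  by (intro module_homI t.pt_closed t.pt_add_left t.pt_smult_left)

lemma pure_tensor_eq_residue_tensor:
  assumes "x \<in> carrier P" "r \<in> carrier R"
  shows "pure_tensor R P K x (\<mm> +> r) = residue_tensor P (r \<odot>\<^bsub>P\<^esub> x)"
proof -
  have "\<mm> +> r = r \<odot>\<^bsub>K\<^esub> (\<mm> +> \<one>)" using assms(2) by (simp add: \<mm>.rcoset_mult_add)
  then show ?thesis
    using t.pt_smult_right[OF assms(2,1) coset_one_closed] t.pt_smult_left[OF assms(2,1) coset_one_closed]
    unfolding residue_tensor_def by metis
qed

text \<open>Scalars move across the tensor sign, x \<otimes> r = (r x) \<otimes> 1, so every pure
  tensor is in the image.\<close>

lemma residue_tensor_surj: "residue_tensor P ` carrier P = carrier (tensor_product R P K)"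
proof (rule t.tensor_induct)
  show "submodule R (residue_tensor P ` carrier P) (tensor_product R P K)"
    by (rule mod_hom.submodule_image[OF mod_homI[OF P t.T.module_axioms residue_tensor_hom]
          submodule_carrier[OF P]])
  fix x X assume x: "x \<in> carrier P" and "X \<in> carrier K"
  then obtain r where "r \<in> carrier R" "X = \<mm> +> r"
    using residue_proj_surj by (metis imageE regular_module_sel(1))
  then show "pure_tensor R P K x X \<in> residue_tensor P ` carrier P"
    using x by (simp add: pure_tensor_eq_residue_tensor)
qed

text \<open>One inclusion is (a z) \<otimes> 1 = z \<otimes> a with \<open>a\<close> zero in k. For
  the other, a map from P \<otimes> k to P/\<mm>P taking x \<otimes> 1 to the class of
  \<open>x\<close> detects the kernel.\<close>

lemma residue_tensor_zero_iff:
  assumes x: "x \<in> carrier P"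
  shows "residue_tensor P x = \<zero>\<^bsub>tensor_product R P K\<^esub> \<longleftrightarrow> x \<in> module.span R P (max_smults R P)"
proof
  interpret rt: mod_hom R P "tensor_product R P K" "residue_tensor P"
    by (rule mod_homI[OF P t.T.module_axioms residue_tensor_hom])
  note sub = max_smults_subset[OF P max_ideal_subset]
  assume "x \<in> module.span R P (max_smults R P)"
  moreover have "max_smults R P \<subseteq> rt.ker"
  proof
    fix y assume "y \<in> max_smults R P"
    then obtain a z where y: "a \<in> \<mm>" "z \<in> carrier P" "y = a \<odot>\<^bsub>P\<^esub> z" by (auto simp: max_smults_def)
    have a: "a \<in> carrier R" using y(1) max_ideal_subset by blast
    have "residue_tensor P y = pure_tensor R P K z (\<mm> +> a)"
      using pure_tensor_eq_residue_tensor[OF y(2) a] y(3) by simp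
    also have "\<mm> +> a = \<mm> +> \<zero>"
      using coset_zero_iff[OF a] coset_zero_iff[OF zero_closed] y(1) by simp
    also have "\<dots> = \<zero> \<odot>\<^bsub>K\<^esub> (\<mm> +> \<one>)" by (simp add: \<mm>.rcoset_mult_add)
    also have "pure_tensor R P K z \<dots> = \<zero>\<^bsub>tensor_product R P K\<^esub>"
      using t.pt_smult_right[OF _ y(2) coset_one_closed, of \<zero>] t.pt_closed[OF y(2) coset_one_closed]
      by (simp del: residue_module_sel)
    finally show "y \<in> rt.ker" using y a by (simp add: rt.ker_def)
  qed
  ultimately show "residue_tensor P x = \<zero>\<^bsub>tensor_product R P K\<^esub>"
    using span_subset_submodule[OF rt.ker_is_submodule] rt.f_ker by blast
next
  define U where "U = module.span R P (max_smults R P)"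
  note sub = max_smults_subset[OF P max_ideal_subset]
  have U: "submodule R U P" unfolding U_def by (rule submodule_span[OF P sub])
  let ?W = "quotient_module P U"
  let ?p = "\<lambda>x. U +>\<^bsub>P\<^esub> x"
  have W: "module R ?W" by (rule quotient_module_module[OF U])
  interpret W: module R ?W by (rule W)
  interpret p: mod_hom R P ?W ?p by (rule mod_homI[OF P W quotient_proj_hom[OF U]])
  have mU: "?p (a \<odot>\<^bsub>P\<^esub> y) = \<zero>\<^bsub>?W\<^esub>" if "a \<in> \<mm>" "y \<in> carrier P" for a y
  proof -
    have "a \<odot>\<^bsub>P\<^esub> y \<in> max_smults R P" using that by (auto simp: max_smults_def)
    then have "a \<odot>\<^bsub>P\<^esub> y \<in> U" unfolding U_def by (rule span_base[OF P sub])
    then show ?thesis using quotient_proj_zero_iff[OF U] submodule.subset[OF U] by blast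
  qed
  interpret res: residue_annihilated R ?W
  proof
    fix a t assume a: "a \<in> \<mm>" and "t \<in> carrier ?W"
    then obtain y where "y \<in> carrier P" "t = ?p y" using quotient_proj_surj[OF U] by blast
    then show "a \<odot>\<^bsub>?W\<^esub> t = \<zero>\<^bsub>?W\<^esub>"
      using mU[OF a] p.f_smult[of a y] a max_ideal_subset by (auto simp del: quotient_module_sel p.f_smult)
  qed
  \<comment> \<open>P/\<mm>P carries an action of the residue field, so a coset can be paired with a
    vector; by \<open>residue_smult\<close> any representative computes the value.\<close>
  define b where "b x X = X \<odot>\<^bsub>residue_space R ?W\<^esub> ?p x" for x X
  have b: "b y (\<mm> +> r) = r \<odot>\<^bsub>?W\<^esub> ?p y" if "y \<in> carrier P" "r \<in> carrier R" for y r
    unfolding b_def using that by (intro res.residue_smult) (simp_all del: quotient_module_sel)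
  have Kcases: "\<exists>r \<in> carrier R. X = \<mm> +> r" if "X \<in> carrier K" for X
    using that residue_proj_surj by (metis imageE regular_module_sel(1))
  obtain h where h: "h \<in> module_hom R (tensor_product R P K) ?W"
    "\<forall>x\<in>carrier P. \<forall>y\<in>carrier K. h (pure_tensor R P K x y) = b x y"
  proof (rule t.tensor_lift[OF W, of b])
    fix x X assume x: "x \<in> carrier P" and "X \<in> carrier K"
    then obtain r where r: "r \<in> carrier R" "X = \<mm> +> r" using Kcases by blast
    show "b x X \<in> carrier ?W" using x r by (simp add: b del: quotient_module_sel)
    fix y assume "y \<in> carrier P"
    then show "b (x \<oplus>\<^bsub>P\<^esub> y) X = b x X \<oplus>\<^bsub>?W\<^esub> b y X"
      using x r by (simp add: b W.smult_r_distr del: quotient_module_sel)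
  next
    fix x X Y assume x: "x \<in> carrier P" and "X \<in> carrier K" "Y \<in> carrier K"
    then obtain r s where r: "r \<in> carrier R" "X = \<mm> +> r" "s \<in> carrier R" "Y = \<mm> +> s" using Kcases by metis
    have "X \<oplus>\<^bsub>K\<^esub> Y = \<mm> +> (r \<oplus> s)" using r by (simp add: \<mm>.a_rcos_sum)
    then show "b x (X \<oplus>\<^bsub>K\<^esub> Y) = b x X \<oplus>\<^bsub>?W\<^esub> b x Y"
      using x r by (simp add: b W.smult_l_distr del: quotient_module_sel residue_module_sel)
  next
    fix a x X assume a: "a \<in> carrier R" and x: "x \<in> carrier P" and "X \<in> carrier K"
    then obtain r where r: "r \<in> carrier R" "X = \<mm> +> r" using Kcases by blast
    show "b (a \<odot>\<^bsub>P\<^esub> x) X = a \<odot>\<^bsub>?W\<^esub> b x X"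
      using a x r by (simp add: b m_comm flip: W.smult_assoc1 del: quotient_module_sel)
    have "a \<odot>\<^bsub>K\<^esub> X = \<mm> +> (a \<otimes> r)" using a r by (simp add: \<mm>.rcoset_mult_add)
    then show "b x (a \<odot>\<^bsub>K\<^esub> X) = a \<odot>\<^bsub>?W\<^esub> b x X"
      using a x r by (simp add: b W.smult_assoc1 del: quotient_module_sel residue_module_sel)
  qed
  interpret h: mod_hom R "tensor_product R P K" ?W h by (rule mod_homI[OF t.T.module_axioms W h(1)])
  assume "residue_tensor P x = \<zero>\<^bsub>tensor_product R P K\<^esub>"
  then have "h (residue_tensor P x) = \<zero>\<^bsub>?W\<^esub>" by (simp del: quotient_module_sel)
  then have "b x (\<mm> +> \<one>) = \<zero>\<^bsub>?W\<^esub>"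
    using h(2) x coset_one_closed by (simp add: residue_tensor_def del: quotient_module_sel residue_module_sel)
  then have "?p x = \<zero>\<^bsub>?W\<^esub>" using x by (simp add: b del: quotient_module_sel)
  then show "x \<in> module.span R P (max_smults R P)" using quotient_proj_zero_iff[OF U x] unfolding U_def by blast
qed

end

lemma tensor_map_residue_tensor:
  assumes "module R P" "module R Q" "f \<in> module_hom R P Q" "x \<in> carrier P"
  shows "tensor_map R P Q K f (residue_tensor P x) = residue_tensor Q (f x)"
  unfolding residue_tensor_def
  by (rule tensor_map_pure[OF assms(1,2) residue_module_module assms(3,4) coset_one_closed])

end

lemma image_eq_of_surj:
  assumes "p ` A = B" shows "{y \<in> B. Q y} = p ` {x \<in> A. Q (p x)}"
  using assms by auto

text \<open>Computes the homology of P \<otimes> k inside \<open>P\<close>: along the surjections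
  \<open>\<phi>\<close>, with kernel \<mm>P, cycles pull back to \<open>Z\<close> and boundaries to
  the span of \<open>B\<close>, so the homology is \<open>Z\<close> modulo that span.\<close>

locale residue_complex = cring_max R for R :: "('a, 'r) ring_scheme" (structure) +
  fixes P :: "nat \<Rightarrow> ('a, 'p) module" and d :: "nat \<Rightarrow> 'p \<Rightarrow> 'p"
  assumes modules: "\<And>i. module R (P i)"
    and d_hom: "\<And>i. d (Suc i) \<in> module_hom R (P (Suc i)) (P i)"
    and d_d: "\<And>i x. x \<in> carrier (P (Suc (Suc i))) \<Longrightarrow> d (Suc i) (d (Suc (Suc i)) x) = \<zero>\<^bsub>P i\<^esub>"
begin

abbreviation C where "C j \<equiv> tensor_product R (P j) K"
definition D where "D j = tensor_map R (P j) (P (j - 1)) K (d j)"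
abbreviation H where "H i \<equiv> homology C D i"
abbreviation \<phi> where "\<phi> i \<equiv> residue_tensor (P i)"
abbreviation Z where "Z i \<equiv> residue_cycles R P d i"
abbreviation B where "B i \<equiv> residue_boundaries R P d i"

lemma C_module: "module R (C i)"
  by (rule tensor.tensor_module[OF tensor.intro[OF modules residue_module_module]])

lemma \<phi>_mod_hom: "mod_hom R (P i) (C i) (\<phi> i)"
  by (rule mod_homI[OF modules C_module residue_tensor_hom[OF modules]])

lemma D_\<phi>: "x \<in> carrier (P (Suc i)) \<Longrightarrow> D (Suc i) (\<phi> (Suc i) x) = \<phi> i (d (Suc i) x)"
  using tensor_map_residue_tensor[OF modules modules d_hom] by (simp add: D_def)

lemma \<phi>_zero_iff: "x \<in> carrier (P i) \<Longrightarrow>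
    \<phi> i x = \<zero>\<^bsub>C i\<^esub> \<longleftrightarrow> x \<in> module.span R (P i) (max_smults R (P i))"
  by (rule residue_tensor_zero_iff[OF modules])

lemma cycles_eq: "cycles C D i = \<phi> i ` Z i"
proof -
  have "(i \<noteq> 0 \<longrightarrow> D i (\<phi> i x) = \<zero>\<^bsub>C (i - 1)\<^esub>) \<longleftrightarrow>
      (i \<noteq> 0 \<longrightarrow> d i x \<in> module.span R (P (i - 1)) (max_smults R (P (i - 1))))"
    if x: "x \<in> carrier (P i)" for x
  proof (cases i)
    case (Suc j)
    then show ?thesis using x module_homD(1)[OF d_hom, of x j] D_\<phi>[of x j] \<phi>_zero_iff[of "d (Suc j) x" j]
      by simp
  qed simp
  then show ?thesis
    unfolding cycles_def residue_cycles_def image_eq_of_surj[OF residue_tensor_surj[OF modules]]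
    by (intro arg_cong[where f = "(`) (\<phi> i)"]) blast
qed

lemma boundaries_eq: "boundaries C D i = \<phi> i ` boundaries P d i"
proof -
  have "boundaries C D i = D (Suc i) ` \<phi> (Suc i) ` carrier (P (Suc i))"
    unfolding boundaries_def residue_tensor_surj[OF modules] ..
  also have "\<dots> = \<phi> i ` boundaries P d i"
    by (simp add: boundaries_def image_image D_\<phi>)
  finally show ?thesis .
qed

lemma boundaries_submodule: "submodule R (boundaries P d i) (P i)"
  unfolding boundaries_def
  by (rule mod_hom.submodule_image[OF mod_homI[OF modules modules d_hom] submodule_carrier[OF modules]])

lemma max_smults_sub: "max_smults R (P i) \<subseteq> carrier (P i)"
  by (rule max_smults_subset[OF modules max_ideal_subset])

lemma Z_submodule: "submodule R (Z i) (P i)"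
proof (cases i)
  case 0
  then show ?thesis using submodule_carrier[OF modules] by (simp add: residue_cycles_def)
next
  case (Suc j)
  then show ?thesis
    using mod_hom.submodule_vimage[OF mod_homI[OF modules modules d_hom]
        submodule_span[OF modules max_smults_sub], of j]
    by (simp add: residue_cycles_def)
qed

text \<open>For boundaries, two differentials compose to zero; for a product \<open>a z\<close> with
  \<open>a\<close> in \<mm>, the differential is \<open>a\<close> times an element.\<close>

lemma B_subset_Z: "B i \<subseteq> Z i"
proof
  fix x assume "x \<in> B i"
  then consider "x \<in> boundaries P d i" | "x \<in> max_smults R (P i)" by (auto simp: residue_boundaries_def)
  then show "x \<in> Z i"
  proof cases
    case 1
    then obtain y where y: "y \<in> carrier (P (Suc i))" "x = d (Suc i) y" by (auto simp: boundaries_def)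
    have x: "x \<in> carrier (P i)" using y module_homD(1)[OF d_hom] by simp
    show ?thesis
    proof (cases i)
      case (Suc j)
      have "d i x = \<zero>\<^bsub>P j\<^esub>" using y Suc d_d by simp
      then show ?thesis using x Suc submodule.zero_closed[OF submodule_span[OF modules max_smults_sub]]
        by (simp add: residue_cycles_def)
    qed (use x in \<open>simp add: residue_cycles_def\<close>)
  next
    case 2
    then have x: "x \<in> carrier (P i)" using max_smults_sub by blast
    show ?thesis
    proof (cases i)
      case (Suc j)
      obtain a z where a: "a \<in> \<mm>" "z \<in> carrier (P i)" "x = a \<odot>\<^bsub>P i\<^esub> z" using 2 by (auto simp: max_smults_def)
      then have "d i x = a \<odot>\<^bsub>P j\<^esub> d i z" "d i z \<in> carrier (P j)"
        using module_homD(1,3)[OF d_hom] max_ideal_subset Suc by auto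
      then have "d i x \<in> max_smults R (P j)" using a(1) by (auto simp: max_smults_def)
      then have "d i x \<in> module.span R (P j) (max_smults R (P j))"
        by (rule span_base[OF modules max_smults_sub])
      then show ?thesis using x Suc by (simp add: residue_cycles_def)
    qed (use x in \<open>simp add: residue_cycles_def\<close>)
  qed
qed

text \<open>The map from lifted cycles onto the homology, with kernel the span of \<open>B\<close>.
  The coset is formed in the record whose carrier is the cycles, as in
  \<open>homology\<close>.\<close>

definition \<psi> where
  "\<psi> i x = boundaries C D i +>\<^bsub>(C i)\<lparr>carrier := cycles C D i\<rparr>\<^esub> \<phi> i x"

lemma cycles_submodule: "submodule R (cycles C D i) (C i)"
  unfolding cycles_eq by (rule mod_hom.submodule_image[OF \<phi>_mod_hom Z_submodule])

lemma boundaries_sub: "submodule R (boundaries C D i) ((C i)\<lparr>carrier := cycles C D i\<rparr>)"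
proof (rule submodule_of_subset)
  show "submodule R (boundaries C D i) (C i)"
    unfolding boundaries_eq by (rule mod_hom.submodule_image[OF \<phi>_mod_hom boundaries_submodule])
  show "boundaries C D i \<subseteq> cycles C D i"
    unfolding boundaries_eq cycles_eq using B_subset_Z by (auto simp: residue_boundaries_def)
qed (rule cycles_submodule)

lemma H_module: "module R (H i)"
  unfolding homology_def by (rule quotient_module_module[OF boundaries_sub])

lemma Z_module: "module R ((P i)\<lparr>carrier := Z i\<rparr>)"
  by (rule module.submodule_is_module[OF modules Z_submodule])

lemma \<psi>_mod_hom: "mod_hom R ((P i)\<lparr>carrier := Z i\<rparr>) (H i) (\<psi> i)"
proof (rule mod_homI[OF Z_module H_module])
  interpret \<phi>: mod_hom R "P i" "C i" "\<phi> i" by (rule \<phi>_mod_hom)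
  have "\<phi> i \<in> module_hom R ((P i)\<lparr>carrier := Z i\<rparr>) ((C i)\<lparr>carrier := cycles C D i\<rparr>)"
    using submodule.subset[OF Z_submodule, of i] by (intro module_homI) (simp_all add: cycles_eq subset_iff)
  from module_hom_comp[OF this quotient_proj_hom[OF boundaries_sub]]
  show "\<psi> i \<in> module_hom R ((P i)\<lparr>carrier := Z i\<rparr>) (H i)"
    by (simp add: homology_def \<psi>_def[abs_def])
qed

lemma \<psi>_surj: "\<psi> i ` Z i = carrier (H i)"
proof -
  have "\<psi> i ` Z i = (\<lambda>y. boundaries C D i +>\<^bsub>(C i)\<lparr>carrier := cycles C D i\<rparr>\<^esub> y) ` cycles C D i"
    by (simp add: \<psi>_def cycles_eq image_image)
  then show ?thesis using quotient_proj_surj[OF boundaries_sub, of i] by (simp add: homology_def)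
qed

text \<open>If x \<otimes> 1 equals y \<otimes> 1 for a boundary \<open>y\<close> of
  \<open>P\<close>, then x - y lies in \<mm>P, the kernel of \<open>\<phi>\<close>. Conversely
  \<open>\<phi>\<close> kills multiples by \<mm>, so it sends the span of \<open>B\<close> into the
  images of boundaries.\<close>

lemma \<psi>_zero_iff:
  assumes x: "x \<in> Z i"
  shows "\<psi> i x = \<zero>\<^bsub>H i\<^esub> \<longleftrightarrow> x \<in> module.span R (P i) (B i)"
proof -
  interpret Pi: module R "P i" by (rule modules)
  interpret \<phi>: mod_hom R "P i" "C i" "\<phi> i" by (rule \<phi>_mod_hom)
  have xP: "x \<in> carrier (P i)" using x by (simp add: residue_cycles_def)
  have BP: "B i \<subseteq> carrier (P i)" using B_subset_Z by (auto simp: residue_cycles_def)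
  have span: "submodule R (module.span R (P i) (B i)) (P i)" by (rule submodule_span[OF modules BP])
  have sub: "module.span R (P i) (max_smults R (P i)) \<subseteq> module.span R (P i) (B i)"
    by (rule span_mono[OF modules]) (auto simp: residue_boundaries_def)
  have "\<psi> i x = \<zero>\<^bsub>H i\<^esub> \<longleftrightarrow> \<phi> i x \<in> \<phi> i ` boundaries P d i"
    unfolding \<psi>_def homology_def boundaries_eq[symmetric]
    using x by (intro quotient_proj_zero_iff[OF boundaries_sub]) (simp add: cycles_eq)
  also have "\<dots> \<longleftrightarrow> x \<in> module.span R (P i) (B i)"
  proof
    assume "\<phi> i x \<in> \<phi> i ` boundaries P d i"
    then obtain y where y: "y \<in> boundaries P d i" "\<phi> i x = \<phi> i y" by blast
    have yP: "y \<in> carrier (P i)" using y(1) submodule.subset[OF boundaries_submodule] by blast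
    have "\<phi> i (x \<ominus>\<^bsub>P i\<^esub> y) = \<zero>\<^bsub>C i\<^esub>" using xP yP y(2) by simp
    then have "x \<ominus>\<^bsub>P i\<^esub> y \<in> module.span R (P i) (B i)"
      using \<phi>_zero_iff[of "x \<ominus>\<^bsub>P i\<^esub> y" i] xP yP sub by auto
    moreover have "y \<in> module.span R (P i) (B i)"
      using y(1) by (intro span_base[OF modules BP]) (simp add: residue_boundaries_def)
    ultimately have "x \<ominus>\<^bsub>P i\<^esub> y \<oplus>\<^bsub>P i\<^esub> y \<in> module.span R (P i) (B i)"
      by (rule submodule.m_closed[OF span])
    then show "x \<in> module.span R (P i) (B i)"
      using xP yP by (simp add: a_minus_def Pi.M.a_assoc Pi.M.l_neg)
  next
    have "B i \<subseteq> {x \<in> carrier (P i). \<phi> i x \<in> \<phi> i ` boundaries P d i}"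
    proof
      fix y assume y: "y \<in> B i"
      have "\<phi> i y \<in> \<phi> i ` boundaries P d i"
      proof (cases "y \<in> boundaries P d i")
        case False
        then have "y \<in> max_smults R (P i)" using y by (simp add: residue_boundaries_def)
        then have "y \<in> module.span R (P i) (max_smults R (P i))" by (rule span_base[OF modules max_smults_sub])
        then have "\<phi> i y = \<zero>\<^bsub>C i\<^esub>" using \<phi>_zero_iff y BP by blast
        then have "\<phi> i y = \<phi> i \<zero>\<^bsub>P i\<^esub>" by simp
        then show ?thesis using submodule.zero_closed[OF boundaries_submodule] by (rule image_eqI)
      qed simp
      then show "y \<in> {x \<in> carrier (P i). \<phi> i x \<in> \<phi> i ` boundaries P d i}" using y BP by blast
    qed
    then have "module.span R (P i) (B i) \<subseteq> {x \<in> carrier (P i). \<phi> i x \<in> \<phi> i ` boundaries P d i}"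
      by (rule span_subset_submodule[OF \<phi>.submodule_vimage[OF \<phi>.submodule_image[OF boundaries_submodule]]])
    moreover assume "x \<in> module.span R (P i) (B i)"
    ultimately show "\<phi> i x \<in> \<phi> i ` boundaries P d i" by blast
  qed
  finally show ?thesis .
qed

lemma H_annihilated: "residue_annihilated R (H i)"
proof (intro residue_annihilated.intro residue_annihilated_axioms.intro cring_max_axioms H_module)
  interpret \<psi>: mod_hom R "(P i)\<lparr>carrier := Z i\<rparr>" "H i" "\<psi> i" by (rule \<psi>_mod_hom)
  fix a t assume a: "a \<in> \<mm>" and "t \<in> carrier (H i)"
  then obtain z where z: "z \<in> Z i" "t = \<psi> i z" using \<psi>_surj by blast
  have aR: "a \<in> carrier R" using a max_ideal_subset by blast
  have "a \<odot>\<^bsub>P i\<^esub> z \<in> B i" using a z by (auto simp: residue_boundaries_def max_smults_def residue_cycles_def)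
  moreover have "B i \<subseteq> carrier (P i)" using B_subset_Z by (auto simp: residue_cycles_def)
  ultimately have "a \<odot>\<^bsub>P i\<^esub> z \<in> module.span R (P i) (B i)" "a \<odot>\<^bsub>P i\<^esub> z \<in> Z i"
    using span_base[OF modules] B_subset_Z by blast+
  then have "\<psi> i (a \<odot>\<^bsub>P i\<^esub> z) = \<zero>\<^bsub>H i\<^esub>" using \<psi>_zero_iff by blast
  then show "a \<odot>\<^bsub>H i\<^esub> t = \<zero>\<^bsub>H i\<^esub>" using \<psi>.f_smult[of a z] aR z by simp
qed

lemma generators_image:
  assumes S: "homology_generators R P d i S"
  shows "\<psi> i ` S \<subseteq> carrier (H i)" "module.span R (H i) (\<psi> i ` S) = carrier (H i)"
proof -
  interpret \<psi>: mod_hom R "(P i)\<lparr>carrier := Z i\<rparr>" "H i" "\<psi> i" by (rule \<psi>_mod_hom)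
  have S': "S \<subseteq> Z i" "Z i \<subseteq> module.span R (P i) (S \<union> B i)" using S by (auto simp: homology_generators_def)
  show sub: "\<psi> i ` S \<subseteq> carrier (H i)" using S'(1) \<psi>_surj by blast
  let ?W = "module.span R (H i) (\<psi> i ` S)"
  have W: "submodule R ?W (H i)" by (rule submodule_span[OF H_module sub])
  have SB: "S \<union> B i \<subseteq> Z i" using S'(1) B_subset_Z by blast
  \<comment> \<open>Generation is stated in \<open>P i\<close>, while \<open>\<psi>\<close> is
    linear on \<open>Z i\<close> only; the span is the same in both.\<close>
  have "module.span R (P i) (S \<union> B i) = module.span R ((P i)\<lparr>carrier := Z i\<rparr>) (S \<union> B i)"
    by (rule module.span_li_not_depend(1)[OF modules SB Z_submodule, symmetric])
  also have "\<dots> \<subseteq> {x \<in> carrier ((P i)\<lparr>carrier := Z i\<rparr>). \<psi> i x \<in> ?W}"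
  proof (rule span_subset_submodule[OF \<psi>.submodule_vimage[OF W]], rule subsetI)
    fix x assume x: "x \<in> S \<union> B i"
    then have xZ: "x \<in> Z i" using SB by blast
    have "\<psi> i x \<in> ?W"
    proof (cases "x \<in> S")
      case True
      then show ?thesis by (intro span_base[OF H_module sub]) simp
    next
      case False
      then have "x \<in> module.span R (P i) (B i)"
        using x B_subset_Z by (intro span_base[OF modules]) (auto simp: residue_cycles_def)
      then show ?thesis using \<psi>_zero_iff[OF xZ] submodule.zero_closed[OF W] by simp
    qed
    then show "x \<in> {x \<in> carrier ((P i)\<lparr>carrier := Z i\<rparr>). \<psi> i x \<in> ?W}" using xZ by simp
  qed
  finally have "Z i \<subseteq> {x \<in> carrier ((P i)\<lparr>carrier := Z i\<rparr>). \<psi> i x \<in> ?W}" using S'(2) by (rule subset_trans[rotated])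
  then have "carrier (H i) \<subseteq> ?W" unfolding \<psi>_surj[symmetric] by auto
  then show "?W = carrier (H i)" using submodule.subset[OF W] by blast
qed

lemma generators_lift:
  assumes E: "finite E" "E \<subseteq> carrier (H i)" "module.span R (H i) E = carrier (H i)"
  shows "\<exists>S. homology_generators R P d i S \<and> card S = card E"
proof -
  interpret \<psi>: mod_hom R "(P i)\<lparr>carrier := Z i\<rparr>" "H i" "\<psi> i" by (rule \<psi>_mod_hom)
  interpret Pi: module R "P i" by (rule modules)
  \<comment> \<open>One preimage for each element of \<open>E\<close>, so that the cardinality is
    kept.\<close>
  obtain S where S: "S \<subseteq> Z i" "inj_on (\<psi> i) S" "E = \<psi> i ` S"
    using E(2) unfolding \<psi>_surj[symmetric] subset_image_inj by blast
  have fin: "finite S" using E(1) S(2,3) finite_imageD by blast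
  let ?U = "module.span R (P i) (S \<union> B i)"
  have SB: "S \<union> B i \<subseteq> Z i" using S(1) B_subset_Z by blast
  have ZP: "Z i \<subseteq> carrier (P i)" by (auto simp: residue_cycles_def)
  have SBP: "S \<union> B i \<subseteq> carrier (P i)" using SB ZP by blast
  have U: "submodule R ?U (P i)" by (rule submodule_span[OF modules SBP])
  have UZ: "?U \<subseteq> Z i" by (rule span_subset_submodule[OF Z_submodule SB])
  have subm: "submodule R (\<psi> i ` ?U) (H i)"
    by (rule \<psi>.submodule_image[OF submodule_of_subset[OF U Z_submodule UZ]])
  have "E \<subseteq> \<psi> i ` ?U" unfolding S(3) using span_base[OF modules SBP] by blast
  then have HU: "carrier (H i) \<subseteq> \<psi> i ` ?U" using span_subset_submodule[OF subm] E(3) by blast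
  have "z \<in> ?U" if z: "z \<in> Z i" for z
  proof -
    have "\<psi> i z \<in> carrier (H i)" using z \<psi>_surj by blast
    then have "\<psi> i z \<in> \<psi> i ` ?U" using HU by blast
    then obtain w where w: "w \<in> ?U" "\<psi> i z = \<psi> i w" by blast
    have wZ: "w \<in> Z i" using w UZ by blast
    have wz: "w \<in> carrier (P i)" "z \<in> carrier (P i)" using wZ z ZP by auto
    \<comment> \<open>The difference z - w is formed with the scalar -1: \<open>P i\<close> and its
      restriction to \<open>Z i\<close> share addition and scalar multiplication, whereas a negative
      is a description over the carrier.\<close>
    let ?m = "\<ominus>\<^bsub>R\<^esub> \<one>\<^bsub>R\<^esub> \<odot>\<^bsub>P i\<^esub> w"
    have mZ: "?m \<in> Z i" using submodule.smult_closed[OF Z_submodule _ wZ] by simp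
    then have zm: "z \<oplus>\<^bsub>P i\<^esub> ?m \<in> Z i" using submodule.m_closed[OF Z_submodule z] by simp
    have "\<psi> i (z \<oplus>\<^bsub>P i\<^esub> ?m) = \<psi> i z \<oplus>\<^bsub>H i\<^esub> \<psi> i ?m" using \<psi>.f_add[of z ?m] z mZ by simp
    also have "\<psi> i ?m = (\<ominus>\<^bsub>R\<^esub> \<one>\<^bsub>R\<^esub>) \<odot>\<^bsub>H i\<^esub> \<psi> i w" using \<psi>.f_smult[of "\<ominus>\<^bsub>R\<^esub> \<one>\<^bsub>R\<^esub>" w] wZ by simp
    also have "\<psi> i z \<oplus>\<^bsub>H i\<^esub> \<dots> = \<zero>\<^bsub>H i\<^esub>"
    proof -
      have "\<psi> i w \<in> carrier (H i)" using wZ \<psi>_surj by blast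
      then show ?thesis unfolding w(2) by (simp add: \<psi>.N.smult_minus_1 \<psi>.N.M.r_neg)
    qed
    finally have "z \<oplus>\<^bsub>P i\<^esub> ?m \<in> module.span R (P i) (B i)" using \<psi>_zero_iff[OF zm] by simp
    moreover have "module.span R (P i) (B i) \<subseteq> ?U" by (rule span_mono[OF modules]) simp
    ultimately have "z \<oplus>\<^bsub>P i\<^esub> ?m \<oplus>\<^bsub>P i\<^esub> w \<in> ?U" using submodule.m_closed[OF U _ w(1)] by blast
    then show ?thesis using wz by (simp add: Pi.smult_minus_1 Pi.M.a_assoc Pi.M.l_neg)
  qed
  then have "homology_generators R P d i S" using fin S(1) by (auto simp: homology_generators_def)
  moreover have "card S = card E" unfolding S(3) by (rule card_image[OF S(2), symmetric])
  ultimately show ?thesis by blast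
qed

lemma dim_le:
  assumes "homology_generators R P d i S"
  shows "vectorspace.dim (residue_field R) (residue_space R (H i)) \<le> card S"
proof -
  have "vectorspace.dim (residue_field R) (residue_space R (H i)) \<le> card (\<psi> i ` S)"
    unfolding residue_annihilated.residue_dim[OF H_annihilated]
    using generators_image[OF assms] assms
    by (intro Least_le exI[where x = "\<psi> i ` S"]) (simp add: homology_generators_def)
  also have "\<dots> \<le> card S" using assms by (intro card_image_le) (simp add: homology_generators_def)
  finally show ?thesis .
qed

text \<open>\<open>S0\<close> guarantees that a finite generating set exists; without one, the
  \<open>LEAST\<close> in the dimension has no specified value.\<close>

lemma dim_attained:
  assumes "homology_generators R P d i S0"
  shows "\<exists>S. homology_generators R P d i S \<and>
    card S = vectorspace.dim (residue_field R) (residue_space R (H i))"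
proof -
  let ?P = "\<lambda>n. \<exists>E. finite E \<and> card E = n \<and> E \<subseteq> carrier (H i) \<and> module.span R (H i) E = carrier (H i)"
  have "?P (card (\<psi> i ` S0))"
    using generators_image[OF assms] assms
    by (intro exI[where x = "\<psi> i ` S0"]) (simp add: homology_generators_def)
  then have "?P (Least ?P)" by (rule LeastI[where P = ?P])
  then obtain E where E: "finite E" "card E = Least ?P" "E \<subseteq> carrier (H i)"
    "module.span R (H i) E = carrier (H i)" by blast
  from generators_lift[OF E(1,3,4)] show ?thesis
    unfolding residue_annihilated.residue_dim[OF H_annihilated] E(2) .
qed

end

lemma betti_eq:
  "betti R i L = vectorspace.dim (residue_field R) (residue_space R (homology
     (\<lambda>j. tensor_product R (fst (some_resolution R L) j) (residue_module R))
     (\<lambda>j. tensor_map R (fst (some_resolution R L) j) (fst (some_resolution R L) (j - 1))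
            (residue_module R) (snd (some_resolution R L) j)) i))"
  by (simp add: betti_def Tor_def Let_def)

lemma some_resolution:
  fixes R :: "('a, 'r) ring_scheme"
    and P :: "nat \<Rightarrow> ('a, nat \<Rightarrow> 'a) module"
  assumes "projective_resolution R L P d \<epsilon>"
  shows "\<exists>\<epsilon>. projective_resolution R L (fst (some_resolution R L)) (snd (some_resolution R L)) \<epsilon>"
proof -
  have "\<exists>C :: (nat \<Rightarrow> ('a, nat \<Rightarrow> 'a) module) \<times> (nat \<Rightarrow> (nat \<Rightarrow> 'a) \<Rightarrow> nat \<Rightarrow> 'a).
      \<exists>\<epsilon>. projective_resolution R L (fst C) (snd C) \<epsilon>"
    using assms by (intro exI[where x = "(P, d)"] exI[where x = \<epsilon>]) simp
  then show ?thesis unfolding some_resolution_def by (rule someI_ex)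
qed

lemma residue_complex_resolution:
  assumes "cring_max R" "projective_resolution R L P d \<epsilon>"
  shows "residue_complex R P d"
proof -
  have P: "resolves R L P d \<epsilon>" using assms(2) by (simp add: projective_resolution_iff)
  show ?thesis
    by (intro residue_complex.intro residue_complex_axioms.intro assms(1)
        resolvesD(1,2)[OF P] resolves_differential(2)[OF P])
qed

section \<open>Modules over Noetherian rings\<close>

lemma (in cring) ideal_intro:
  assumes "I \<subseteq> carrier R" "\<zero> \<in> I" "\<And>a b. a \<in> I \<Longrightarrow> b \<in> I \<Longrightarrow> a \<oplus> b \<in> I"
    and smult: "\<And>r a. r \<in> carrier R \<Longrightarrow> a \<in> I \<Longrightarrow> r \<otimes> a \<in> I"
  shows "ideal I R"
proof (rule idealI[OF ring_axioms])
  show "subgroup I (add_monoid R)"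
  proof (rule subgroup.intro)
    show "inv\<^bsub>add_monoid R\<^esub> x \<in> I" if x: "x \<in> I" for x
    proof -
      have "\<ominus> x = (\<ominus> \<one>) \<otimes> x" using x assms(1) by (simp add: l_minus subset_iff)
      then show ?thesis using smult[OF _ x, of "\<ominus> \<one>"] by (simp add: a_inv_def)
    qed
  qed (use assms in auto)
  show "x \<otimes> a \<in> I" if "a \<in> I" "x \<in> carrier R" for a x by (rule smult[OF that(2,1)])
  show "a \<otimes> x \<in> I" if a: "a \<in> I" and x: "x \<in> carrier R" for a x
  proof -
    have "a \<in> carrier R" using a assms(1) by blast
    then show ?thesis using smult[OF x a] x by (simp add: m_comm)
  qed
qed

text \<open>The coefficients at \<open>b\<close> of elements of \<open>U\<close>, modulo
  \<open>W\<close>. Like leading coefficients in Hilbert's basis theorem, they bring finite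
  generation of ideals to bear on one generator at a time.\<close>

lemma coefficient_ideal:
  assumes M: "module R M" and U: "submodule R U M" and W: "submodule R W M" and b: "b \<in> carrier M"
  shows "ideal {r \<in> carrier R. \<exists>s\<in>W. r \<odot>\<^bsub>M\<^esub> b \<oplus>\<^bsub>M\<^esub> s \<in> U} R" (is "ideal ?I R")
proof -
  interpret M: module R M by (rule M)
  interpret U: submodule R U M by (rule U)
  interpret W: submodule R W M by (rule W)
  have WM: "s \<in> carrier M" if "s \<in> W" for s using that W.subset by blast
  have add: "r \<oplus>\<^bsub>R\<^esub> r' \<in> ?I" if r: "r \<in> ?I" "r' \<in> ?I" for r r'
  proof -
    obtain s s' where s: "s \<in> W" "s' \<in> W" "r \<odot>\<^bsub>M\<^esub> b \<oplus>\<^bsub>M\<^esub> s \<in> U" "r' \<odot>\<^bsub>M\<^esub> b \<oplus>\<^bsub>M\<^esub> s' \<in> U"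
      using r by (elim CollectE conjE bexE)
    have "(r \<oplus>\<^bsub>R\<^esub> r') \<odot>\<^bsub>M\<^esub> b \<oplus>\<^bsub>M\<^esub> (s \<oplus>\<^bsub>M\<^esub> s') =
        (r \<odot>\<^bsub>M\<^esub> b \<oplus>\<^bsub>M\<^esub> s) \<oplus>\<^bsub>M\<^esub> (r' \<odot>\<^bsub>M\<^esub> b \<oplus>\<^bsub>M\<^esub> s')"
      using that b WM[OF s(1)] WM[OF s(2)] by (simp add: M.smult_l_distr M.M.a_ac)
    also have "\<dots> \<in> U" using s(3,4) by (rule U.m_closed)
    finally show ?thesis
      using that s(1,2) by (intro CollectI conjI bexI[where x = "s \<oplus>\<^bsub>M\<^esub> s'"]) auto
  qed
  have smult: "a \<otimes>\<^bsub>R\<^esub> r \<in> ?I" if r: "a \<in> carrier R" "r \<in> ?I" for a r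
  proof -
    obtain s where s: "s \<in> W" "r \<odot>\<^bsub>M\<^esub> b \<oplus>\<^bsub>M\<^esub> s \<in> U" using r(2) by (elim CollectE conjE bexE)
    have "(a \<otimes>\<^bsub>R\<^esub> r) \<odot>\<^bsub>M\<^esub> b \<oplus>\<^bsub>M\<^esub> a \<odot>\<^bsub>M\<^esub> s = a \<odot>\<^bsub>M\<^esub> (r \<odot>\<^bsub>M\<^esub> b \<oplus>\<^bsub>M\<^esub> s)"
      using that b WM[OF s(1)] by (simp add: M.smult_r_distr M.smult_assoc1)
    also have "\<dots> \<in> U" using that(1) s(2) by (rule U.smult_closed)
    finally show ?thesis
      using that s(1) by (intro CollectI conjI bexI[where x = "a \<odot>\<^bsub>M\<^esub> s"]) auto
  qed
  have zero: "\<zero>\<^bsub>R\<^esub> \<in> ?I" using b by (auto intro!: bexI[where x = "\<zero>\<^bsub>M\<^esub>"])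
  show ?thesis by (rule M.R.ideal_intro) (use add smult zero in simp_all)
qed

lemma in_span_insert:
  assumes M: "module R M" and B: "B \<subseteq> carrier M" and b: "b \<in> carrier M"
    and x: "x \<in> module.span R M (insert b B)"
  shows "\<exists>r\<in>carrier R. \<exists>s\<in>module.span R M B. x = r \<odot>\<^bsub>M\<^esub> b \<oplus>\<^bsub>M\<^esub> s"
proof -
  interpret M: module R M by (rule M)
  let ?W = "module.span R M B"
  interpret W: submodule R ?W M by (rule submodule_span[OF M B])
  let ?U = "{r \<odot>\<^bsub>M\<^esub> b \<oplus>\<^bsub>M\<^esub> s | r s. r \<in> carrier R \<and> s \<in> ?W}"
  have WM: "s \<in> carrier M" if "s \<in> ?W" for s using that W.subset by blast
  have "submodule R ?U M"
  proof (rule submodule_intro[OF M])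
    show "?U \<subseteq> carrier M" using b WM by auto
    have "\<zero>\<^bsub>M\<^esub> = \<zero>\<^bsub>R\<^esub> \<odot>\<^bsub>M\<^esub> b \<oplus>\<^bsub>M\<^esub> \<zero>\<^bsub>M\<^esub>" using b by simp
    then show "\<zero>\<^bsub>M\<^esub> \<in> ?U"
      by (intro CollectI exI[where x = "\<zero>\<^bsub>R\<^esub>"] exI[where x = "\<zero>\<^bsub>M\<^esub>"] conjI
          M.R.zero_closed W.zero_closed)
  next
    fix x y assume "x \<in> ?U" "y \<in> ?U"
    then obtain r s r' s' where rs: "r \<in> carrier R" "s \<in> ?W" "x = r \<odot>\<^bsub>M\<^esub> b \<oplus>\<^bsub>M\<^esub> s"
      "r' \<in> carrier R" "s' \<in> ?W" "y = r' \<odot>\<^bsub>M\<^esub> b \<oplus>\<^bsub>M\<^esub> s'" by (elim CollectE exE conjE)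
    then have "x \<oplus>\<^bsub>M\<^esub> y = (r \<oplus>\<^bsub>R\<^esub> r') \<odot>\<^bsub>M\<^esub> b \<oplus>\<^bsub>M\<^esub> (s \<oplus>\<^bsub>M\<^esub> s')"
      using b WM by (simp add: M.smult_l_distr M.M.a_ac)
    moreover have "r \<oplus>\<^bsub>R\<^esub> r' \<in> carrier R" "s \<oplus>\<^bsub>M\<^esub> s' \<in> ?W" using rs by simp_all
    ultimately show "x \<oplus>\<^bsub>M\<^esub> y \<in> ?U" by (intro CollectI exI conjI)
  next
    fix a x assume a: "a \<in> carrier R" and "x \<in> ?U"
    then obtain r s where rs: "r \<in> carrier R" "s \<in> ?W" "x = r \<odot>\<^bsub>M\<^esub> b \<oplus>\<^bsub>M\<^esub> s" by (elim CollectE exE conjE)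
    then have "a \<odot>\<^bsub>M\<^esub> x = (a \<otimes>\<^bsub>R\<^esub> r) \<odot>\<^bsub>M\<^esub> b \<oplus>\<^bsub>M\<^esub> a \<odot>\<^bsub>M\<^esub> s"
      using a b WM by (simp add: M.smult_r_distr M.smult_assoc1)
    moreover have "a \<otimes>\<^bsub>R\<^esub> r \<in> carrier R" "a \<odot>\<^bsub>M\<^esub> s \<in> ?W" using a rs by simp_all
    ultimately show "a \<odot>\<^bsub>M\<^esub> x \<in> ?U" by (intro CollectI exI conjI)
  qed
  moreover have "insert b B \<subseteq> ?U"
  proof -
    have "b = \<one>\<^bsub>R\<^esub> \<odot>\<^bsub>M\<^esub> b \<oplus>\<^bsub>M\<^esub> \<zero>\<^bsub>M\<^esub>" using b by simp
    then have "b \<in> ?U"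
      by (intro CollectI exI[where x = "\<one>\<^bsub>R\<^esub>"] exI[where x = "\<zero>\<^bsub>M\<^esub>"] conjI
          M.R.one_closed W.zero_closed)
    moreover have "y \<in> ?U" if y: "y \<in> B" for y
    proof -
      have "y = \<zero>\<^bsub>R\<^esub> \<odot>\<^bsub>M\<^esub> b \<oplus>\<^bsub>M\<^esub> y" using b y B by auto
      then show ?thesis using span_base[OF M B y] M.R.zero_closed by (intro CollectI exI conjI)
    qed
    ultimately show ?thesis by blast
  qed
  ultimately have "module.span R M (insert b B) \<subseteq> ?U" by (rule span_subset_submodule)
  from subsetD[OF this x] obtain r s where "r \<in> carrier R" "s \<in> ?W" "x = r \<odot>\<^bsub>M\<^esub> b \<oplus>\<^bsub>M\<^esub> s"
    by (elim CollectE exE conjE)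
  then show ?thesis by (intro bexI)
qed

text \<open>Adjoining a generator \<open>b\<close> splits \<open>U\<close> into its intersection
  with the span \<open>?W\<close> of the old generators and the ideal of coefficients at
  \<open>b\<close>; both are finitely generated.\<close>

lemma noetherian_submodule_finite:
  assumes R: "noetherian_ring R" and M: "module R M"
    and B: "finite B" "B \<subseteq> carrier M" and U: "submodule R U M" "U \<subseteq> module.span R M B"
  shows "\<exists>C. finite C \<and> C \<subseteq> U \<and> module.span R M C = U"
  using B U
proof (induction B arbitrary: U rule: finite_induct)
  case empty
  interpret M: module R M by (rule M)
  have "submodule R {\<zero>\<^bsub>M\<^esub>} M" by (rule submodule_intro[OF M]) auto
  then have "module.span R M {} \<subseteq> {\<zero>\<^bsub>M\<^esub>}" by (rule span_subset_submodule) simp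
  then have "U \<subseteq> {\<zero>\<^bsub>M\<^esub>}" using empty.prems(3) by blast
  moreover have "\<zero>\<^bsub>M\<^esub> \<in> module.span R M {}"
    using submodule.zero_closed[OF submodule_span[OF M, of "{}"]] by simp
  ultimately have "U \<subseteq> module.span R M {}" by auto
  moreover have "module.span R M {} \<subseteq> U" by (rule span_subset_submodule[OF empty.prems(2)]) simp
  ultimately show ?case by (intro exI[where x = "{}"]) simp
next
  case (insert b B)
  interpret M: module R M by (rule M)
  have bM: "b \<in> carrier M" and BM: "B \<subseteq> carrier M" using insert.prems(1) by auto
  let ?W = "module.span R M B"
  have W: "submodule R ?W M" by (rule submodule_span[OF M BM])
  have UM: "U \<subseteq> carrier M" by (rule submodule.subset[OF insert.prems(2)])
  let ?I = "\<lambda>V. {r \<in> carrier R. \<exists>s\<in>?W. r \<odot>\<^bsub>M\<^esub> b \<oplus>\<^bsub>M\<^esub> s \<in> V}"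
  obtain A where A: "A \<subseteq> carrier R" "finite A" "?I U = genideal R A"
    using noetherian_ring.finetely_gen[OF R coefficient_ideal[OF M insert.prems(2) W bM]] by blast
  have "A \<subseteq> ?I U" unfolding A(3) by (rule M.R.genideal_self[OF A(1)])
  then have "\<exists>s\<in>?W. a \<odot>\<^bsub>M\<^esub> b \<oplus>\<^bsub>M\<^esub> s \<in> U" if "a \<in> A" for a using that by blast
  then obtain s where s: "\<And>a. a \<in> A \<Longrightarrow> s a \<in> ?W" "\<And>a. a \<in> A \<Longrightarrow> a \<odot>\<^bsub>M\<^esub> b \<oplus>\<^bsub>M\<^esub> s a \<in> U"
    by metis
  have "submodule R (U \<inter> ?W) M"
    using submodule.subset[OF W] submodule.zero_closed[OF W] submodule.m_closed[OF W]
      submodule.smult_closed[OF W] submodule.zero_closed[OF insert.prems(2)]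
      submodule.m_closed[OF insert.prems(2)] submodule.smult_closed[OF insert.prems(2)]
    by (intro submodule_intro[OF M]) auto
  from insert.IH[OF BM this] obtain C where C: "finite C" "C \<subseteq> U \<inter> ?W" "module.span R M C = U \<inter> ?W"
    by blast
  \<comment> \<open>Generators of the part in \<open>?W\<close>, and for each generator
    \<open>a\<close> of the coefficient ideal one element of \<open>U\<close> with coefficient
    \<open>a\<close> at \<open>b\<close>.\<close>
  define D where "D = C \<union> (\<lambda>a. a \<odot>\<^bsub>M\<^esub> b \<oplus>\<^bsub>M\<^esub> s a) ` A"
  have DU: "D \<subseteq> U" using C(2) s(2) by (auto simp: D_def)
  then have DM: "D \<subseteq> carrier M" using UM by blast
  let ?V = "module.span R M D"
  have V: "submodule R ?V M" by (rule submodule_span[OF M DM])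
  have VU: "?V \<subseteq> U" by (rule span_subset_submodule[OF insert.prems(2) DU])
  have "A \<subseteq> ?I ?V"
  proof
    fix a assume a: "a \<in> A"
    then have "a \<odot>\<^bsub>M\<^esub> b \<oplus>\<^bsub>M\<^esub> s a \<in> ?V" by (intro span_base[OF M DM]) (simp add: D_def)
    then show "a \<in> ?I ?V" using a A(1) s(1) by blast
  qed
  then have IV: "?I U \<subseteq> ?I ?V"
    unfolding A(3) by (rule M.R.genideal_minimal[OF coefficient_ideal[OF M V W bM]])
  have "x \<in> ?V" if x: "x \<in> U" for x
  proof -
    have "x \<in> module.span R M (insert b B)" using x insert.prems(3) by blast
    from in_span_insert[OF M BM bM this] obtain r t
      where r: "r \<in> carrier R" "t \<in> ?W" "x = r \<odot>\<^bsub>M\<^esub> b \<oplus>\<^bsub>M\<^esub> t" by (elim bexE)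
    then have "r \<in> ?I U" using x by (intro CollectI conjI bexI[where x = t]) simp_all
    from subsetD[OF IV this] obtain u where u: "u \<in> ?W" "r \<odot>\<^bsub>M\<^esub> b \<oplus>\<^bsub>M\<^esub> u \<in> ?V"
      by (elim CollectE conjE bexE)
    have tu: "t \<in> carrier M" "u \<in> carrier M" using r(2) u(1) submodule.subset[OF W] by auto
    \<comment> \<open>An element of \<open>?V\<close> with the same coefficient at \<open>b\<close>
      is split off. The remainder t - u lies in \<open>U\<close> and in \<open>?W\<close>, hence in
      the span of \<open>C\<close>.\<close>
    have eq: "x = (r \<odot>\<^bsub>M\<^esub> b \<oplus>\<^bsub>M\<^esub> u) \<oplus>\<^bsub>M\<^esub> (t \<ominus>\<^bsub>M\<^esub> u)"
      using tu r bM by (simp add: a_minus_def M.M.a_ac M.M.r_neg2)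
    have "x \<ominus>\<^bsub>M\<^esub> (r \<odot>\<^bsub>M\<^esub> b \<oplus>\<^bsub>M\<^esub> u) \<in> U" using submodule_minus[OF insert.prems(2) x] u(2) VU by blast
    moreover have "x \<ominus>\<^bsub>M\<^esub> (r \<odot>\<^bsub>M\<^esub> b \<oplus>\<^bsub>M\<^esub> u) = t \<ominus>\<^bsub>M\<^esub> u"
    proof -
      have "x \<ominus>\<^bsub>M\<^esub> (r \<odot>\<^bsub>M\<^esub> b \<oplus>\<^bsub>M\<^esub> u) = r \<odot>\<^bsub>M\<^esub> b \<oplus>\<^bsub>M\<^esub> (t \<oplus>\<^bsub>M\<^esub> (\<ominus>\<^bsub>M\<^esub> (r \<odot>\<^bsub>M\<^esub> b) \<oplus>\<^bsub>M\<^esub> \<ominus>\<^bsub>M\<^esub> u))"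
        using tu r bM by (simp add: a_minus_def M.M.minus_add M.M.a_assoc)
      also have "\<dots> = t \<ominus>\<^bsub>M\<^esub> u"
        using tu r bM M.M.a_lcomm[of t "\<ominus>\<^bsub>M\<^esub> (r \<odot>\<^bsub>M\<^esub> b)" "\<ominus>\<^bsub>M\<^esub> u"]
        by (simp add: a_minus_def M.M.r_neg2)
      finally show ?thesis .
    qed
    ultimately have "t \<ominus>\<^bsub>M\<^esub> u \<in> U \<inter> ?W" using submodule_minus[OF W r(2) u(1)] by simp
    then have "t \<ominus>\<^bsub>M\<^esub> u \<in> module.span R M C" using C(3) by simp
    then have "t \<ominus>\<^bsub>M\<^esub> u \<in> ?V" using span_mono[OF M, of C D] by (auto simp: D_def)
    then show ?thesis unfolding eq by (rule submodule.m_closed[OF V u(2)])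
  qed
  then have "?V = U" using VU by blast
  moreover have "finite D" using C(1) A(2) by (simp add: D_def)
  ultimately show ?case using DU by blast
qed

section \<open>Finite free covers and resolutions\<close>

lemma free_cover:
  assumes M: "module R M" and B: "finite B" "B \<subseteq> carrier M"
  shows "\<exists>(n::nat) f. f \<in> module_hom R (free_module R {..<n}) M \<and>
    f ` carrier (free_module R {..<n}) = module.span R M B"
proof -
  interpret M: module R M by (rule M)
  let ?n = "card B"
  let ?F = "free_module R {..<?n}"
  obtain b where b: "bij_betw b {0..<?n} B" using ex_bij_betw_nat_finite[OF B(1)] by blast
  then have bB: "b ` {..<?n} = B" by (simp add: bij_betw_def lessThan_atLeast0)
  then have bcl: "b i \<in> carrier M" if "i \<in> {..<?n}" for i using B(2) that by blast
  obtain f where f: "f \<in> module_hom R ?F M" "\<forall>i\<in>{..<?n}. f (free_gen R i) = b i"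
    by (rule free_module_lift[OF M bcl])
  interpret f: mod_hom R ?F M f by (rule mod_homI[OF M.R.free_module_module M f(1)])
  have S: "submodule R (module.span R M B) M" by (rule submodule_span[OF M B(2)])
  have "{v \<in> carrier ?F. f v \<in> module.span R M B} = carrier ?F"
  proof (rule M.R.free_module_induct[OF f.submodule_vimage[OF S]])
    fix i assume i: "i \<in> {..<?n}"
    then have "b i \<in> module.span R M B" using bB by (intro span_base[OF M B(2)]) blast
    then show "free_gen R i \<in> {v \<in> carrier ?F. f v \<in> module.span R M B}"
      using f(2) i M.R.free_gen_closed[OF i] by (simp del: free_module_sel)
  qed
  then have "f ` carrier ?F \<subseteq> module.span R M B" by blast
  moreover have "module.span R M B \<subseteq> f ` carrier ?F"
  proof (rule span_subset_submodule[OF f.submodule_image[OF submodule_carrier[OF M.R.free_module_module]]])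
    show "B \<subseteq> f ` carrier ?F"
    proof
      fix y assume "y \<in> B"
      then have "y \<in> b ` {..<?n}" by (simp only: bB)
      then obtain i where i: "i \<in> {..<?n}" "y = b i" by (elim imageE)
      then have "y = f (free_gen R i)" using f(2) by simp
      then show "y \<in> f ` carrier ?F" using M.R.free_gen_closed[OF i(1)] by (rule image_eqI)
    qed
  qed
  ultimately show ?thesis by (intro exI[where x = ?n] exI[where x = f] conjI f(1) equalityI)
qed

lemma free_submodule_finite:
  assumes "noetherian_ring R" "cring R" "submodule R U (free_module R {..<n::nat})"
  shows "\<exists>C. finite C \<and> C \<subseteq> U \<and> module.span R (free_module R {..<n}) C = U"
proof -
  interpret cring R by fact
  let ?F = "free_module R {..<n}" and ?B = "free_gen R ` {..<n}"
  have B: "?B \<subseteq> carrier ?F" by (rule image_subsetI) (rule free_gen_closed)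
  have span: "module.span R ?F ?B = carrier ?F"
  proof (rule free_module_induct[OF submodule_span[OF free_module_module B]])
    fix i assume "i \<in> {..<n}"
    then show "free_gen R i \<in> module.span R ?F ?B"
      by (intro span_base[OF free_module_module B] imageI)
  qed
  have sub: "U \<subseteq> module.span R ?F ?B" unfolding span by (rule submodule.subset[OF assms(3)])
  have fin: "finite ?B" by simp
  show ?thesis by (rule noetherian_submodule_finite[OF assms(1) free_module_module fin B assms(3) sub])
qed

text \<open>One step of a free resolution: the kernel is finitely generated over a Noetherian ring,
  and a finite free cover of it is the next differential.\<close>

lemma free_cover_kernel:
  assumes R: "noetherian_ring R" "cring R" and M: "module R M"
    and f: "f \<in> module_hom R (free_module R {..<n::nat}) M"
  shows "\<exists>(m::nat) g. g \<in> module_hom R (free_module R {..<m}) (free_module R {..<n}) \<and>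
    g ` carrier (free_module R {..<m}) = {v \<in> carrier (free_module R {..<n}). f v = \<zero>\<^bsub>M\<^esub>}"
proof -
  note F = cring.free_module_module[OF R(2)]
  interpret f: mod_hom R "free_module R {..<n}" M f by (rule mod_homI[OF F M f])
  from free_submodule_finite[OF R f.ker_is_submodule] obtain C where C: "finite C" "C \<subseteq> f.ker"
    "module.span R (free_module R {..<n}) C = f.ker" by blast
  have "C \<subseteq> carrier (free_module R {..<n})"
    using C(2) submodule.subset[OF f.ker_is_submodule] by (rule subset_trans)
  from free_cover[OF F C(1) this] obtain m :: nat and g where
    g: "g \<in> module_hom R (free_module R {..<m}) (free_module R {..<n})"
    and im: "g ` carrier (free_module R {..<m}) = module.span R (free_module R {..<n}) C"
    by (elim exE conjE)
  have "f.ker = {v \<in> carrier (free_module R {..<n}). f v = \<zero>\<^bsub>M\<^esub>}" by (simp only: f.ker_def)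
  then show ?thesis using g im C(3) by (intro exI[where x = m] exI[where x = g] conjI) (rule g, metis)
qed

lemma free_resolution_exists:
  fixes R :: "('a, 'r) ring_scheme"
  assumes R: "noetherian_ring R" "cring R" and L: "module R L" "finitely_generated R L"
  shows "\<exists>(n :: nat \<Rightarrow> nat) d \<epsilon>. projective_resolution R L (\<lambda>i. free_module R {..<n i}) d \<epsilon>"
proof -
  let ?F = "\<lambda>n::nat. free_module R {..<n}"
  obtain B where B: "finite B" "B \<subseteq> carrier L" "module.span R L B = carrier L"
    using L(2) by (auto simp: finitely_generated_def)
  obtain n0 \<epsilon> where \<epsilon>: "\<epsilon> \<in> module_hom R (?F n0) L" "\<epsilon> ` carrier (?F n0) = carrier L"
    using free_cover[OF L(1) B(1,2)] unfolding B(3) by (elim exE conjE)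
  \<comment> \<open>A state is a differential \<open>f\<close> from rank \<open>m\<close> to rank
    \<open>n\<close>. Its successor must have target rank \<open>m\<close> and image the kernel of
    \<open>f\<close>; state 0 covers the kernel of the augmentation.\<close>
  define Z where "Z i x \<longleftrightarrow> (case x of (n, m, f) \<Rightarrow> f \<in> module_hom R (?F m) (?F n) \<and>
      (i = (0::nat) \<longrightarrow> n = n0 \<and> f ` carrier (?F m) = {v \<in> carrier (?F n0). \<epsilon> v = \<zero>\<^bsub>L\<^esub>}))" for i x
  have "\<exists>st. \<forall>i. Z i (st i) \<and> (case st i of (n, m, f) \<Rightarrow> case st (Suc i) of (n', m', g) \<Rightarrow>
      n' = m \<and> g ` carrier (?F m') = {v \<in> carrier (?F m). f v = \<zero>\<^bsub>?F n\<^esub>})"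
  proof (rule dependent_nat_choice)
    obtain m g where "g \<in> module_hom R (?F m) (?F n0)"
      "g ` carrier (?F m) = {v \<in> carrier (?F n0). \<epsilon> v = \<zero>\<^bsub>L\<^esub>}"
      using free_cover_kernel[OF R L(1) \<epsilon>(1)] by (elim exE conjE)
    then show "\<exists>x. Z 0 x"
      by (intro exI[where x = "(n0, m, g)"]) (simp only: Z_def prod.case simp_thms)
  next
    fix x i assume x: "Z i x"
    obtain n m f where nmf: "x = (n, m, f)" by (cases x)
    have f: "f \<in> module_hom R (?F m) (?F n)" using x by (simp only: Z_def nmf prod.case)
    obtain m' g where "g \<in> module_hom R (?F m') (?F m)"
      "g ` carrier (?F m') = {v \<in> carrier (?F m). f v = \<zero>\<^bsub>?F n\<^esub>}"
      using free_cover_kernel[OF R cring.free_module_module[OF R(2)] f] by (elim exE conjE)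
    then show "\<exists>y. Z (Suc i) y \<and> (case x of (n, m, f) \<Rightarrow> case y of (n', m', g) \<Rightarrow>
        n' = m \<and> g ` carrier (?F m') = {v \<in> carrier (?F m). f v = \<zero>\<^bsub>?F n\<^esub>})"
      by (intro exI[where x = "(m, m', g)"]) (simp only: Z_def nmf prod.case nat.distinct simp_thms)
  qed
  then obtain st where st: "\<forall>i. Z i (st i) \<and> (case st i of (n, m, f) \<Rightarrow> case st (Suc i) of (n', m', g) \<Rightarrow>
      n' = m \<and> g ` carrier (?F m') = {v \<in> carrier (?F m). f v = \<zero>\<^bsub>?F n\<^esub>})" by (elim exE)
  define n where "n i = fst (st i)" for i
  \<comment> \<open>Shift by one: state \<open>i\<close> holds the differential out of degree
    \<open>i + 1\<close>. By truncated subtraction \<open>d 0\<close> repeats \<open>d 1\<close>,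
    and resolutions ignore it.\<close>
  define d where "d i = snd (snd (st (i - 1)))" for i
  have eq: "st i = (n i, n (Suc i), d (Suc i))" for i
    using conjunct2[OF spec[OF st, of i]]
    by (cases "st i"; cases "st (Suc i)") (simp only: prod.case n_def d_def fst_conv snd_conv diff_Suc_1)
  have Z: "Z i (n i, n (Suc i), d (Suc i))" for i using conjunct1[OF spec[OF st, of i]] unfolding eq .
  have d: "d (Suc i) \<in> module_hom R (?F (n (Suc i))) (?F (n i))" for i
    using Z[of i] by (simp only: Z_def prod.case)
  have n0: "n 0 = n0" using Z[of 0] by (simp only: Z_def prod.case simp_thms)
  have d0: "d (Suc 0) ` carrier (?F (n (Suc 0))) = {v \<in> carrier (?F (n 0)). \<epsilon> v = \<zero>\<^bsub>L\<^esub>}"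
    using Z[of 0] by (simp only: Z_def prod.case simp_thms)
  have dS: "d (Suc (Suc i)) ` carrier (?F (n (Suc (Suc i)))) =
      {v \<in> carrier (?F (n (Suc i))). d (Suc i) v = \<zero>\<^bsub>?F (n i)\<^esub>}" for i
    using conjunct2[OF spec[OF st, of i]] unfolding eq by (simp only: prod.case)
  have "projective_resolution R L (\<lambda>i. ?F (n i)) d \<epsilon>"
    unfolding projective_resolution_def
  proof (intro conjI allI)
    show "projective_module R (?F (n i))" for i by (rule projective_free_module[OF R(2)])
    show "d (Suc i) \<in> module_hom R (?F (n (Suc i))) (?F (n i))" for i by (rule d)
    show "\<epsilon> \<in> module_hom R (?F (n 0)) L" "\<epsilon> ` carrier (?F (n 0)) = carrier L" unfolding n0 by (fact \<epsilon>)+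
    show "boundaries (\<lambda>i. ?F (n i)) d 0 = {v \<in> carrier (?F (n 0)). \<epsilon> v = \<zero>\<^bsub>L\<^esub>}"
      unfolding boundaries_def by (rule d0)
    show "boundaries (\<lambda>i. ?F (n i)) d (Suc i) = cycles (\<lambda>i. ?F (n i)) d (Suc i)" for i
      unfolding boundaries_def cycles_def dS by (simp only: nat.distinct simp_thms diff_Suc_1)
  qed
  then show ?thesis by (intro exI)
qed

text \<open>The lifted cycles are a submodule of a free module of finite rank, so they are finitely
  generated even before the boundaries are adjoined.\<close>

lemma homology_generators_exist:
  assumes R: "noetherian_ring R" "cring_max R"
    and P: "projective_resolution R L (\<lambda>i. free_module R {..<n i :: nat}) d \<epsilon>"
  shows "\<exists>S. homology_generators R (\<lambda>i. free_module R {..<n i}) d i S"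
proof -
  interpret residue_complex R "\<lambda>i. free_module R {..<n i}" d
    by (rule residue_complex_resolution[OF R(2) P])
  obtain S where S: "finite S" "S \<subseteq> Z i" "module.span R (free_module R {..<n i}) S = Z i"
    using free_submodule_finite[OF R(1) is_cring Z_submodule] by blast
  have "Z i \<subseteq> module.span R (free_module R {..<n i}) (S \<union> B i)"
    using span_mono[OF free_module_module, of S "S \<union> B i" "{..<n i}"] S(3) by auto
  then show ?thesis using S(1,2) by (intro exI[where x = S]) (simp add: homology_generators_def)
qed

text \<open>Lets the retraction lemma, taken for the identity of a single ring, compare two
  resolutions of the same module.\<close>

lemma restrict_scalars_id: "restrict_scalars (\<lambda>a. a) M = M"
  by (cases M) (simp add: restrict_scalars_def)

text \<open>Over \<open>A\<close> a resolution in the type required by \<open>Tor\<close> is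
  constructed; over R it is the given \<open>P\<close>, which finite projective dimension will
  provide.\<close>

lemma betti_retract_le:
  fixes R :: "('a, 'r) ring_scheme" and A :: "('b, 's) ring_scheme"
    and P :: "nat \<Rightarrow> ('a, nat \<Rightarrow> 'a) module"
  assumes R: "cring_max R" and A: "cring_max A" "noetherian_ring A"
    and \<iota>: "\<iota> \<in> ring_hom R A" "\<iota> ` max_ideal R \<subseteq> max_ideal A"
    and \<pi>: "\<pi> \<in> ring_hom A R" "\<pi> ` max_ideal A \<subseteq> max_ideal R"
    and retract: "\<And>r. r \<in> carrier R \<Longrightarrow> \<pi> (\<iota> r) = r"
    and N: "module R N" "finitely_generated A (restrict_scalars \<pi> N)"
    and P: "projective_resolution R N P d \<epsilon>"
  shows "betti R i N \<le> betti A i (restrict_scalars \<pi> N)"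
proof -
  interpret R: cring_max R by (rule R)
  interpret A: cring_max A by (rule A)
  let ?L = "restrict_scalars \<pi> N"
  have L: "module A ?L" by (rule restrict_scalars_module[OF \<pi>(1) A.is_cring N(1)])
  obtain n e \<eta> where F: "projective_resolution A ?L (\<lambda>i. free_module A {..<n i :: nat}) e \<eta>"
    using free_resolution_exists[OF A(2) A.is_cring L N(2)] by (elim exE)
  obtain S where S: "homology_generators A (\<lambda>i. free_module A {..<n i}) e i S"
    using homology_generators_exist[OF A(2,1) F, of i] by (elim exE)
  define Q q where "Q = fst (some_resolution A ?L)" and "q = snd (some_resolution A ?L)"
  obtain \<eta>' where Q: "projective_resolution A ?L Q q \<eta>'"
    using some_resolution[OF F] unfolding Q_def q_def by (elim exE)
  \<comment> \<open>The resolution chosen for \<open>Tor\<close> may have terms that are not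
    finitely generated. Retraction along the identity ring map carries the finite set
    \<open>S\<close> over to it.\<close>
  have id: "(\<lambda>a. a) \<in> ring_hom A A" by (rule ring_hom_memI) auto
  obtain T0 where T0: "homology_generators A Q q i T0"
    using homology_generators_retract[OF id _ id _ _ A.is_cring A.is_cring A.max_ideal_subset A.max_ideal_subset L Q _ S]
      F by (auto simp add: restrict_scalars_id)
  interpret CA: residue_complex A Q q by (rule residue_complex_resolution[OF A(1) Q])
  \<comment> \<open>With \<open>T0\<close> at hand the Betti number over \<open>A\<close> is a
    genuine minimum, attained by \<open>T\<close>.\<close>
  obtain T where T: "homology_generators A Q q i T" "card T = betti A i ?L"
    using CA.dim_attained[OF T0, unfolded CA.D_def[abs_def],
        unfolded Q_def q_def, folded betti_eq] unfolding Q_def q_def by (elim exE conjE)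
  define P' p' where "P' = fst (some_resolution R N)" and "p' = snd (some_resolution R N)"
  obtain \<epsilon>' where P': "projective_resolution R N P' p' \<epsilon>'"
    using some_resolution[OF P] unfolding P'_def p'_def by (elim exE)
  have "\<exists>U. homology_generators R P' p' i U \<and> card U \<le> card T"
    by (rule homology_generators_retract[OF \<iota> \<pi> retract R.is_cring A.is_cring R.max_ideal_subset
        A.max_ideal_subset N(1) P' Q T(1)])
  then obtain U where U: "homology_generators R P' p' i U" "card U \<le> card T" by (elim exE conjE)
  interpret CR: residue_complex R P' p' by (rule residue_complex_resolution[OF R P'])
  have "betti R i N \<le> card U"
    using CR.dim_le[OF U(1), unfolded CR.D_def[abs_def]] unfolding betti_eq P'_def p'_def .
  then show ?thesis using U(2) T(2) by simp
qed

section \<open>The idealization\<close>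

lemma idealization_sel [simp]:
  "carrier (R \<ltimes> M) = carrier R \<times> carrier M" "\<zero>\<^bsub>R \<ltimes> M\<^esub> = (\<zero>\<^bsub>R\<^esub>, \<zero>\<^bsub>M\<^esub>)" "\<one>\<^bsub>R \<ltimes> M\<^esub> = (\<one>\<^bsub>R\<^esub>, \<zero>\<^bsub>M\<^esub>)"
  "(r, x) \<oplus>\<^bsub>R \<ltimes> M\<^esub> (s, y) = (r \<oplus>\<^bsub>R\<^esub> s, x \<oplus>\<^bsub>M\<^esub> y)"
  "(r, x) \<otimes>\<^bsub>R \<ltimes> M\<^esub> (s, y) = (r \<otimes>\<^bsub>R\<^esub> s, r \<odot>\<^bsub>M\<^esub> y \<oplus>\<^bsub>M\<^esub> s \<odot>\<^bsub>M\<^esub> x)"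
  by (simp_all add: idealization_def)

locale idealization_module = module R M
  for R :: "('a, 'r) ring_scheme" (structure) and M :: "('a, 'm) module"
begin

lemma idealization_cring: "cring (R \<ltimes> M)"
proof (rule cringI)
  show "abelian_group (R \<ltimes> M)"
  proof (rule abelian_groupI)
    fix p assume "p \<in> carrier (R \<ltimes> M)"
    then show "\<exists>q\<in>carrier (R \<ltimes> M). q \<oplus>\<^bsub>R \<ltimes> M\<^esub> p = \<zero>\<^bsub>R \<ltimes> M\<^esub>"
      by (intro bexI[where x = "(\<ominus> fst p, \<ominus>\<^bsub>M\<^esub> snd p)"]) (auto simp: R.l_neg M.l_neg)
  qed (auto simp: R.a_ac M.a_ac)
  show "comm_monoid (R \<ltimes> M)"
  proof (rule comm_monoidI)
    fix p q assume pq: "p \<in> carrier (R \<ltimes> M)" "q \<in> carrier (R \<ltimes> M)"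
    then show "p \<otimes>\<^bsub>R \<ltimes> M\<^esub> q \<in> carrier (R \<ltimes> M)" by auto
    show "p \<otimes>\<^bsub>R \<ltimes> M\<^esub> q = q \<otimes>\<^bsub>R \<ltimes> M\<^esub> p" using pq by (auto simp: R.m_comm M.a_comm)
    fix s assume "s \<in> carrier (R \<ltimes> M)"
    with pq obtain a x b y c z where s: "p = (a, x)" "q = (b, y)" "s = (c, z)"
      "a \<in> carrier R" "x \<in> carrier M" "b \<in> carrier R" "y \<in> carrier M" "c \<in> carrier R" "z \<in> carrier M"
      by auto
    show "p \<otimes>\<^bsub>R \<ltimes> M\<^esub> q \<otimes>\<^bsub>R \<ltimes> M\<^esub> s = p \<otimes>\<^bsub>R \<ltimes> M\<^esub> (q \<otimes>\<^bsub>R \<ltimes> M\<^esub> s)"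
      unfolding s(1-3) using s(4-)
      by (simp add: smult_r_distr smult_assoc_simp R.m_comm[of c a] R.m_comm[of c b] R.m_assoc M.a_assoc)
  qed auto
  show "(p \<oplus>\<^bsub>R \<ltimes> M\<^esub> q) \<otimes>\<^bsub>R \<ltimes> M\<^esub> s = p \<otimes>\<^bsub>R \<ltimes> M\<^esub> s \<oplus>\<^bsub>R \<ltimes> M\<^esub> q \<otimes>\<^bsub>R \<ltimes> M\<^esub> s"
    if "p \<in> carrier (R \<ltimes> M)" "q \<in> carrier (R \<ltimes> M)" "s \<in> carrier (R \<ltimes> M)" for p q s
    using that by (auto simp: R.l_distr smult_l_distr smult_r_distr M.a_ac)
qed

lemma idealization_inclusion: "(\<lambda>r. (r, \<zero>\<^bsub>M\<^esub>)) \<in> ring_hom R (R \<ltimes> M)"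
  by (rule ring_hom_memI) auto

lemma idealization_projection: "fst \<in> ring_hom (R \<ltimes> M) R"
  by (rule ring_hom_memI) auto

lemma ideal_times_carrier:
  assumes "ideal I R" shows "ideal (I \<times> carrier M) (R \<ltimes> M)"
proof -
  interpret I: ideal I R by fact
  interpret A: cring "R \<ltimes> M" by (rule idealization_cring)
  show ?thesis
  proof (rule A.ideal_intro)
    show "p \<otimes>\<^bsub>R \<ltimes> M\<^esub> q \<in> I \<times> carrier M" if pq: "p \<in> carrier (R \<ltimes> M)" "q \<in> I \<times> carrier M" for p q
    proof -
      obtain r x s y where "p = (r, x)" "q = (s, y)" "r \<in> carrier R" "s \<in> I" "x \<in> carrier M" "y \<in> carrier M"
        using pq by auto
      then show ?thesis using I.I_l_closed[of s r] I.Icarr[of s] by simp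
    qed
    show "p \<oplus>\<^bsub>R \<ltimes> M\<^esub> q \<in> I \<times> carrier M" if pq: "p \<in> I \<times> carrier M" "q \<in> I \<times> carrier M" for p q
    proof -
      obtain r x s y where "p = (r, x)" "q = (s, y)" "r \<in> I" "s \<in> I" "x \<in> carrier M" "y \<in> carrier M"
        using pq by auto
      then show ?thesis by simp
    qed
    show "I \<times> carrier M \<subseteq> carrier (R \<ltimes> M)" using I.a_subset by (simp add: Sigma_mono)
  qed simp
qed

text \<open>Adding elements (0, x) of \<open>J\<close> changes the second component at will, so
  membership in \<open>J\<close> depends on the first component alone.\<close>

lemma ideal_eq_times_carrier:
  assumes J: "ideal J (R \<ltimes> M)" and nil: "\<And>x. x \<in> carrier M \<Longrightarrow> (\<zero>, x) \<in> J"
  obtains I where "ideal I R" "J = I \<times> carrier M"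
proof -
  interpret A: cring "R \<ltimes> M" by (rule idealization_cring)
  interpret J: ideal J "R \<ltimes> M" by (rule J)
  define I where "I = {r \<in> carrier R. (r, \<zero>\<^bsub>M\<^esub>) \<in> J}"
  have add: "(r \<oplus> s, x \<oplus>\<^bsub>M\<^esub> y) \<in> J" if "(r, x) \<in> J" "(s, y) \<in> J" for r s x y
    using J.a_closed[OF that] by simp
  have ideal: "ideal I R"
  proof (rule R.ideal_intro)
    show "\<zero> \<in> I" using nil by (simp add: I_def)
    show "r \<oplus> s \<in> I" if "r \<in> I" "s \<in> I" for r s
      using that add[of r "\<zero>\<^bsub>M\<^esub>" s "\<zero>\<^bsub>M\<^esub>"] by (simp add: I_def)
    show "a \<otimes> r \<in> I" if "a \<in> carrier R" "r \<in> I" for a r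
      using that J.I_l_closed[of "(r, \<zero>\<^bsub>M\<^esub>)" "(a, \<zero>\<^bsub>M\<^esub>)"] by (simp add: I_def)
  qed (auto simp: I_def)
  have iff: "(r, x) \<in> J \<longleftrightarrow> (r, x) \<in> I \<times> carrier M" for r x
  proof
    assume rx: "(r, x) \<in> J"
    then have "r \<in> carrier R" "x \<in> carrier M" using J.a_subset by auto
    then show "(r, x) \<in> I \<times> carrier M"
      using add[OF rx nil, of "\<ominus>\<^bsub>M\<^esub> x"] by (simp add: I_def M.r_neg)
  next
    assume "(r, x) \<in> I \<times> carrier M"
    then show "(r, x) \<in> J" using add[OF _ nil, of r "\<zero>\<^bsub>M\<^esub>" x] by (simp add: I_def)
  qed
  have "J = I \<times> carrier M"
  proof (rule Set.set_eqI)
    show "p \<in> J \<longleftrightarrow> p \<in> I \<times> carrier M" for p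
      using iff[of "fst p" "snd p"] by (simp only: prod.collapse)
  qed
  with ideal show ?thesis by (rule that)
qed

end

section \<open>The idealization as a Noetherian local ring\<close>

lemma (in noetherian_local_ring) maximal_iff: "maximalideal I R \<longleftrightarrow> I = max_ideal R"
  unfolding max_ideal_def using local theI'[OF local] by auto

lemma (in noetherian_local_ring) cring_max: "cring_max R"
  by (simp add: cring_max_def cring_max_axioms_def is_cring maximal_iff)

locale idealization_local = idealization_module R M + loc: noetherian_local_ring R
  for R :: "('a, 'r) ring_scheme" (structure) and M :: "('a, 'm) module"
begin

abbreviation "A \<equiv> R \<ltimes> M"

sublocale A: cring A by (rule idealization_cring)
sublocale mx: cring_max R by (rule loc.cring_max)

text \<open>An ideal above I \<times> M contains all (0, x), hence comes from an ideal of R above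
  \<open>I\<close>.\<close>

lemma maximalideal_times_carrier:
  assumes "maximalideal I R" shows "maximalideal (I \<times> carrier M) A"
proof -
  interpret I: maximalideal I R by fact
  show ?thesis
  proof (rule maximalidealI[OF ideal_times_carrier[OF I.is_ideal]])
    show "carrier A \<noteq> I \<times> carrier M"
      using I.I_notcarr I.a_subset M.zero_closed by (auto simp: times_eq_iff)
    fix J assume J: "ideal J A" and sub: "I \<times> carrier M \<subseteq> J"
    have "(\<zero>, x) \<in> J" if x: "x \<in> carrier M" for x
      using subsetD[OF sub, of "(\<zero>, x)"] x by simp
    from ideal_eq_times_carrier[OF J this] obtain L where L: "ideal L R" "J = L \<times> carrier M" .
    have "I \<subseteq> L"
    proof
      fix r assume "r \<in> I"
      then have "(r, \<zero>\<^bsub>M\<^esub>) \<in> J" using subsetD[OF sub, of "(r, \<zero>\<^bsub>M\<^esub>)"] by simp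
      then show "r \<in> L" using L(2) by simp
    qed
    moreover have "L \<subseteq> carrier R" using additive_subgroup.a_subset[OF ideal.axioms(1)[OF L(1)]] .
    ultimately have "L = I \<or> L = carrier R" by (rule I.I_maximal[OF L(1)])
    then show "J = I \<times> carrier M \<or> J = carrier A" using L(2) by (elim disjE) simp_all
  qed
qed

text \<open>A maximal ideal is prime, so it contains the elements (0, x), whose squares vanish. It
  is thus of the form I \<times> M, and locality of R leaves one candidate. This uniqueness
  evaluates the description \<open>max_ideal\<close> for the idealization.\<close>

lemma maximalideal_idealization: "maximalideal J A \<longleftrightarrow> J = max_ideal R \<times> carrier M"
proof
  assume J: "maximalideal J A"
  interpret J: maximalideal J A by (rule J)
  interpret JP: primeideal J A by (rule A.maximalideal_prime[OF J])
  have nil: "(\<zero>, x) \<in> J" if x: "x \<in> carrier M" for x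
  proof -
    have "(\<zero>, x) \<otimes>\<^bsub>A\<^esub> (\<zero>, x) \<in> J" using x additive_subgroup.zero_closed[OF ideal.axioms(1)[OF J.is_ideal]] by simp
    then show ?thesis using JP.I_prime[of "(\<zero>, x)" "(\<zero>, x)"] x by simp
  qed
  from ideal_eq_times_carrier[OF J.is_ideal nil] obtain I where I: "ideal I R" "J = I \<times> carrier M" .
  have "maximalideal I R"
  proof (rule maximalidealI[OF I(1)])
    show "carrier R \<noteq> I" using I(2) J.I_notcarr by auto
    fix L assume L: "ideal L R" and sub: "I \<subseteq> L" "L \<subseteq> carrier R"
    have "L \<times> carrier M = J \<or> L \<times> carrier M = carrier A"
    proof (rule J.I_maximal[OF ideal_times_carrier[OF L]])
      show "J \<subseteq> L \<times> carrier M" unfolding I(2) using sub(1) by (intro Sigma_mono) simp_all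
      show "L \<times> carrier M \<subseteq> carrier A" using sub(2) by (simp add: Sigma_mono)
    qed
    moreover have "carrier M \<noteq> {}" using M.zero_closed by blast
    ultimately show "L = I \<or> L = carrier R" unfolding I(2) idealization_sel times_eq_iff by blast
  qed
  then have "I = max_ideal R" by (rule loc.maximal_iff[THEN iffD1])
  then show "J = max_ideal R \<times> carrier M" using I(2) by simp
next
  assume "J = max_ideal R \<times> carrier M"
  then show "maximalideal J A" using maximalideal_times_carrier[OF mx.max_ideal] by (simp only:)
qed

lemma max_ideal_idealization: "max_ideal A = max_ideal R \<times> carrier M"
  unfolding max_ideal_def[of A] maximalideal_idealization by (rule the_eq_trivial)

lemma cring_max_idealization: "cring_max A"
  by (intro cring_max.intro cring_max_axioms.intro A.is_cring)
    (unfold max_ideal_idealization maximalideal_idealization, rule refl)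

text \<open>As an R-module the idealization is generated by (1, 0) and the pairs (0, b) with
  \<open>b\<close> a generator of \<open>M\<close>. Ideals are R-submodules, hence finitely
  generated over R, and the same elements generate them as ideals.\<close>

lemma noetherian_idealization:
  assumes "finitely_generated R M"
  shows "noetherian_ring A"
proof (rule A.noetherian_ringI)
  interpret am: cring_max A by (rule cring_max_idealization)
  fix I assume I: "ideal I A"
  let ?\<iota> = "\<lambda>r. (r, \<zero>\<^bsub>M\<^esub>)"
  let ?X = "restrict_scalars ?\<iota> (regular_module A)"
  have X: "module R ?X"
    by (rule restrict_scalars_module[OF idealization_inclusion R.is_cring am.regular_module_module])
  have sub: "submodule R J ?X" if J: "ideal J A" for J
  proof -
    interpret J: ideal J A by (rule J)
    have "submodule A J (regular_module A)"
      using J.a_subset J.I_l_closed J.zero_closed J.a_closed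
      by (intro submodule_intro[OF am.regular_module_module]) (simp_all del: idealization_sel)
    then show ?thesis by (rule submodule_restrict_scalars[OF idealization_inclusion R.is_cring])
  qed
  obtain B where B: "finite B" "B \<subseteq> carrier M" "module.span R M B = carrier M"
    using assms by (auto simp: finitely_generated_def)
  let ?B = "insert (\<one>, \<zero>\<^bsub>M\<^esub>) (Pair \<zero> ` B)"
  have B': "finite ?B" "?B \<subseteq> carrier ?X" using B by auto
  let ?U = "module.span R ?X ?B"
  interpret U: submodule R ?U ?X by (rule submodule_span[OF X B'(2)])
  have hom: "Pair \<zero> \<in> module_hom R M ?X" by (rule module_homI) auto
  have nil: "(\<zero>, x) \<in> ?U" if "x \<in> carrier M" for x
    using that unfolding B(3)[symmetric]
    by (rule module_hom_span[OF module_axioms hom U.submodule_axioms B(2), rotated -1])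
      (rule span_base[OF X B'(2)], simp)
  have "p \<in> ?U" if p: "p \<in> carrier A" for p
  proof -
    obtain r x where rx: "p = (r, x)" "r \<in> carrier R" "x \<in> carrier M" using p by auto
    have "r \<odot>\<^bsub>?X\<^esub> (\<one>, \<zero>\<^bsub>M\<^esub>) \<in> ?U"
      using rx by (intro U.smult_closed span_base[OF X B'(2)]) simp_all
    from U.m_closed[OF this nil[OF rx(3)]] show ?thesis using rx by simp
  qed
  then have "I \<subseteq> ?U" using additive_subgroup.a_subset[OF ideal.axioms(1)[OF I]] by blast
  from noetherian_submodule_finite[OF loc.noetherian_ring_axioms X B' sub[OF I] this]
  obtain C where C: "finite C" "C \<subseteq> I" "module.span R ?X C = I" by (elim exE conjE)
  have CA: "C \<subseteq> carrier A" using C(2) additive_subgroup.a_subset[OF ideal.axioms(1)[OF I]] by blast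
  have "I \<subseteq> genideal A C"
    unfolding C(3)[symmetric]
    by (rule span_subset_submodule[OF sub[OF A.genideal_ideal[OF CA]] A.genideal_self[OF CA]])
  moreover have "genideal A C \<subseteq> I" by (rule A.genideal_minimal[OF I C(2)])
  ultimately show "\<exists>C\<subseteq>carrier A. finite C \<and> I = genideal A C" using C(1) CA by blast
qed

text \<open>A scalar \<open>r\<close> acts on \<open>N\<close> as the pair (r, 0), so submodules
  over \<open>A\<close> are submodules over R and the same generators serve.\<close>

lemma finitely_generated_restrict_fst:
  assumes N: "module R N" "finitely_generated R N"
  shows "finitely_generated A (restrict_scalars fst N)"
proof -
  obtain B where B: "finite B" "B \<subseteq> carrier N" "module.span R N B = carrier N"
    using N(2) by (auto simp: finitely_generated_def)
  let ?L = "restrict_scalars fst N"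
  have L: "module A ?L" by (rule restrict_scalars_module[OF idealization_projection A.is_cring N(1)])
  have BL: "B \<subseteq> carrier ?L" using B(2) by simp
  let ?U = "module.span A ?L B"
  interpret U: submodule A ?U ?L by (rule submodule_span[OF L BL])
  have "submodule R ?U N"
  proof (rule submodule_intro[OF N(1)])
    show "r \<odot>\<^bsub>N\<^esub> x \<in> ?U" if "r \<in> carrier R" "x \<in> ?U" for r x
      using U.smult_closed[of "(r, \<zero>\<^bsub>M\<^esub>)" x] that by simp
  qed (use U.subset U.m_closed U.zero_closed in auto)
  then have "carrier N \<subseteq> ?U"
    unfolding B(3)[symmetric] by (rule span_subset_submodule) (use span_base[OF L BL] in blast)
  then have "?U = carrier ?L" using U.subset by auto
  then show ?thesis using B(1) BL unfolding finitely_generated_def by blast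
qed

lemma betti_idealization_ge:
  fixes P :: "nat \<Rightarrow> ('a, nat \<Rightarrow> 'a) module"
  assumes "finitely_generated R M" "module R N" "finitely_generated R N"
    and "projective_resolution R N P d \<epsilon>"
  shows "betti R i N \<le> betti A i (restrict_scalars fst N)"
proof (rule betti_retract_le[OF loc.cring_max cring_max_idealization
      noetherian_idealization[OF assms(1)] idealization_inclusion _ idealization_projection _ _ assms(2)
      finitely_generated_restrict_fst[OF assms(2,3)] assms(4)])
  show "(\<lambda>r. (r, \<zero>\<^bsub>M\<^esub>)) ` max_ideal R \<subseteq> max_ideal A"
    by (auto simp: max_ideal_idealization)
  show "fst ` max_ideal A \<subseteq> max_ideal R" by (auto simp: max_ideal_idealization)
qed simp

end

section \<open>Isomorphic modules\<close>

lemma projective_resolution_iso: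
  assumes P: "projective_resolution R L P d \<epsilon>" and L: "module R L" and N: "module R N"
    and h: "h \<in> module_hom R L N" and bij: "bij_betw h (carrier L) (carrier N)"
  shows "projective_resolution R N P d (\<lambda>x. h (\<epsilon> x))"
proof -
  interpret h: mod_hom R L N h by (rule mod_homI[OF L N h])
  have P': "resolves R L P d \<epsilon>" using P by (simp add: projective_resolution_iff)
  note p = resolvesD[OF P']
  have "h (\<epsilon> x) = \<zero>\<^bsub>N\<^esub> \<longleftrightarrow> \<epsilon> x = \<zero>\<^bsub>L\<^esub>" if "x \<in> carrier (P 0)" for x
    using inj_onD[OF bij_betw_imp_inj_on[OF bij], of "\<epsilon> x" "\<zero>\<^bsub>L\<^esub>"] module_homD(1)[OF p(3) that] by auto
  then have "boundaries P d 0 = {x \<in> carrier (P 0). h (\<epsilon> x) = \<zero>\<^bsub>N\<^esub>}" unfolding p(5) by blast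
  moreover have "(\<lambda>x. h (\<epsilon> x)) ` carrier (P 0) = carrier N"
    using bij_betw_imp_surj_on[OF bij] p(4) by (simp flip: image_image)
  moreover have "(\<lambda>x. h (\<epsilon> x)) \<in> module_hom R (P 0) N" by (rule module_hom_comp[OF p(3) h])
  ultimately show ?thesis using P unfolding projective_resolution_def by blast
qed

lemma module_hom_inverse:
  assumes L: "module R L" and N: "module R N"
    and h: "h \<in> module_hom R L N" and bij: "bij_betw h (carrier L) (carrier N)"
  shows "the_inv_into (carrier L) h \<in> module_hom R N L"
proof -
  interpret h: mod_hom R L N h by (rule mod_homI[OF L N h])
  let ?k = "the_inv_into (carrier L) h"
  have k: "?k (h x) = x" if "x \<in> carrier L" for x
    using that bij by (auto simp: bij_betw_def the_inv_into_f_f)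
  have ex: "\<exists>x\<in>carrier L. y = h x" if "y \<in> carrier N" for y using that bij by (auto simp: bij_betw_def)
  show ?thesis
  proof (rule module_homI)
    fix y assume "y \<in> carrier N"
    then obtain x where x: "x \<in> carrier L" "y = h x" using ex by blast
    then show "?k y \<in> carrier L" by (simp add: k)
    fix a assume a: "a \<in> carrier R"
    have "?k (a \<odot>\<^bsub>N\<^esub> y) = ?k (h (a \<odot>\<^bsub>L\<^esub> x))" using x a by simp
    also have "\<dots> = a \<odot>\<^bsub>L\<^esub> x" using x a by (intro k) simp
    finally show "?k (a \<odot>\<^bsub>N\<^esub> y) = a \<odot>\<^bsub>L\<^esub> ?k y" using x by (simp add: k)
  next
    fix y y' assume "y \<in> carrier N" "y' \<in> carrier N"
    then obtain x x' where x: "x \<in> carrier L" "y = h x" "x' \<in> carrier L" "y' = h x'" using ex by metis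
    have "?k (y \<oplus>\<^bsub>N\<^esub> y') = ?k (h (x \<oplus>\<^bsub>L\<^esub> x'))" using x by simp
    also have "\<dots> = x \<oplus>\<^bsub>L\<^esub> x'" using x by (intro k) simp
    finally show "?k (y \<oplus>\<^bsub>N\<^esub> y') = ?k y \<oplus>\<^bsub>L\<^esub> ?k y'" using x by (simp add: k)
  qed
qed

text \<open>Modules and differentials stay fixed while the augmentation changes.
  \<open>some_resolution\<close> then chooses by the same predicate for \<open>L\<close> and for
  \<open>N\<close>, so the chosen resolutions are equal and the Betti numbers agree
  literally.\<close>

lemma projective_resolution_iso_iff:
  assumes L: "module R L" and N: "module R N"
    and h: "h \<in> module_hom R L N" and bij: "bij_betw h (carrier L) (carrier N)"
  shows "(\<exists>\<epsilon>. projective_resolution R L P d \<epsilon>) \<longleftrightarrow> (\<exists>\<epsilon>. projective_resolution R N P d \<epsilon>)"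
proof
  assume "\<exists>\<epsilon>. projective_resolution R L P d \<epsilon>"
  then obtain \<epsilon> where "projective_resolution R L P d \<epsilon>" by (elim exE)
  from projective_resolution_iso[OF this L N h bij] show "\<exists>\<epsilon>. projective_resolution R N P d \<epsilon>"
    by (rule exI[where x = "\<lambda>x. h (\<epsilon> x)"])
next
  assume "\<exists>\<epsilon>. projective_resolution R N P d \<epsilon>"
  then obtain \<epsilon> where "projective_resolution R N P d \<epsilon>" by (elim exE)
  from projective_resolution_iso[OF this N L module_hom_inverse[OF L N h bij] bij_betw_the_inv_into[OF bij]]
  show "\<exists>\<epsilon>. projective_resolution R L P d \<epsilon>"
    by (rule exI[where x = "\<lambda>x. the_inv_into (carrier L) h (\<epsilon> x)"])
qed

lemma
  assumes "module R L" "module R N" "h \<in> module_hom R L N" "bij_betw h (carrier L) (carrier N)"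
  shows betti_iso: "betti R i L = betti R i N" and proj_dim_iso: "proj_dim R L = proj_dim R N"
proof -
  note iff = projective_resolution_iso_iff[OF assms]
  have "some_resolution R L = some_resolution R N" unfolding some_resolution_def iff ..
  then show "betti R i L = betti R i N" unfolding betti_eq by simp
  have "(\<exists>\<epsilon>. projective_resolution R L P d \<epsilon> \<and> Q) \<longleftrightarrow> (\<exists>\<epsilon>. projective_resolution R N P d \<epsilon> \<and> Q)"
    for P :: "nat \<Rightarrow> ('a, nat \<Rightarrow> 'a) module" and d Q
    using iff[of P d] by blast
  then show "proj_dim R L = proj_dim R N" unfolding proj_dim_def by (simp only:)
qed

text \<open>An injective map carries a strict chain of submodules to a strict chain, so
  \<open>L\<close> is at most as long as \<open>N\<close>.\<close>

lemma finite_length_iso: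
  assumes L: "module R L" and N: "module R N"
    and h: "h \<in> module_hom R L N" and bij: "bij_betw h (carrier L) (carrier N)"
    and "finite_length R N"
  shows "finite_length R L"
proof -
  interpret h: mod_hom R L N h by (rule mod_homI[OF L N h])
  have inj: "inj_on h (carrier L)" using bij by (rule bij_betw_imp_inj_on)
  have "module_length R L \<le> module_length R N"
    unfolding module_length_def
  proof (rule Sup_subset_mono, rule subsetI)
    fix l assume "l \<in> {enat n |n. \<exists>U. (\<forall>i\<le>n. submodule R (U i) L) \<and> (\<forall>i<n. U i \<subset> U (Suc i))}"
    then obtain n U where l: "l = enat n" and sub: "\<And>i. i \<le> n \<Longrightarrow> submodule R (U i) L"
      and strict: "\<And>i. i < n \<Longrightarrow> U i \<subset> U (Suc i)" by auto
    have "h ` U i \<subset> h ` U (Suc i)" if i: "i < n" for i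
    proof -
      have "U (Suc i) \<subseteq> carrier L" "U i \<subseteq> carrier L"
        using sub[of "Suc i"] sub[of i] i by (simp_all add: submodule.subset)
      then show ?thesis using strict[OF i] inj_on_image_eq_iff[OF inj, of "U i" "U (Suc i)"]
        by (simp add: psubset_eq image_mono)
    qed
    then show "l \<in> {enat n |n. \<exists>U. (\<forall>i\<le>n. submodule R (U i) N) \<and> (\<forall>i<n. U i \<subset> U (Suc i))}"
      using sub h.submodule_image l by (intro CollectI exI[where x = n] conjI exI[where x = "\<lambda>i. h ` U i"]) auto
  qed
  then show ?thesis using assms(5) unfolding finite_length_def by (rule le_less_trans)
qed

lemma finitely_generated_iso:
  assumes L: "module R L" and N: "module R N"
    and h: "h \<in> module_hom R L N" and bij: "bij_betw h (carrier L) (carrier N)"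
    and "finitely_generated R N"
  shows "finitely_generated R L"
proof -
  let ?k = "the_inv_into (carrier L) h"
  note k = module_hom_inverse[OF L N h bij] and kbij = bij_betw_the_inv_into[OF bij]
  obtain B where B: "finite B" "B \<subseteq> carrier N" "module.span R N B = carrier N"
    using assms(5) by (auto simp: finitely_generated_def)
  have kB: "?k ` B \<subseteq> carrier L" using B(2) module_homD(1)[OF k] by blast
  have S: "submodule R (module.span R L (?k ` B)) L" by (rule submodule_span[OF L kB])
  have "?k y \<in> module.span R L (?k ` B)" if "y \<in> carrier N" for y
    using that unfolding B(3)[symmetric]
    by (rule module_hom_span[OF N k S B(2), rotated -1]) (rule span_base[OF L kB], simp)
  then have "?k ` carrier N \<subseteq> module.span R L (?k ` B)" by (rule image_subsetI)
  then have "carrier L \<subseteq> module.span R L (?k ` B)" unfolding bij_betw_imp_surj_on[OF kbij] .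
  then have "module.span R L (?k ` B) = carrier L" using submodule.subset[OF S] by blast
  then show ?thesis using B(1) kB unfolding finitely_generated_def by blast
qed

text \<open>The first isomorphism theorem for a surjection from R^n: cosets of its kernel have the
  type over which the two conjectures quantify.\<close>

lemma finitely_generated_model:
  fixes R :: "('a, 'r) ring_scheme"
  assumes N: "module R N" "finitely_generated R N"
  obtains L :: "('a, (nat \<Rightarrow> 'a) set) module" and h
  where "module R L" "h \<in> module_hom R L N" "bij_betw h (carrier L) (carrier N)"
proof -
  interpret N: module R N by (rule N(1))
  obtain B where B: "finite B" "B \<subseteq> carrier N" "module.span R N B = carrier N"
    using N(2) by (auto simp: finitely_generated_def)
  from free_cover[OF N(1) B(1,2), unfolded B(3)] obtain n :: nat and f
    where f: "f \<in> module_hom R (free_module R {..<n}) N"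
      "f ` carrier (free_module R {..<n}) = carrier N" by (elim exE conjE)
  let ?F = "free_module R {..<n}"
  have F: "module R ?F" by (rule N.R.free_module_module)
  interpret f: mod_hom R ?F N f by (rule mod_homI[OF F N(1) f(1)])
  let ?L = "quotient_module ?F f.ker"
  let ?p = "\<lambda>v. f.ker +>\<^bsub>?F\<^esub> v"
  note ker = f.ker_is_submodule
  have L: "module R ?L" by (rule quotient_module_module[OF ker])
  have p0: "f v = \<zero>\<^bsub>N\<^esub>" if "v \<in> carrier ?F" "?p v = \<zero>\<^bsub>?L\<^esub>" for v
  proof -
    have "v \<in> f.ker" using quotient_proj_zero_iff[OF ker that(1)] that(2) by (rule iffD1)
    then show ?thesis by (rule f.f_ker)
  qed
  obtain h where h: "h \<in> module_hom R ?L N" "\<forall>v\<in>carrier ?F. h (?p v) = f v"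
    by (rule f.factor_through[OF L quotient_proj_hom[OF ker] quotient_proj_surj[OF ker] p0])
  interpret h: mod_hom R ?L N h by (rule mod_homI[OF L N(1) h(1)])
  have surj: "h ` carrier ?L = carrier N"
    unfolding quotient_proj_surj[OF ker, symmetric] image_image f(2)[symmetric]
    using h(2) by (intro image_cong refl) blast
  have inj: "x = y" if xy: "x \<in> carrier ?L" "y \<in> carrier ?L" "h x = h y" for x y
  proof -
    have "x \<ominus>\<^bsub>?L\<^esub> y \<in> carrier ?L" using xy(1,2) by (rule h.M.M.minus_closed)
    then obtain v where v: "v \<in> carrier ?F" "x \<ominus>\<^bsub>?L\<^esub> y = ?p v"
      unfolding quotient_proj_surj[OF ker, symmetric] by (elim imageE)
    have "h (x \<ominus>\<^bsub>?L\<^esub> y) = \<zero>\<^bsub>N\<^esub>" unfolding h.f_minus[OF xy(1,2)] xy(3) using xy(2) by simp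
    then have "f v = \<zero>\<^bsub>N\<^esub>" using h(2) v by simp
    then have "v \<in> f.ker" using v(1) unfolding f.ker_def by blast
    then have "x \<ominus>\<^bsub>?L\<^esub> y = \<zero>\<^bsub>?L\<^esub>" unfolding v(2) using quotient_proj_zero_iff[OF ker v(1)] by blast
    then show ?thesis using h.M.M.minus_other_side[OF xy(1,2)] by blast
  qed
  have "inj_on h (carrier ?L)" using inj by (rule inj_onI)
  then have "bij_betw h (carrier ?L) (carrier N)" using surj by (rule bij_betw_imageI)
  with L h(1) show ?thesis by (rule that)
qed

theorem theorem5p3:
  fixes R :: "('a, 'r) ring_scheme"
    and M :: "('a, 'm) module"
    and N :: "('a, 'n) module"
    and d :: nat
  assumes "noetherian_local_ring R"
    and "krull_dim R = enat d"
    and "module R M" and "finitely_generated R M" and "carrier M \<noteq> {\<zero>\<^bsub>M\<^esub>}"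
    and "module R N" and "finitely_generated R N" and "carrier N \<noteq> {\<zero>\<^bsub>N\<^esub>}"
  shows "(BEH_conjecture R \<and> finite_length R N \<and> proj_dim R N < \<infinity> \<longrightarrow>
            (\<forall>i. 1 \<le> i \<and> enat i \<le> depth R \<longrightarrow>
               betti (R \<ltimes> M) i (restrict_scalars fst N) \<ge> d choose i))
       \<and> (total_rank_conjecture R \<and> finite_length R N \<and> proj_dim R N < \<infinity> \<longrightarrow>
            (\<Sum>i. enat (betti (R \<ltimes> M) i (restrict_scalars fst N))) \<ge> 2 ^ d)"
proof -
  interpret idealization_local R M
    by (intro idealization_local.intro idealization_module.intro assms(1,3))
  \<comment> \<open>\<open>N\<close> may have any element type; the conjectures are applied to its
    copy \<open>L\<close>.\<close>
  obtain L :: "('a, (nat \<Rightarrow> 'a) set) module" and h where L: "module R L"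
    and h: "h \<in> module_hom R L N" and bij: "bij_betw h (carrier L) (carrier N)"
    by (rule finitely_generated_model[OF assms(6,7)])
  have L0: "carrier L \<noteq> {\<zero>\<^bsub>L\<^esub>}"
  proof
    assume "carrier L = {\<zero>\<^bsub>L\<^esub>}"
    then have "carrier N = {h \<zero>\<^bsub>L\<^esub>}" using bij_betw_imp_surj_on[OF bij] by simp
    also have "h \<zero>\<^bsub>L\<^esub> = \<zero>\<^bsub>N\<^esub>" by (rule mod_hom.f0_is_0[OF mod_homI[OF L assms(6) h]])
    finally show False using assms(8) by simp
  qed
  note Lfg = finitely_generated_iso[OF L assms(6) h bij assms(7)]
  have model: "module R L \<and> carrier L \<noteq> {\<zero>\<^bsub>L\<^esub>} \<and> finitely_generated R L \<and>
      finite_length R L \<and> proj_dim R L < \<infinity>" if "finite_length R N" "proj_dim R N < \<infinity>"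
    using L L0 Lfg finite_length_iso[OF L assms(6) h bij that(1)] that(2)
    by (simp add: proj_dim_iso[OF L assms(6) h bij])
  have ge: "betti R i L \<le> betti (R \<ltimes> M) i (restrict_scalars fst N)" if "proj_dim R N < \<infinity>" for i
  proof -
    \<comment> \<open>An infimum below infinity comes from a nonempty set, and any member carries a
      resolution in the type required by \<open>Tor\<close>.\<close>
    from that[unfolded proj_dim_def Inf_less_iff] obtain P :: "nat \<Rightarrow> ('a, nat \<Rightarrow> 'a) module" and d \<epsilon>
      where "projective_resolution R N P d \<epsilon>" by (elim bexE CollectE exE conjE)
    then show ?thesis unfolding betti_iso[OF L assms(6) h bij]
      by (rule betti_idealization_ge[OF assms(4,6,7)])
  qed
  show ?thesis
  proof (intro conjI impI allI; elim conjE)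
    fix i assume "BEH_conjecture R" and fin: "finite_length R N" "proj_dim R N < \<infinity>"
    then have "d choose i \<le> betti R i L"
      using assms(2) model unfolding BEH_conjecture_def by simp
    then show "d choose i \<le> betti (R \<ltimes> M) i (restrict_scalars fst N)"
      using ge[OF fin(2)] by (rule order_trans)
  next
    assume "total_rank_conjecture R" and fin: "finite_length R N" "proj_dim R N < \<infinity>"
    then have "2 ^ d \<le> (\<Sum>i. enat (betti R i L))"
      using assms(2) model unfolding total_rank_conjecture_def by simp
    \<comment> \<open>Series of extended naturals always have a sum, so a termwise comparison is
      enough.\<close>
    also have "\<dots> \<le> (\<Sum>i. enat (betti (R \<ltimes> M) i (restrict_scalars fst N)))"
      by (rule suminf_le) (simp_all add: ge[OF fin(2)] summableI)
    finally show "2 ^ d \<le> (\<Sum>i. enat (betti (R \<ltimes> M) i (restrict_scalars fst N)))" .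
  qed
qed

end
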